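(* Let $(n_m)$ be a sequence of positive integers with $n_m/m\to1$ as $m\to\infty$. Then $\sqrt{m\log m}\,R_m\to2\sqrt2$ in $\mu_{m,n_m}$-measure; that is, for every $\varepsilon>0$, $$\mu_{m,n_m}\left\{a:\left|\sqrt{m\log m}\,R_m(a)-2\sqrt2\right|>\varepsilon\right\}\to0\qquad(m\to\infty).$$
   Context: $\mathcal M_{m,n}:=\{\alpha\in\mathbb N_0^n:|\alpha|=m\}$ and $q_m:=2m/(m+1)$. For $a=(a_\alpha)_{|\alpha|=m}\in\mathbb C^{\mathcal M_{m,n}}$, $\|a\|_p:=(\sum_\alpha|a_\alpha|^p)^{1/p}$, $P_a(z):=\sum_{|\alpha|=m}a_\alpha z^\alpha$, $\|P_a\|_\infty$ is the supremum of $|P_a|$ over the unit polydisc of $\mathbb C^n$, and $R_m(a):=\|a\|_{q_m}/\|P_a\|_\infty$ for $a\ne0$. $\mu_{m,n}$ is normalized (total mass one) Euclidean surface measure on the unit sphere $\{a\in\mathbb C^{\mathcal M_{m,n}}:\|a\|_2=1\}$, where $\mathbb C^{\mathcal M_{m,n}}$ is regarded as a real Euclidean space. *)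

theory Defs
  imports "HOL-Probability.Probability"
begin

text \<open>A multi-index in \<open>\<nat>\<^sub>0\<^sup>n\<close> is a function on all of \<^typ>\<open>nat\<close> that vanishes from \<open>n\<close> on.\<close>

definition multi_indices :: "nat \<Rightarrow> nat \<Rightarrow> (nat \<Rightarrow> nat) set" where
  "multi_indices m n = {\<alpha>. (\<forall>i\<ge>n. \<alpha> i = 0) \<and> (\<Sum>i<n. \<alpha> i) = m}"

definition lp_norm :: "real \<Rightarrow> 'i set \<Rightarrow> ('i \<Rightarrow> complex) \<Rightarrow> real" where
  "lp_norm p I a = (\<Sum>i\<in>I. cmod (a i) powr p) powr (1 / p)"

definition hom_poly :: "nat \<Rightarrow> nat \<Rightarrow> ((nat \<Rightarrow> nat) \<Rightarrow> complex) \<Rightarrow> (nat \<Rightarrow> complex) \<Rightarrow> complex" where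
  "hom_poly m n a z = (\<Sum>\<alpha>\<in>multi_indices m n. a \<alpha> * (\<Prod>i<n. z i ^ \<alpha> i))"

definition polydisc :: "nat \<Rightarrow> (nat \<Rightarrow> complex) set" where
  "polydisc n = {..<n} \<rightarrow>\<^sub>E ball 0 1"

definition poly_sup_norm :: "nat \<Rightarrow> nat \<Rightarrow> ((nat \<Rightarrow> nat) \<Rightarrow> complex) \<Rightarrow> real" where
  "poly_sup_norm m n a = (SUP z\<in>polydisc n. cmod (hom_poly m n a z))"

definition R_quot :: "nat \<Rightarrow> nat \<Rightarrow> ((nat \<Rightarrow> nat) \<Rightarrow> complex) \<Rightarrow> real" where
  "R_quot m n a =
     lp_norm (2 * real m / (real m + 1)) (multi_indices m n) a / poly_sup_norm m n a"

text \<open>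
  The space \<open>\<complex>\<^sup>I\<close> is modelled by the extensional functions on the finite set \<open>I\<close>, with Lebesgue
  measure the product of the planar Lebesgue measures; its real dimension is \<open>2 * card I\<close>.
\<close>

definition coeff_lborel :: "'i set \<Rightarrow> ('i \<Rightarrow> complex) measure" where
  "coeff_lborel I = Pi\<^sub>M I (\<lambda>_. lborel)"

definition unit_sphere :: "'i set \<Rightarrow> ('i \<Rightarrow> complex) set" where
  "unit_sphere I = {a \<in> I \<rightarrow>\<^sub>E UNIV. lp_norm 2 I a = 1}"

definition punctured_ball :: "'i set \<Rightarrow> ('i \<Rightarrow> complex) set" where
  "punctured_ball I = {a \<in> I \<rightarrow>\<^sub>E UNIV. 0 < lp_norm 2 I a \<and> lp_norm 2 I a \<le> 1}"

definition radial_proj :: "'i set \<Rightarrow> ('i \<Rightarrow> complex) \<Rightarrow> ('i \<Rightarrow> complex)" where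
  "radial_proj I a = (\<lambda>i\<in>I. a i / of_real (lp_norm 2 I a))"

text \<open>
  Surface measure on the unit sphere of a \<open>d\<close>-dimensional Euclidean space, from polar coordinates:
  \<open>\<sigma>(A) = d * vol {r x | 0 < r \<le> 1, x \<in> A}\<close>.  The cone over \<open>A\<close> is the set of points of the
  punctured unit ball whose radial projection lies in \<open>A\<close>; see \<open>emeasure_sphere_surface_measure\<close>.
\<close>

definition sphere_surface_measure :: "'i set \<Rightarrow> ('i \<Rightarrow> complex) measure" where
  "sphere_surface_measure I =
     scale_measure (of_nat (2 * card I))
       (distr (restrict_space (coeff_lborel I) (punctured_ball I))
              (restrict_space (coeff_lborel I) (unit_sphere I))
              (radial_proj I))"

definition normalized_sphere_measure :: "'i set \<Rightarrow> ('i \<Rightarrow> complex) measure" where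
  "normalized_sphere_measure I =
     uniform_measure (sphere_surface_measure I) (unit_sphere I)"

definition mu :: "nat \<Rightarrow> nat \<Rightarrow> ((nat \<Rightarrow> nat) \<Rightarrow> complex) measure" where
  "mu m n = normalized_sphere_measure (multi_indices m n)"


lemma finite_multi_indices: "finite (multi_indices m n)"
proof -
  have "multi_indices m n \<subseteq> {f. \<forall>x. (x \<in> {..<n} \<longrightarrow> f x \<in> {..m}) \<and> (x \<notin> {..<n} \<longrightarrow> f x = 0)}"
    by (auto simp: multi_indices_def intro: member_le_sum)
  then show ?thesis
    by (rule finite_subset) (rule finite_set_of_finite_funs; simp)
qed

lemma multi_indices_nonempty:
  assumes "0 < n"
  shows "multi_indices m n \<noteq> {}"
proof -
  have "(\<lambda>i. if i = 0 then m else 0) \<in> multi_indices m n"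
    using assms by (auto simp: multi_indices_def)
  then show ?thesis by blast
qed

lemma space_coeff_lborel: "space (coeff_lborel I) = I \<rightarrow>\<^sub>E UNIV"
  by (simp add: coeff_lborel_def space_PiM)

lemma measurable_coeff [measurable]:
  "i \<in> I \<Longrightarrow> (\<lambda>a. a i) \<in> borel_measurable (coeff_lborel I)"
  unfolding coeff_lborel_def by measurable

lemma measurable_lp_norm [measurable]: "lp_norm p I \<in> borel_measurable (coeff_lborel I)"
  unfolding lp_norm_def[abs_def] by measurable

lemma sets_unit_sphere [measurable]: "unit_sphere I \<in> sets (coeff_lborel I)"
  unfolding unit_sphere_def space_coeff_lborel[symmetric] by measurable

lemma sets_punctured_ball [measurable]: "punctured_ball I \<in> sets (coeff_lborel I)"
  unfolding punctured_ball_def space_coeff_lborel[symmetric] by measurable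

lemma lp_norm_2: "lp_norm 2 I a = sqrt (\<Sum>i\<in>I. (cmod (a i))\<^sup>2)"
  by (simp add: lp_norm_def powr_half_sqrt sum_nonneg)

lemma radial_proj_in_sphere:
  assumes "a \<in> punctured_ball I"
  shows "radial_proj I a \<in> unit_sphere I"
proof -
  have pos: "0 < lp_norm 2 I a"
    using assms by (simp add: punctured_ball_def)
  have "(\<Sum>i\<in>I. (cmod (radial_proj I a i))\<^sup>2)
      = (\<Sum>i\<in>I. (cmod (a i))\<^sup>2) / (lp_norm 2 I a)\<^sup>2"
    by (simp add: radial_proj_def norm_divide power_divide sum_divide_distrib)
  also have "\<dots> = 1"
    using pos by (simp add: lp_norm_2 sum_nonneg)
  finally have "lp_norm 2 I (radial_proj I a) = 1"
    by (simp add: lp_norm_2)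
  then show ?thesis
    by (simp add: unit_sphere_def radial_proj_def)
qed

lemma measurable_radial_proj:
  "radial_proj I \<in> restrict_space (coeff_lborel I) (punctured_ball I)
     \<rightarrow>\<^sub>M restrict_space (coeff_lborel I) (unit_sphere I)"
proof (rule measurable_restrict_space2)
  show "radial_proj I \<in> space (restrict_space (coeff_lborel I) (punctured_ball I)) \<rightarrow> unit_sphere I"
    by (auto simp: space_restrict_space radial_proj_in_sphere)
  have "radial_proj I \<in> coeff_lborel I \<rightarrow>\<^sub>M Pi\<^sub>M I (\<lambda>_. lborel)"
    unfolding radial_proj_def[abs_def] by (rule measurable_restrict) measurable
  then show "radial_proj I \<in> restrict_space (coeff_lborel I) (punctured_ball I) \<rightarrow>\<^sub>M coeff_lborel I"
    unfolding coeff_lborel_def by (rule measurable_restrict_space1)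
qed

lemma space_sphere_surface_measure [simp]: "space (sphere_surface_measure I) = unit_sphere I"
  unfolding sphere_surface_measure_def
  by (auto simp: space_scale_measure space_restrict_space space_coeff_lborel unit_sphere_def)

lemma sets_sphere_surface_measure [simp, measurable_cong]:
  "sets (sphere_surface_measure I) = sets (restrict_space (coeff_lborel I) (unit_sphere I))"
  unfolding sphere_surface_measure_def by simp

lemma cone_eq:
  assumes "A \<subseteq> unit_sphere I"
  shows "{a \<in> punctured_ball I. radial_proj I a \<in> A}
       = {(\<lambda>i\<in>I. of_real r * x i) | r x. 0 < r \<and> r \<le> 1 \<and> x \<in> A}" (is "?L = ?R")
proof (intro set_eqI iffI)
  fix a assume a: "a \<in> ?L"
  then have "a = (\<lambda>i\<in>I. of_real (lp_norm 2 I a) * radial_proj I a i)"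
    by (auto simp: radial_proj_def punctured_ball_def PiE_def extensional_def fun_eq_iff)
  with a show "a \<in> ?R"
    by (auto simp: punctured_ball_def)
next
  fix a assume "a \<in> ?R"
  then obtain r x where r: "0 < r" "r \<le> 1" and x: "x \<in> A"
    and a: "a = (\<lambda>i\<in>I. of_real r * x i)" by auto
  have xs: "x \<in> I \<rightarrow>\<^sub>E UNIV" "lp_norm 2 I x = 1"
    using assms x by (auto simp: unit_sphere_def)
  have "(\<Sum>i\<in>I. (cmod (a i))\<^sup>2) = r\<^sup>2 * (\<Sum>i\<in>I. (cmod (x i))\<^sup>2)"
    by (simp add: a norm_mult power_mult_distrib sum_distrib_left)
  then have na: "lp_norm 2 I a = r"
    using xs(2) r by (simp add: lp_norm_2 real_sqrt_mult)
  have "radial_proj I a = x"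
    using xs(1) r unfolding radial_proj_def na
    by (auto simp: a fun_eq_iff PiE_def extensional_def)
  then show "a \<in> ?L"
    using na r x by (auto simp: punctured_ball_def a)
qed

lemma emeasure_sphere_surface_measure:
  assumes "A \<in> sets (sphere_surface_measure I)"
  shows "emeasure (sphere_surface_measure I) A =
     of_nat (2 * card I) * emeasure (coeff_lborel I)
       {(\<lambda>i\<in>I. of_real r * x i) | r x. 0 < r \<and> r \<le> 1 \<and> x \<in> A}"
proof -
  have A: "A \<in> sets (restrict_space (coeff_lborel I) (unit_sphere I))"
    using assms by simp
  have sub: "A \<subseteq> unit_sphere I"
    using sets.sets_into_space[OF assms] by simp
  have "radial_proj I -` A \<inter> space (restrict_space (coeff_lborel I) (punctured_ball I))
      = {a \<in> punctured_ball I. radial_proj I a \<in> A}"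
    by (auto simp: space_restrict_space space_coeff_lborel punctured_ball_def)
  then show ?thesis
    unfolding sphere_surface_measure_def cone_eq[OF sub, symmetric]
    using A by (simp add: emeasure_distr[OF measurable_radial_proj] emeasure_restrict_space)
qed

lemma emeasure_punctured_ball:
  fixes I :: "'i set"
  assumes I: "finite I" "I \<noteq> {}"
  shows "emeasure (coeff_lborel I) (punctured_ball I) \<noteq> 0"
    and "emeasure (coeff_lborel I) (punctured_ball I) \<noteq> \<infinity>"
proof -
  interpret product_sigma_finite "\<lambda>_::'i. lborel :: complex measure" ..
  define c where "c = 1 / (2 * real (card I))"
  define B where "B = ball (complex_of_real c) c"
  have card: "0 < card I" using I by (simp add: card_gt_0_iff)
  have c: "0 < c" using card by (simp add: c_def)
  have box: "emeasure (coeff_lborel I) (I \<rightarrow>\<^sub>E U) = emeasure lborel U ^ card I"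
    if "U \<in> sets lborel" for U
    unfolding coeff_lborel_def using emeasure_PiM[of I "\<lambda>_. U"] that I by simp
  have low: "(I \<rightarrow>\<^sub>E B) \<subseteq> punctured_ball I"
  proof
    fix a assume a: "a \<in> I \<rightarrow>\<^sub>E B"
    have B: "0 < cmod (a i) \<and> cmod (a i) \<le> 1 / real (card I)" if "i \<in> I" for i
    proof -
      have *: "dist (complex_of_real c) (a i) < c"
        using a that by (auto simp: B_def)
      have "a i \<noteq> 0" using * c by auto
      moreover have "cmod (a i) \<le> cmod (complex_of_real c) + dist (complex_of_real c) (a i)"
        by (metis dist_commute dist_norm norm_triangle_sub)
      moreover have "cmod (complex_of_real c) = c" using c by simp
      ultimately have "a i \<noteq> 0 \<and> cmod (a i) \<le> 2 * c" using * by linarith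
      then show ?thesis by (simp add: c_def)
    qed
    have le1: "cmod (a i) \<le> 1" if "i \<in> I" for i
    proof -
      have "1 / real (card I) \<le> 1" using card by (simp add: field_simps)
      then show ?thesis using B[OF that] by linarith
    qed
    have "(\<Sum>i\<in>I. (cmod (a i))\<^sup>2) \<le> (\<Sum>i\<in>I. 1 / real (card I))"
    proof (rule sum_mono)
      fix i assume i: "i \<in> I"
      have "(cmod (a i))\<^sup>2 \<le> cmod (a i)"
        using le1[OF i] by (simp add: power2_eq_square mult_left_le)
      then show "(cmod (a i))\<^sup>2 \<le> 1 / real (card I)" using B[OF i] by linarith
    qed
    then have "(\<Sum>i\<in>I. (cmod (a i))\<^sup>2) \<le> 1" using card by simp
    moreover have "0 < (\<Sum>i\<in>I. (cmod (a i))\<^sup>2)"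
      using I B by (intro sum_pos) auto
    ultimately show "a \<in> punctured_ball I"
      using a by (auto simp: punctured_ball_def lp_norm_2)
  qed
  have "emeasure lborel B \<noteq> 0"
    using c by (simp add: B_def emeasure_ball ennreal_eq_0_iff not_le)
  then have "0 < emeasure lborel B ^ card I"
    unfolding zero_less_iff_neq_zero by simp
  also have "\<dots> = emeasure (coeff_lborel I) (I \<rightarrow>\<^sub>E B)"
    by (rule box[symmetric]) (simp add: B_def)
  also have "\<dots> \<le> emeasure (coeff_lborel I) (punctured_ball I)"
    by (rule emeasure_mono[OF low]) measurable
  finally show "emeasure (coeff_lborel I) (punctured_ball I) \<noteq> 0" by simp
  have up: "punctured_ball I \<subseteq> I \<rightarrow>\<^sub>E cball 0 1"
  proof
    fix a assume a: "a \<in> punctured_ball I"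
    have "cmod (a i) \<le> 1" if "i \<in> I" for i
    proof -
      have "(cmod (a i))\<^sup>2 \<le> (\<Sum>i\<in>I. (cmod (a i))\<^sup>2)"
        using that I by (intro member_le_sum) auto
      also have "\<dots> \<le> 1" using a by (simp add: punctured_ball_def lp_norm_2)
      finally show ?thesis by (simp add: abs_square_le_1)
    qed
    then show "a \<in> I \<rightarrow>\<^sub>E cball 0 1"
      using a by (auto simp: punctured_ball_def PiE_def)
  qed
  have "emeasure (coeff_lborel I) (punctured_ball I) \<le> emeasure (coeff_lborel I) (I \<rightarrow>\<^sub>E cball 0 1)"
    by (rule emeasure_mono[OF up]) (simp add: coeff_lborel_def sets_PiM_I_finite I)
  also have "\<dots> = emeasure lborel (cball 0 1 :: complex set) ^ card I"
    by (rule box) simp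
  also have "\<dots> < \<infinity>"
    using emeasure_lborel_cball_finite[of "0::complex" 1] by (simp add: power_less_top_ennreal)
  finally show "emeasure (coeff_lborel I) (punctured_ball I) \<noteq> \<infinity>" by simp
qed

lemma prob_space_normalized_sphere_measure:
  assumes I: "finite I" "I \<noteq> {}"
  shows "prob_space (normalized_sphere_measure I)"
proof -
  have S: "unit_sphere I \<in> sets (sphere_surface_measure I)"
    using sets.top[of "sphere_surface_measure I"] by simp
  have "{(\<lambda>i\<in>I. of_real r * x i) | r x. 0 < r \<and> r \<le> 1 \<and> x \<in> unit_sphere I} = punctured_ball I"
    unfolding cone_eq[OF order_refl, symmetric] using radial_proj_in_sphere by blast
  then have e: "emeasure (sphere_surface_measure I) (unit_sphere I)
      = of_nat (2 * card I) * emeasure (coeff_lborel I) (punctured_ball I)"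
    using emeasure_sphere_surface_measure[OF S] by simp
  have "emeasure (sphere_surface_measure I) (unit_sphere I) \<noteq> 0"
    unfolding e using I emeasure_punctured_ball(1)[OF I] by simp
  moreover have "emeasure (sphere_surface_measure I) (unit_sphere I) \<noteq> \<infinity>"
    unfolding e using emeasure_punctured_ball(2)[OF I]
    by (simp add: ennreal_mult_eq_top_iff ennreal_of_nat_neq_top)
  ultimately show ?thesis
    unfolding normalized_sphere_measure_def by (rule prob_space_uniform_measure)
qed

lemma space_mu [simp]: "space (mu m n) = unit_sphere (multi_indices m n)"
  by (simp add: mu_def normalized_sphere_measure_def)

lemma prob_space_mu: "0 < n \<Longrightarrow> prob_space (mu m n)"
  unfolding mu_def
  by (intro prob_space_normalized_sphere_measure finite_multi_indices multi_indices_nonempty)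

lemma polydisc_nonempty: "polydisc n \<noteq> {}"
  by (auto simp: polydisc_def PiE_eq_empty_iff)

lemma bdd_above_hom_poly: "bdd_above ((\<lambda>z. cmod (hom_poly m n a z)) ` polydisc n)"
proof (rule bdd_aboveI2)
  fix z assume z: "z \<in> polydisc n"
  show "cmod (hom_poly m n a z) \<le> (\<Sum>\<alpha>\<in>multi_indices m n. cmod (a \<alpha>))"
    unfolding hom_poly_def
  proof (rule sum_norm_le)
    fix \<alpha>
    have "cmod (z i) \<le> 1" if "i < n" for i
      using z that by (force simp: polydisc_def PiE_iff)
    then have "(\<Prod>i<n. cmod (z i) ^ \<alpha> i) \<le> 1"
      by (intro prod_le_1) (simp add: power_le_one)
    then show "cmod (a \<alpha> * (\<Prod>i<n. z i ^ \<alpha> i)) \<le> cmod (a \<alpha>)"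
      using mult_left_le[of "\<Prod>i<n. cmod (z i) ^ \<alpha> i" "cmod (a \<alpha>)"]
      by (simp only: norm_mult prod_norm[symmetric] norm_power norm_ge_zero)
  qed
qed

lemma measurable_poly_sup_norm [measurable]:
  "poly_sup_norm m n \<in> borel_measurable (coeff_lborel (multi_indices m n))" (is "_ \<in> borel_measurable ?M")
proof -
  obtain T where T: "countable T" "T \<subseteq> polydisc n" "polydisc n \<subseteq> closure T"
    by (rule separable[of "polydisc n"])
  have meas [measurable]: "(\<lambda>a. hom_poly m n a z) \<in> borel_measurable ?M" for z
    unfolding hom_poly_def by measurable
  have "{a \<in> space ?M. c < poly_sup_norm m n a}
      = (\<Union>z\<in>T. {a \<in> space ?M. c < cmod (hom_poly m n a z)})" for c
  proof -
    have "(c < poly_sup_norm m n a) = (\<exists>z\<in>T. c < cmod (hom_poly m n a z))" for a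
    proof
      assume "c < poly_sup_norm m n a"
      then obtain z where z: "z \<in> polydisc n" "c < cmod (hom_poly m n a z)"
        unfolding poly_sup_norm_def
        by (auto simp: less_cSUP_iff[OF polydisc_nonempty bdd_above_hom_poly])
      have cont: "continuous_on UNIV (\<lambda>z. cmod (hom_poly m n a z))"
        unfolding hom_poly_def by (intro continuous_intros continuous_on_product_coordinates)
      have "open {z. c < cmod (hom_poly m n a z)}"
        by (rule open_Collect_less[OF continuous_on_const cont])
      moreover have "z \<in> closure T" using T z by blast
      ultimately show "\<exists>z\<in>T. c < cmod (hom_poly m n a z)"
        using z open_Int_closure_eq_empty[of "{z. c < cmod (hom_poly m n a z)}" T] by blast
    next
      assume "\<exists>z\<in>T. c < cmod (hom_poly m n a z)"
      then show "c < poly_sup_norm m n a"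
        using T(2) unfolding poly_sup_norm_def
        by (auto simp: less_cSUP_iff[OF polydisc_nonempty bdd_above_hom_poly])
    qed
    then show ?thesis by auto
  qed
  moreover have "(\<Union>z\<in>T. {a \<in> space ?M. c < cmod (hom_poly m n a z)}) \<in> sets ?M" for c
    using T(1) by (intro sets.countable_UN'') measurable
  ultimately show ?thesis
    by (simp add: borel_measurable_iff_greater)
qed

text \<open>
  Since \<^const>\<open>measure\<close> vanishes on non-measurable sets, it matters that \<^const>\<open>R_quot\<close> is measurable.
\<close>

lemma measurable_R_quot [measurable]: "R_quot m n \<in> borel_measurable (mu m n)"
proof -
  have "R_quot m n \<in> borel_measurable (coeff_lborel (multi_indices m n))"
    unfolding R_quot_def[abs_def] by measurable
  then have "R_quot m n \<in> borel_measurable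
      (restrict_space (coeff_lborel (multi_indices m n)) (unit_sphere (multi_indices m n)))"
    by (rule measurable_restrict_space1)
  moreover have eq: "sets (mu m n) = sets
      (restrict_space (coeff_lborel (multi_indices m n)) (unit_sphere (multi_indices m n)))"
    unfolding mu_def normalized_sphere_measure_def
    by (simp only: sets_uniform_measure sets_sphere_surface_measure)
  ultimately show ?thesis
    unfolding measurable_cong_sets[OF eq refl] by simp
qed

end

theory Submission
  imports Defs "HOL-Complex_Analysis.Complex_Analysis" "HOL-Real_Asymp.Real_Asymp"
begin

text \<open>
  \<open>R_quot\<close> is invariant under scaling, so the coefficients may be taken to be independent complex
  Gaussians \<open>a\<^sub>\<alpha>\<close> with \<open>E\<bar>a\<^sub>\<alpha>\<bar>\<^sup>2 = 2\<close>.  Let \<open>N\<close> be the number of multi-indices.  By Chebyshev's inequality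
  \<open>\<Sum>\<bar>a\<^sub>\<alpha>\<bar>\<^sup>q\<close> is close to \<open>2N\<close>, and \<open>N powr (1 / (2m))\<close> tends to 2 since \<open>N\<close> is nearly \<open>4 ^ m\<close>.  It remains
  to see that the supremum norm is close to \<open>sqrt (N m ln m)\<close>.  At a point of the torus the polynomial
  is Gaussian of size \<open>sqrt N\<close>, and its increments are controlled by the Euclidean distance
  of the arguments modulo global rotation, so about \<open>m powr (m / 2)\<close> points matter.

  For the upper bound, a union bound over a grid of mesh \<open>m powr (- 1 / 2 - \<epsilon>)\<close> handles the
  main term; a much finer grid controls the supremum over the polydisc deterministically,
  and the increments from the fine to the coarse grid are so small that a crude union bound suffices.
  For the lower bound, take a grid of mesh \<open>m powr (- 1 / 2 + \<epsilon>)\<close>.  The correlation of two values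
  is a normalised complete homogeneous symmetric polynomial, which by Cauchy's inequality
  is tiny unless the two points almost agree up to a rotation, and the
  second moment method applies to the number of large values.
\<close>

section \<open>Gaussian vectors\<close>

text \<open>The scale \<open>sqrt (N m ln m)\<close> is the size of the maximum of
  \<open>m powr (m / 2)\<close> nearly independent real Gaussians of variance \<open>N\<close>,
  namely \<open>sqrt (2 N (m / 2) ln m)\<close>. Changing the mesh exponent by \<epsilon> changes
  the logarithm of the number of points only by a relative amount of order \<epsilon>. The
  coefficient norm is about \<open>(2 N) powr (1 / q)\<close> with
  \<open>1 / q = 1 / 2 + 1 / (2 m)\<close>: the factor \<open>sqrt N\<close> cancels,
  \<open>sqrt 2\<close> survives, and \<open>N powr (1 / (2 m))\<close> supplies the remaining 2.
  The obstacle is the common rotation. The exponents of a monomial add up to \<open>m\<close>, so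
  shifting every argument by \<delta> changes its phase by \<open>m\<close> times \<delta>, far more
  than the order \<open>sqrt m\<close> times \<delta> typical of shifts with mean zero. Rotations
  leave the modulus unchanged, however, so they can be divided out: in the upper bound by
  subtracting the mean difference of the arguments, in the lower bound by discarding pairs of grid
  points whose quotients are almost constant. Writing the number of variables as
  \<open>Suc k\<close> makes \<open>N\<close> the binomial coefficient
  \<open>m + k choose m\<close>.\<close>

lemma iexp_eq_cis: "iexp x = cis x"
  by (simp add: cis_conv_exp)

text \<open>A positive weight turns the hypothesis into equality of two characteristic functions, so
  that the one-dimensional uniqueness theorem also yields statements about joint laws.\<close>

lemma weighted_std_normal:
  fixes U w :: "'a \<Rightarrow> real"
  assumes "prob_space M" and [measurable]: "U \<in> borel_measurable M"
    and w: "integrable M w" "\<And>x. 0 \<le> w x"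
    and char: "\<And>u. (\<integral>x. complex_of_real (w x) * iexp (u * U x) \<partial>M) =
      complex_of_real ((\<integral>x. w x \<partial>M) * exp (- u\<^sup>2 / 2))"
    and [measurable]: "A \<in> sets borel"
  shows "(\<integral>x. w x * indicator A (U x) \<partial>M) = (\<integral>x. w x \<partial>M) * measure std_normal_distribution A"
proof -
  interpret prob_space M by fact
  have [measurable]: "w \<in> borel_measurable M" using w by simp
  define c where "c = (\<integral>x. w x \<partial>M)"
  have c0: "0 \<le> c" unfolding c_def by (simp add: w)
  show ?thesis
  proof (cases "c = 0")
    case True
    then have "AE x in M. w x = 0"
      using integral_nonneg_eq_0_iff_AE[OF w(1)] w(2) by (simp add: c_def)
    then have "(\<integral>x. w x * indicator A (U x) \<partial>M) = (\<integral>x. 0 \<partial>M)"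
      by (intro integral_cong_AE) auto
    then show ?thesis using True by (simp add: c_def)
  next
    case False
    then have c: "c > 0" using c0 by simp
    define D where "D = density M (\<lambda>x. ennreal (w x / c))"
    have int: "(\<integral>\<^sup>+x. ennreal (w x / c) \<partial>M) = ennreal (\<integral>x. w x / c \<partial>M)"
      using c w by (intro nn_integral_eq_integral) auto
    have "prob_space D"
      using int c by (intro prob_spaceI) (simp add: D_def emeasure_density c_def cong: nn_integral_cong)
    then interpret D: prob_space D .
    have [measurable]: "U \<in> borel_measurable D" by (simp add: D_def)
    have rd: "real_distribution (distr D borel U)" by (rule D.real_distribution_distr) simp
    have "char (distr D borel U) u = char std_normal_distribution u" for u
    proof -
      have "char (distr D borel U) u = (\<integral>x. iexp (u * U x) \<partial>D)"
        by (simp add: char_def integral_distr)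
      also have "\<dots> = (\<integral>x. (w x / c) *\<^sub>R iexp (u * U x) \<partial>M)"
        unfolding D_def
      proof (rule integral_density)
        show "AE x in M. 0 \<le> w x / c" using c w(2) by (intro AE_I2 divide_nonneg_pos)
      qed measurable
      also have "\<dots> = (\<integral>x. (1 / complex_of_real c) * (complex_of_real (w x) * iexp (u * U x)) \<partial>M)"
        by (simp add: scaleR_conv_of_real)
      also have "\<dots> = (1 / complex_of_real c) * (\<integral>x. complex_of_real (w x) * iexp (u * U x) \<partial>M)"
        by (rule integral_mult_right_zero)
      also have "\<dots> = exp (- u\<^sup>2 / 2)"
        unfolding char using c by (simp flip: c_def)
      finally show ?thesis by (simp add: char_std_normal_distribution)
    qed
    then have "distr D borel U = std_normal_distribution"
      by (intro Levy_uniqueness rd real_dist_normal_dist) auto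
    then have "measure std_normal_distribution A = measure (distr D borel U) A" by simp
    also have "\<dots> = measure D (U -` A \<inter> space M)"
      by (subst measure_distr) (auto simp: D_def)
    also have "\<dots> = (\<integral>x. indicator (U -` A \<inter> space M) x \<partial>D)"
      by (simp add: D_def)
    also have "\<dots> = (\<integral>x. (w x / c) *\<^sub>R indicator (U -` A \<inter> space M) x \<partial>M)"
      unfolding D_def
    proof (rule integral_density)
      show "AE x in M. 0 \<le> w x / c" using c w(2) by (intro AE_I2 divide_nonneg_pos)
    qed measurable
    also have "\<dots> = (\<integral>x. (1 / c) * (w x * indicator A (U x)) \<partial>M)"
      by (intro Bochner_Integration.integral_cong) (auto simp: indicator_def)
    also have "\<dots> = (1 / c) * (\<integral>x. w x * indicator A (U x) \<partial>M)"
      by (rule integral_mult_right_zero)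
    finally show ?thesis using c by (simp add: field_simps flip: c_def)
  qed
qed

lemma std_normal_of_char:
  fixes U :: "'a \<Rightarrow> real"
  assumes M: "prob_space M" and U: "U \<in> borel_measurable M"
    and char: "\<And>u. (\<integral>x. iexp (u * U x) \<partial>M) = complex_of_real (exp (- u\<^sup>2 / 2))"
    and A [measurable]: "A \<in> sets borel"
  shows "measure M {x \<in> space M. U x \<in> A} = measure std_normal_distribution A"
proof -
  interpret prob_space M by fact
  have [measurable]: "U \<in> borel_measurable M" by fact
  have "(\<integral>x. 1 * indicator A (U x) \<partial>M) = (\<integral>x. 1 \<partial>M) * measure std_normal_distribution A"
    by (rule weighted_std_normal[OF M U _ _ _ A]) (simp_all only: char of_real_1 mult_1 prob_space, simp_all add: prob_space)
  also have "(\<integral>x. 1 * indicator A (U x) \<partial>M) = (\<integral>x. indicator {x \<in> space M. U x \<in> A} x \<partial>M :: real)"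
    by (intro Bochner_Integration.integral_cong) (auto simp: indicator_def)
  also have "\<dots> = measure M {x \<in> space M. U x \<in> A}" by simp
  finally show ?thesis by (simp add: prob_space)
qed

text \<open>Two applications of \<open>weighted_std_normal\<close> replace uniqueness for planar
  laws. The weights \<open>1 + cos (v * V x)\<close> and \<open>1 + sin (v * V x)\<close> are
  nonnegative and yield the integrals of cosine and sine over the event that \<open>U\<close> lies
  in \<open>A\<close>. These are the real and imaginary parts of the characteristic function of
  \<open>V\<close> with weight \<open>indicator A (U x)\<close>, to which the lemma applies
  again.\<close>

lemma indep_std_normal_of_char:
  fixes U V :: "'a \<Rightarrow> real"
  assumes M: "prob_space M" and U: "U \<in> borel_measurable M" and V: "V \<in> borel_measurable M"
    and char: "\<And>u v. (\<integral>x. iexp (u * U x + v * V x) \<partial>M) = complex_of_real (exp (- (u\<^sup>2 + v\<^sup>2) / 2))"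
    and A [measurable]: "A \<in> sets borel" and B [measurable]: "B \<in> sets borel"
  shows "measure M {x \<in> space M. U x \<in> A \<and> V x \<in> B} =
    measure std_normal_distribution A * measure std_normal_distribution B"
proof -
  interpret prob_space M by fact
  have [measurable]: "U \<in> borel_measurable M" "V \<in> borel_measurable M" by fact+
  let ?N = "measure std_normal_distribution"
  have icis: "integrable M (\<lambda>x. iexp (f x))" if [measurable]: "f \<in> borel_measurable M" for f :: "'a \<Rightarrow> real"
    by (rule integrable_const_bound[where B=1]) auto
  have irw: "integrable M (\<lambda>x. g x * h x)"
    if "integrable M h" "g \<in> borel_measurable M" "\<And>x. \<bar>g x\<bar> \<le> 1" for g h :: "'a \<Rightarrow> real"
    using that by (intro Bochner_Integration.integrable_bound[OF that(1)])
      (auto intro!: AE_I2 mult_left_le_one_le simp: abs_mult)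
  have itrig: "integrable M (\<lambda>x. cos (v * V x))" "integrable M (\<lambda>x. sin (v * V x))" for v
    by (rule integrable_const_bound[where B=1]; auto)+
  have rr: "(\<integral>x. cos (v * V x) \<partial>M) = exp (- v\<^sup>2 / 2)" "(\<integral>x. sin (v * V x) \<partial>M) = 0" for v
  proof -
    have "(\<integral>x. iexp (v * V x) \<partial>M) = exp (- v\<^sup>2 / 2)" using char[of 0 v] by simp
    then have "Re (\<integral>x. iexp (v * V x) \<partial>M) = exp (- v\<^sup>2 / 2)" "Im (\<integral>x. iexp (v * V x) \<partial>M) = 0"
      by simp_all
    then show "(\<integral>x. cos (v * V x) \<partial>M) = exp (- v\<^sup>2 / 2)" "(\<integral>x. sin (v * V x) \<partial>M) = 0"
      using icis[of "\<lambda>x. v * V x"] by (simp_all add: Re_exp Im_exp flip: integral_Re integral_Im)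
  qed
  have base: "(\<integral>x. indicator A (U x) \<partial>M) = ?N A"
    using weighted_std_normal[OF M U, of "\<lambda>_. 1" A] char[of _ 0] by (simp add: prob_space)
  have ind: "integrable M (\<lambda>x. indicator A (U x) :: real)"
    by (rule integrable_const_bound[where B=1]) (auto simp: indicator_def)
  have e: "(\<integral>x. complex_of_real (1 + cos (v * V x)) * iexp (u * U x) \<partial>M)
      = complex_of_real ((1 + exp (- v\<^sup>2 / 2)) * exp (- u\<^sup>2 / 2))"
    "(\<integral>x. complex_of_real (1 + sin (v * V x)) * iexp (u * U x) \<partial>M)
      = complex_of_real (1 * exp (- u\<^sup>2 / 2))" for u v
  proof -
    \<comment> \<open>Product-to-sum identities reduce the weighted exponentials to joint ones,
      whose integrals are given by \<open>char\<close>; the summand \<open>0 * V x\<close> brings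
      the unweighted term into the same shape.\<close>
    have c: "complex_of_real (1 + cos (v * V x)) * iexp (u * U x) =
       iexp (u * U x + 0 * V x) + (1 / 2) * (iexp (u * U x + v * V x) + iexp (u * U x + (-v) * V x))" for x
      unfolding iexp_eq_cis by (simp add: complex_eq_iff cos_add sin_add cos_diff sin_diff field_simps)
    have s: "complex_of_real (1 + sin (v * V x)) * iexp (u * U x) =
       iexp (u * U x + 0 * V x) + (- \<i> / 2) * (iexp (u * U x + v * V x) - iexp (u * U x + (-v) * V x))" for x
      unfolding iexp_eq_cis by (simp add: complex_eq_iff cos_add sin_add cos_diff sin_diff field_simps)
    have "integrable M (\<lambda>x. iexp (u * U x + v * V x))" for u v by (rule icis) measurable
    then have hb: "has_bochner_integral M (\<lambda>x. iexp (u * U x + v * V x)) (complex_of_real (exp (- (u\<^sup>2 + v\<^sup>2) / 2)))" for u v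
      unfolding has_bochner_integral_iff by (simp only: char simp_thms)
    have "(\<integral>x. complex_of_real (1 + cos (v * V x)) * iexp (u * U x) \<partial>M) =
      complex_of_real (exp (- (u\<^sup>2 + 0\<^sup>2) / 2)) + (1 / 2) * (complex_of_real (exp (- (u\<^sup>2 + v\<^sup>2) / 2))
        + complex_of_real (exp (- (u\<^sup>2 + (-v)\<^sup>2) / 2)))"
      unfolding c by (rule has_bochner_integral_integral_eq)
        (intro has_bochner_integral_add has_bochner_integral_mult_right hb)
    also have "\<dots> = complex_of_real ((1 + exp (- v\<^sup>2 / 2)) * exp (- u\<^sup>2 / 2))"
      by (simp add: distrib_right add_divide_distrib diff_divide_distrib flip: exp_add of_real_mult)
    finally show "(\<integral>x. complex_of_real (1 + cos (v * V x)) * iexp (u * U x) \<partial>M)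
      = complex_of_real ((1 + exp (- v\<^sup>2 / 2)) * exp (- u\<^sup>2 / 2))" .
    have "(\<integral>x. complex_of_real (1 + sin (v * V x)) * iexp (u * U x) \<partial>M) =
      complex_of_real (exp (- (u\<^sup>2 + 0\<^sup>2) / 2)) + (- \<i> / 2) * (complex_of_real (exp (- (u\<^sup>2 + v\<^sup>2) / 2))
        - complex_of_real (exp (- (u\<^sup>2 + (-v)\<^sup>2) / 2)))"
      unfolding s by (rule has_bochner_integral_integral_eq)
        (intro has_bochner_integral_add has_bochner_integral_mult_right has_bochner_integral_diff hb)
    then show "(\<integral>x. complex_of_real (1 + sin (v * V x)) * iexp (u * U x) \<partial>M)
      = complex_of_real (1 * exp (- u\<^sup>2 / 2))"
      by (simp only:) simp
  qed
  have C: "(\<integral>x. cos (v * V x) * indicator A (U x) \<partial>M) = exp (- v\<^sup>2 / 2) * ?N A" for v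
  proof -
    have "(\<integral>x. (1 + cos (v * V x)) * indicator A (U x) \<partial>M) = (\<integral>x. 1 + cos (v * V x) \<partial>M) * ?N A"
    proof (rule weighted_std_normal[OF M U _ _ _ A])
      show "0 \<le> 1 + cos (v * V x)" for x using cos_ge_minus_one[of "v * V x"] by linarith
    qed (use itrig(1)[of v] e(1)[of v] in \<open>simp_all del: of_real_add of_real_mult add: rr prob_space\<close>)
    moreover have "(\<integral>x. (1 + cos (v * V x)) * indicator A (U x) \<partial>M)
       = (\<integral>x. indicator A (U x) + cos (v * V x) * indicator A (U x) \<partial>M)"
      by (simp add: algebra_simps)
    ultimately show ?thesis
      using itrig(1)[of v] irw[OF ind, of "\<lambda>x. cos (v * V x)"] ind
      by (simp add: base rr prob_space algebra_simps)
  qed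
  have S: "(\<integral>x. sin (v * V x) * indicator A (U x) \<partial>M) = 0" for v
  proof -
    have "(\<integral>x. (1 + sin (v * V x)) * indicator A (U x) \<partial>M) = (\<integral>x. 1 + sin (v * V x) \<partial>M) * ?N A"
    proof (rule weighted_std_normal[OF M U _ _ _ A])
      show "0 \<le> 1 + sin (v * V x)" for x using sin_ge_minus_one[of "v * V x"] by linarith
    qed (use itrig(2)[of v] e(2)[of v] in \<open>simp_all del: of_real_add of_real_mult add: rr prob_space\<close>)
    moreover have "(\<integral>x. (1 + sin (v * V x)) * indicator A (U x) \<partial>M)
       = (\<integral>x. indicator A (U x) + sin (v * V x) * indicator A (U x) \<partial>M)"
      by (simp add: algebra_simps)
    ultimately show ?thesis
      using itrig(2)[of v] irw[OF ind, of "\<lambda>x. sin (v * V x)"] ind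
      by (simp add: base rr prob_space algebra_simps)
  qed
  have "(\<integral>x. complex_of_real (indicator A (U x)) * iexp (v * V x) \<partial>M) =
      complex_of_real ((\<integral>x. indicator A (U x) \<partial>M) * exp (- v\<^sup>2 / 2))" for v
  proof -
    have i: "integrable M (\<lambda>x. complex_of_real (indicator A (U x)) * iexp (v * V x))"
      by (rule integrable_const_bound[where B=1]) (auto simp: norm_mult indicator_def)
    have "Re (\<integral>x. complex_of_real (indicator A (U x)) * iexp (v * V x) \<partial>M) = (\<integral>x. cos (v * V x) * indicator A (U x) \<partial>M)"
      "Im (\<integral>x. complex_of_real (indicator A (U x)) * iexp (v * V x) \<partial>M) = (\<integral>x. sin (v * V x) * indicator A (U x) \<partial>M)"
      unfolding integral_Re[OF i, symmetric] integral_Im[OF i, symmetric]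
      unfolding iexp_eq_cis
      by (simp_all add: mult.commute)
    then show ?thesis
      by (intro complex_eqI) (simp_all only: C S base, simp_all)
  qed
  from weighted_std_normal[OF M V ind _ this B]
  have "(\<integral>x. indicator A (U x) * indicator B (V x) \<partial>M) = ?N A * ?N B"
    by (simp add: base)
  also have "(\<integral>x. indicator A (U x) * indicator B (V x) \<partial>M)
      = (\<integral>x. indicator {x \<in> space M. U x \<in> A \<and> V x \<in> B} x \<partial>M :: real)"
    by (intro Bochner_Integration.integral_cong) (auto simp: indicator_def)
  finally show ?thesis by simp
qed

section \<open>Standard complex Gaussians and their finite products\<close>

definition cgauss :: "complex measure" where
  "cgauss = density lborel (\<lambda>z. ennreal (exp (- (cmod z)\<^sup>2 / 2) / (2 * pi)))"

definition gauss :: "'i set \<Rightarrow> ('i \<Rightarrow> complex) measure" where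
  "gauss I = Pi\<^sub>M I (\<lambda>_. cgauss)"

abbreviation complex_of_pair :: "real \<times> real \<Rightarrow> complex" where
  "complex_of_pair \<equiv> \<lambda>p. complex_of_real (fst p) + \<i> * complex_of_real (snd p)"

lemma lborel_complex: "(lborel :: complex measure) = distr (lborel \<Otimes>\<^sub>M lborel) borel complex_of_pair"
proof (rule lborel_eqI)
  fix l u :: complex assume le: "\<And>b. b \<in> Basis \<Longrightarrow> l \<bullet> b \<le> u \<bullet> b"
  have le': "Re l \<le> Re u" "Im l \<le> Im u"
    using le[of 1] le[of \<i>] by (auto simp: Basis_complex_def)
  have "emeasure (distr (lborel \<Otimes>\<^sub>M lborel) borel complex_of_pair) (box l u) =
    emeasure (lborel \<Otimes>\<^sub>M lborel) ({Re l <..< Re u} \<times> {Im l <..< Im u})"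
    by (subst emeasure_distr)
      (auto simp: box_def Basis_complex_def space_pair_measure intro!: arg_cong[where f="emeasure _"])
  also have "\<dots> = ennreal (Re u - Re l) * ennreal (Im u - Im l)"
    using le' by (simp add: lborel.emeasure_pair_measure_Times)
  also have "\<dots> = ennreal (\<Prod>b\<in>Basis. (u - l) \<bullet> b)"
    using le' by (simp add: Basis_complex_def ennreal_mult)
  finally show "emeasure (distr (lborel \<Otimes>\<^sub>M lborel) borel complex_of_pair) (box l u)
     = ennreal (\<Prod>b\<in>Basis. (u - l) \<bullet> b)" .
qed simp

interpretation std_normal: prob_space std_normal_distribution
  by (rule prob_space_normal_density) simp

text \<open>With this normalisation the real and imaginary parts are independent standard normals,
  so real parts of linear forms with unit coefficient vectors are standard normal without further
  constants.\<close>

lemma cgauss_eq: "cgauss = distr (std_normal_distribution \<Otimes>\<^sub>M std_normal_distribution) borel complex_of_pair"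
proof -
  have "cgauss = distr (density (lborel \<Otimes>\<^sub>M lborel) (\<lambda>p. ennreal (exp (- (cmod (complex_of_pair p))\<^sup>2 / 2) / (2 * pi))))
     borel complex_of_pair"
    unfolding cgauss_def by (subst lborel_complex, subst density_distr) (simp_all add: comp_def split_beta')
  also have "density (lborel \<Otimes>\<^sub>M lborel) (\<lambda>p. ennreal (exp (- (cmod (complex_of_pair p))\<^sup>2 / 2) / (2 * pi)))
     = density (lborel \<Otimes>\<^sub>M lborel) (\<lambda>(x, y). ennreal (std_normal_density x) * ennreal (std_normal_density y))"
  proof -
    have "exp (- (cmod (complex_of_real x + \<i> * complex_of_real y))\<^sup>2 / 2) / (2 * pi) = std_normal_density x * std_normal_density y" for x y
    proof -
      have "std_normal_density x * std_normal_density y = (exp (- x\<^sup>2 / 2) * exp (- y\<^sup>2 / 2)) / (sqrt (2 * pi) * sqrt (2 * pi))"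
        by (simp add: std_normal_density_def)
      also have "exp (- x\<^sup>2 / 2) * exp (- y\<^sup>2 / 2) = exp (- (x\<^sup>2 + y\<^sup>2) / 2)"
        by (simp flip: exp_add add: field_simps)
      finally show ?thesis by (simp add: cmod_power2)
    qed
    then show ?thesis
      by (intro density_cong) (auto simp: ennreal_mult split_beta')
  qed
  also have "\<dots> = std_normal_distribution \<Otimes>\<^sub>M std_normal_distribution"
    by (rule pair_measure_density[symmetric])
      (auto intro: sigma_finite_lborel std_normal.sigma_finite_measure_axioms)
  finally show ?thesis .
qed

lemma prob_space_cgauss: "prob_space cgauss"
proof -
  interpret pair_prob_space std_normal_distribution std_normal_distribution ..
  show ?thesis unfolding cgauss_eq by (rule prob_space_distr) measurable
qed

interpretation cgauss: prob_space cgauss by (rule prob_space_cgauss)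

interpretation cgauss_pair: pair_prob_space std_normal_distribution std_normal_distribution ..

lemma sets_cgauss [simp, measurable_cong]: "sets cgauss = sets borel"
  by (simp add: cgauss_def)

lemma space_cgauss [simp]: "space cgauss = UNIV"
  by (simp add: cgauss_def)

lemma prob_space_gauss: "prob_space (gauss I)"
  unfolding gauss_def by (rule prob_space_PiM) (rule prob_space_cgauss)

lemma sets_gauss: "sets (gauss I) = sets (coeff_lborel I)"
  unfolding gauss_def coeff_lborel_def by (rule sets_PiM_cong) auto

lemma space_gauss: "space (gauss I) = I \<rightarrow>\<^sub>E UNIV"
  by (simp add: gauss_def space_PiM)

lemma measurable_gauss_coord [measurable]: "i \<in> I \<Longrightarrow> (\<lambda>a. a i) \<in> borel_measurable (gauss I)"
  unfolding gauss_def using measurable_component_singleton[of i I "\<lambda>_. cgauss"]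
  by (simp add: measurable_cong_sets[OF refl sets_cgauss])

lemma cgauss_char: "(\<integral>z. iexp (Re (c * z)) \<partial>cgauss) = complex_of_real (exp (- (cmod c)\<^sup>2 / 2))"
proof -
  have ch: "(\<integral>x. iexp (t * x) \<partial>std_normal_distribution) = complex_of_real (exp (- t\<^sup>2 / 2))" for t
    using fun_cong[OF char_std_normal_distribution, of t] by (simp add: char_def)
  have "(\<integral>z. iexp (Re (c * z)) \<partial>cgauss) =
      (\<integral>p. iexp (Re (c * (complex_of_pair p))) \<partial>(std_normal_distribution \<Otimes>\<^sub>M std_normal_distribution))"
    unfolding cgauss_eq by (rule integral_distr) simp_all
  also have "\<dots> = (\<integral>p. iexp (Re c * fst p) * iexp (- Im c * snd p) \<partial>(std_normal_distribution \<Otimes>\<^sub>M std_normal_distribution))"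
    by (intro Bochner_Integration.integral_cong) (auto simp: algebra_simps split_beta' simp flip: exp_add)
  also have "\<dots> = (\<integral>x. (\<integral>y. iexp (Re c * x) * iexp (- Im c * y) \<partial>std_normal_distribution) \<partial>std_normal_distribution)"
    by (subst cgauss_pair.integral_fst'[symmetric])
       (auto intro!: cgauss_pair.integrable_const_bound[where B=1] simp: norm_mult)
  also have "\<dots> = complex_of_real (exp (- (Re c)\<^sup>2 / 2)) * complex_of_real (exp (- (Im c)\<^sup>2 / 2))"
    using ch[of "Re c"] ch[of "- Im c"] by simp
  also have "\<dots> = complex_of_real (exp (- (cmod c)\<^sup>2 / 2))"
    by (simp add: cmod_power2 add_divide_distrib diff_divide_distrib flip: of_real_mult exp_add)
  finally show ?thesis .
qed

lemma gauss_char: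
  assumes I: "finite I"
  shows "(\<integral>a. iexp (Re (\<Sum>i\<in>I. c i * a i)) \<partial>gauss I) = complex_of_real (exp (- (\<Sum>i\<in>I. (cmod (c i))\<^sup>2) / 2))"
proof -
  interpret P: product_sigma_finite "\<lambda>_::'a. cgauss" ..
  have int: "integrable cgauss (\<lambda>z. iexp (Re (c i * z)))" for i
  proof (rule cgauss.integrable_const_bound[where B=1])
    show "(\<lambda>z. iexp (Re (c i * z))) \<in> borel_measurable cgauss"
      unfolding measurable_cong_sets[OF sets_cgauss refl]
      by (intro borel_measurable_continuous_onI continuous_intros)
  qed simp
  have *: "iexp (\<Sum>i\<in>I. f i) = (\<Prod>i\<in>I. iexp (f i))" for f :: "'a \<Rightarrow> real"
    by (simp add: sum_distrib_left exp_sum[OF I])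
  have "(\<integral>a. iexp (Re (\<Sum>i\<in>I. c i * a i)) \<partial>gauss I) = (\<integral>a. (\<Prod>i\<in>I. iexp (Re (c i * a i))) \<partial>gauss I)"
    by (simp only: Re_sum *)
  also have "\<dots> = (\<Prod>i\<in>I. (\<integral>z. iexp (Re (c i * z)) \<partial>cgauss))"
    unfolding gauss_def using I int by (intro P.product_integral_prod)
  also have "\<dots> = complex_of_real (\<Prod>i\<in>I. exp (- (cmod (c i))\<^sup>2 / 2))"
    unfolding cgauss_char of_real_prod ..
  also have "(\<Prod>i\<in>I. exp (- (cmod (c i))\<^sup>2 / 2)) = exp (- (\<Sum>i\<in>I. (cmod (c i))\<^sup>2) / 2)"
    using I by (simp flip: exp_sum add: sum_negf sum_divide_distrib)
  finally show ?thesis .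
qed

section \<open>Real linear forms in Gaussian coefficients\<close>

definition real_form :: "'i set \<Rightarrow> ('i \<Rightarrow> complex) \<Rightarrow> ('i \<Rightarrow> complex) \<Rightarrow> real" where
  "real_form I c a = Re (\<Sum>i\<in>I. c i * a i)"

lemma measurable_real_form [measurable]: "real_form I c \<in> borel_measurable (gauss I)"
  unfolding real_form_def[abs_def] by measurable

lemma real_form_scale: "real_form I (\<lambda>i. complex_of_real r * c i) a = r * real_form I c a"
  by (simp add: real_form_def mult.assoc flip: sum_distrib_left)

lemma real_form_add: "real_form I (\<lambda>i. c i + d i) a = real_form I c a + real_form I d a"
  by (simp add: real_form_def distrib_right sum.distrib)

lemma prob_real_form:
  assumes "finite I" "(\<Sum>i\<in>I. (cmod (c i))\<^sup>2) = 1" "A \<in> sets borel"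
  shows "measure (gauss I) {a \<in> space (gauss I). real_form I c a \<in> A} = measure std_normal_distribution A"
proof (rule std_normal_of_char[OF prob_space_gauss measurable_real_form _ assms(3)])
  fix u
  have "(\<integral>a. iexp (u * real_form I c a) \<partial>gauss I) = (\<integral>a. iexp (real_form I (\<lambda>i. complex_of_real u * c i) a) \<partial>gauss I)"
    by (simp only: real_form_scale)
  also have "\<dots> = complex_of_real (exp (- u\<^sup>2 / 2))"
    unfolding real_form_def gauss_char[OF assms(1)]
    by (simp add: norm_mult power_mult_distrib assms(2) flip: sum_distrib_left)
  finally show "(\<integral>a. iexp (u * real_form I c a) \<partial>gauss I) = complex_of_real (exp (- u\<^sup>2 / 2))" .
qed

text \<open>The covariance of two such forms is the sum of \<open>Re (c i * cnj (d i))\<close>. When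
  it vanishes, the mixed term in the squared norm of \<open>u c + v d\<close> disappears and the
  joint characteristic function factors.\<close>

lemma prob_real_form_pair:
  assumes I: "finite I" and c: "(\<Sum>i\<in>I. (cmod (c i))\<^sup>2) = 1" and d: "(\<Sum>i\<in>I. (cmod (d i))\<^sup>2) = 1"
    and cd: "(\<Sum>i\<in>I. Re (c i * cnj (d i))) = 0" and AB: "A \<in> sets borel" "B \<in> sets borel"
  shows "measure (gauss I) {a \<in> space (gauss I). real_form I c a \<in> A \<and> real_form I d a \<in> B} =
    measure std_normal_distribution A * measure std_normal_distribution B"
proof (rule indep_std_normal_of_char[OF prob_space_gauss measurable_real_form measurable_real_form _ AB])
  fix u v
  have "(\<Sum>i\<in>I. (cmod (complex_of_real u * c i + complex_of_real v * d i))\<^sup>2)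
    = u\<^sup>2 * (\<Sum>i\<in>I. (cmod (c i))\<^sup>2) + v\<^sup>2 * (\<Sum>i\<in>I. (cmod (d i))\<^sup>2) + 2 * u * v * (\<Sum>i\<in>I. Re (c i * cnj (d i)))"
    unfolding sum_distrib_left sum.distrib[symmetric]
    by (intro sum.cong refl) (simp only: cmod_power2, simp add: power2_eq_square algebra_simps)
  also have "\<dots> = u\<^sup>2 + v\<^sup>2" unfolding c d cd by simp
  finally have e: "(\<Sum>i\<in>I. (cmod (complex_of_real u * c i + complex_of_real v * d i))\<^sup>2) = u\<^sup>2 + v\<^sup>2" .
  have "(\<integral>a. iexp (u * real_form I c a + v * real_form I d a) \<partial>gauss I)
    = (\<integral>a. iexp (real_form I (\<lambda>i. complex_of_real u * c i + complex_of_real v * d i) a) \<partial>gauss I)"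
    by (simp only: real_form_scale real_form_add)
  also have "\<dots> = complex_of_real (exp (- (u\<^sup>2 + v\<^sup>2) / 2))"
    unfolding real_form_def gauss_char[OF I] by (simp add: e)
  finally show "(\<integral>a. iexp (u * real_form I c a + v * real_form I d a) \<partial>gauss I)
    = complex_of_real (exp (- (u\<^sup>2 + v\<^sup>2) / 2))" .
qed

section \<open>Multi-indices\<close>

lemma multi_indices_0_left [simp]: "multi_indices 0 n = {\<lambda>_. 0}"
  by (auto simp: multi_indices_def fun_eq_iff) (metis lessThan_iff not_le)

lemma multi_indices_Suc_0 [simp]: "multi_indices (Suc m) 0 = {}"
  by (simp add: multi_indices_def)

text \<open>Pascal's recursion: the last exponent is either zero or can be lowered by one. Both the
  cardinality and \<open>complete_hom\<close> are computed from this disjoint union.\<close>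

lemma multi_indices_Suc_Suc:
  "multi_indices (Suc m) (Suc n) =
     multi_indices (Suc m) n \<union> (\<lambda>\<alpha>. \<alpha>(n := Suc (\<alpha> n))) ` multi_indices m (Suc n)"
proof (intro set_eqI iffI)
  fix \<alpha> assume a: "\<alpha> \<in> multi_indices (Suc m) (Suc n)"
  show "\<alpha> \<in> multi_indices (Suc m) n \<union> (\<lambda>\<alpha>. \<alpha>(n := Suc (\<alpha> n))) ` multi_indices m (Suc n)"
  proof (cases "\<alpha> n")
    case 0
    have "\<alpha> i = 0" if "i \<ge> n" for i
      using a 0 that by (cases "i = n") (auto simp: multi_indices_def)
    then show ?thesis using a 0 by (auto simp: multi_indices_def)
  next
    case (Suc k)
    define \<beta> where "\<beta> = \<alpha>(n := k)"
    have "(\<Sum>i<n. \<beta> i) = (\<Sum>i<n. \<alpha> i)" by (intro sum.cong) (auto simp: \<beta>_def)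
    then have "\<beta> \<in> multi_indices m (Suc n)"
      using a Suc by (auto simp: multi_indices_def \<beta>_def)
    moreover have "\<alpha> = \<beta>(n := Suc (\<beta> n))" using Suc by (auto simp: \<beta>_def)
    ultimately show ?thesis by blast
  qed
next
  fix \<alpha> assume "\<alpha> \<in> multi_indices (Suc m) n \<union> (\<lambda>\<alpha>. \<alpha>(n := Suc (\<alpha> n))) ` multi_indices m (Suc n)"
  then show "\<alpha> \<in> multi_indices (Suc m) (Suc n)"
  proof
    assume "\<alpha> \<in> (\<lambda>\<alpha>. \<alpha>(n := Suc (\<alpha> n))) ` multi_indices m (Suc n)"
    then obtain \<beta> where b: "\<beta> \<in> multi_indices m (Suc n)" "\<alpha> = \<beta>(n := Suc (\<beta> n))" by blast
    have "(\<Sum>i<n. \<alpha> i) = (\<Sum>i<n. \<beta> i)" by (intro sum.cong) (auto simp: b)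
    then show ?thesis using b by (auto simp: multi_indices_def)
  qed (auto simp: multi_indices_def)
qed

lemma inj_on_increment: "inj_on (\<lambda>\<alpha>. \<alpha>(n := Suc (\<alpha> n))) A"
proof (rule inj_onI)
  fix \<alpha> \<beta> :: "'a \<Rightarrow> nat" assume e: "\<alpha>(n := Suc (\<alpha> n)) = \<beta>(n := Suc (\<beta> n))"
  have "\<alpha> i = \<beta> i" for i using fun_cong[OF e, of i] by (cases "i = n") auto
  then show "\<alpha> = \<beta>" ..
qed

lemma multi_indices_disjoint:
  "multi_indices (Suc m) n \<inter> (\<lambda>\<alpha>. \<alpha>(n := Suc (\<alpha> n))) ` multi_indices m (Suc n) = {}"
  by (auto simp: multi_indices_def)

lemma card_multi_indices: "card (multi_indices m (Suc k)) = (m + k) choose m"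
proof (induction m arbitrary: k)
  case (Suc m)
  note IH = Suc.IH
  show ?case
  proof (induction k)
    case 0
    show ?case
      using IH[of 0] by (simp add: multi_indices_Suc_Suc card_image inj_on_increment)
  next
    case (Suc k)
    have "card (multi_indices (Suc m) (Suc (Suc k))) =
        card (multi_indices (Suc m) (Suc k)) + card (multi_indices m (Suc (Suc k)))"
      unfolding multi_indices_Suc_Suc[of m "Suc k"]
      by (subst card_Un_disjoint)
        (auto simp: finite_multi_indices multi_indices_disjoint card_image inj_on_increment)
    then show ?case using IH[of "Suc k"] Suc by simp
  qed
qed simp

section \<open>Complete homogeneous symmetric polynomials\<close>

definition complete_hom :: "(nat \<Rightarrow> complex) \<Rightarrow> nat \<Rightarrow> nat \<Rightarrow> complex" where
  "complete_hom w m n = (\<Sum>\<alpha>\<in>multi_indices m n. \<Prod>i<n. w i ^ \<alpha> i)"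

lemma complete_hom_Suc_Suc:
  "complete_hom w (Suc m) (Suc n) = complete_hom w (Suc m) n + w n * complete_hom w m (Suc n)"
proof -
  have 1: "(\<Sum>\<alpha>\<in>multi_indices (Suc m) n. \<Prod>i<Suc n. w i ^ \<alpha> i) = complete_hom w (Suc m) n"
    unfolding complete_hom_def by (intro sum.cong) (auto simp: multi_indices_def)
  have "(\<Sum>\<alpha>\<in>(\<lambda>\<alpha>. \<alpha>(n := Suc (\<alpha> n))) ` multi_indices m (Suc n). \<Prod>i<Suc n. w i ^ \<alpha> i) =
     (\<Sum>\<alpha>\<in>multi_indices m (Suc n). w n * (\<Prod>i<Suc n. w i ^ \<alpha> i))"
    by (subst sum.reindex[OF inj_on_increment]) (auto intro!: sum.cong simp: ac_simps)
  then have 2: "(\<Sum>\<alpha>\<in>(\<lambda>\<alpha>. \<alpha>(n := Suc (\<alpha> n))) ` multi_indices m (Suc n). \<Prod>i<Suc n. w i ^ \<alpha> i) =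
     w n * complete_hom w m (Suc n)"
    by (simp add: complete_hom_def sum_distrib_left)
  show ?thesis
    unfolding complete_hom_def[of w "Suc m" "Suc n"] multi_indices_Suc_Suc
    by (subst sum.union_disjoint) (simp_all only: finite_multi_indices multi_indices_disjoint finite_imageI 1 2)
qed

text \<open>Multiplying the generating function in \<open>n + 1\<close> variables by
  \<open>1 - w n * x\<close> gives the one in \<open>n\<close> variables; this is the recursion
  \<open>complete_hom_Suc_Suc\<close> read off coefficientwise.\<close>

lemma complete_hom_expansion:
  "(\<lambda>x. \<Prod>i<n. inverse (1 - w i * x)) has_fps_expansion Abs_fps (\<lambda>m. complete_hom w m n)"
proof (induction n)
  case 0
  have "Abs_fps (\<lambda>m. complete_hom w m 0) = 1"
  proof (rule fps_ext)
    show "fps_nth (Abs_fps (\<lambda>m. complete_hom w m 0)) m = fps_nth 1 m" for m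
      by (cases m) (simp_all add: complete_hom_def)
  qed
  then show ?case by (simp add: has_fps_expansion_1)
next
  case (Suc n)
  define L where "L = 1 - fps_const (w n) * fps_X"
  let ?F = "\<lambda>n. Abs_fps (\<lambda>m. complete_hom w m n)"
  have "?F (Suc n) * L = ?F n"
  proof (rule fps_ext)
    show "fps_nth (?F (Suc n) * L) m = fps_nth (?F n) m" for m
    proof (cases m)
      case 0
      then show ?thesis by (simp add: L_def complete_hom_def)
    next
      case (Suc k)
      have "?F (Suc n) * L = ?F (Suc n) - fps_const (w n) * (?F (Suc n) * fps_X)"
        by (simp add: L_def algebra_simps)
      then show ?thesis using Suc by (simp add: complete_hom_Suc_Suc)
    qed
  qed
  moreover have "L \<noteq> 0" "fps_nth L 0 \<noteq> 0" by (auto simp: L_def fps_eq_iff intro!: exI[of _ 0])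
  ultimately have "?F (Suc n) = ?F n * inverse L"
    by (metis inverse_mult_eq_1' mult.assoc mult.right_neutral)
  moreover have "(\<lambda>x. 1 - w n * x) has_fps_expansion L"
    unfolding L_def by (intro fps_expansion_intros)
  then have "(\<lambda>x. (\<Prod>i<n. inverse (1 - w i * x)) * inverse (1 - w n * x)) has_fps_expansion ?F n * inverse L"
    by (intro has_fps_expansion_mult has_fps_expansion_inverse Suc) (simp_all add: L_def)
  ultimately show ?case by simp
qed

text \<open>Cauchy's estimate for the \<open>m\<close>-th Taylor coefficient of the generating
  function. All poles lie on the unit circle, so every radius \<rho> below 1 is admissible. The
  bound \<open>B\<close> is left open because it will depend on how many factors stay away from
  their poles.\<close>

lemma complete_hom_bound:
  assumes w: "\<And>i. i < n \<Longrightarrow> cmod (w i) = 1" and \<rho>: "0 < \<rho>" "\<rho> < 1"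
    and B: "\<And>x. cmod x = \<rho> \<Longrightarrow> cmod (\<Prod>i<n. inverse (1 - w i * x)) \<le> B"
  shows "cmod (complete_hom w m n) * \<rho> ^ m \<le> B"
proof -
  let ?f = "\<lambda>x. \<Prod>i<n. inverse (1 - w i * x)"
  have nz: "1 - w i * x \<noteq> 0" if "i < n" "cmod x < 1" for i x
  proof
    assume "1 - w i * x = 0"
    then have "cmod (w i * x) = 1" by simp
    then show False using that w[of i] by (simp add: norm_mult)
  qed
  have hol: "?f holomorphic_on ball 0 1"
    by (intro holomorphic_intros) (use nz in auto)
  have "cmod ((deriv ^^ m) ?f 0) \<le> fact m * B / \<rho> ^ m"
  proof (rule Cauchy_inequality)
    show "?f holomorphic_on ball 0 \<rho>"
      using \<rho> by (intro holomorphic_on_subset[OF hol]) auto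
    show "continuous_on (cball 0 \<rho>) ?f"
      using \<rho> by (intro continuous_on_subset[OF holomorphic_on_imp_continuous_on[OF hol]]) auto
  qed (use \<rho> B in auto)
  also have "(deriv ^^ m) ?f 0 = fact m * complete_hom w m n"
    using fps_nth_fps_expansion[OF complete_hom_expansion[of w n], of m] by simp
  finally have "fact m * cmod (complete_hom w m n) \<le> fact m * B / \<rho> ^ m"
    by (simp add: norm_mult)
  then have "fact m * (cmod (complete_hom w m n) * \<rho> ^ m) \<le> fact m * B"
    using \<rho> by (simp add: field_simps)
  then show ?thesis by (simp del: of_nat_fact)
qed

text \<open>The binomial law with parameters \<open>M\<close> and \<open>p = m / M\<close> has mean
  \<open>m\<close>, which is also its mode. A mode among \<open>M + 1\<close> values has probability
  between \<open>1 / (M + 1)\<close> and 1, so the binomial coefficient is known up to a polynomial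
  factor.\<close>

lemma binomial_mode:
  fixes m k :: nat
  assumes "0 < m" "0 < k"
  defines "M \<equiv> m + k"
  defines "p \<equiv> real m / real M"
  shows "real (M choose m) * p ^ m * (1 - p) ^ k \<le> 1"
    and "1 \<le> real (Suc M) * (real (M choose m) * p ^ m * (1 - p) ^ k)"
proof -
  define f where "f j = real (M choose j) * p ^ j * (1 - p) ^ (M - j)" for j
  have M: "0 < M" using assms by (simp add: M_def)
  have p: "0 < p" "p < 1" "1 - p = real k / real M"
    using assms by (auto simp: p_def M_def field_simps)
  have s: "(\<Sum>j\<le>M. f j) = 1"
    using binomial_ring[of p "1 - p" M] by (simp add: f_def)
  have f0: "f j \<ge> 0" for j using p by (simp add: f_def)
  have fm: "f m = real (M choose m) * p ^ m * (1 - p) ^ k" by (simp add: f_def M_def)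
  have "f m \<le> (\<Sum>j\<le>M. f j)" by (rule member_le_sum) (auto simp: f0 M_def)
  then show "real (M choose m) * p ^ m * (1 - p) ^ k \<le> 1" using s fm by simp
  \<comment> \<open>The ratio of consecutive probabilities is
    \<open>(M - j) * m / ((j + 1) * k)\<close>, written without division. It is at least 1 for
    \<open>j < m\<close> and at most 1 for \<open>j \<ge> m\<close>.\<close>
  have rat: "f (Suc j) * (real (Suc j) * real k) = f j * (real (M - j) * real m)" if "j < M" for j
  proof -
    have "Suc j * (M choose Suc j) = (M - j) * (M choose j)"
      by (metis binomial_absorb_comp binomial_absorption mult.commute)
    then have c: "real (Suc j) * real (M choose Suc j) = real (M - j) * real (M choose j)"
      by (metis of_nat_mult)
    have e: "M - j = Suc (M - Suc j)" using that by simp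
    have pw: "(1 - p) ^ (M - Suc j) * (1 - p) = (1 - p) ^ (M - j)" by (simp add: e)
    have "f (Suc j) * (real (Suc j) * real k)
      = (real (Suc j) * real (M choose Suc j)) * p ^ j * (1 - p) ^ (M - Suc j) * (p * real k)"
      by (simp add: f_def)
    also have "p * real k = (1 - p) * real m"
      by (simp add: p(3)) (simp add: p_def)
    also have "(real (Suc j) * real (M choose Suc j)) * p ^ j * (1 - p) ^ (M - Suc j) * ((1 - p) * real m)
      = f j * (real (M - j) * real m)"
      unfolding c f_def pw[symmetric] by (simp only: mult_ac)
    finally show ?thesis .
  qed
  have up: "f j \<le> f (Suc j)" if "j < m" for j
  proof -
    have "real k * real (Suc j) \<le> real (M - j) * real m"
      using that by (intro mult_mono) (auto simp: M_def)
    then have "f j * (real (Suc j) * real k) \<le> f (Suc j) * (real (Suc j) * real k)"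
      using rat[of j] that f0[of j] by (simp add: M_def mult_left_mono mult.commute)
    then show ?thesis using assms by (simp add: mult_le_cancel_right)
  qed
  have down: "f (Suc j) \<le> f j" if "m \<le> j" "j < M" for j
  proof -
    have "real (M - j) * real m \<le> real k * real (Suc j)"
      using that by (intro mult_mono) (auto simp: M_def)
    then have "f (Suc j) * (real (Suc j) * real k) \<le> f j * (real (Suc j) * real k)"
      using rat[of j] that f0[of j] by (simp add: M_def mult_left_mono mult.commute)
    then show ?thesis using assms by (simp add: mult_le_cancel_right)
  qed
  have le: "f j \<le> f m" if "j \<le> M" for j
  proof (cases "j \<le> m")
    case True
    then show ?thesis by (induction rule: inc_induct) (use up in \<open>auto intro: order_trans\<close>)
  next
    case False
    then have "m \<le> j" by simp
    then show ?thesis using \<open>j \<le> M\<close>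
      by (induction rule: dec_induct) (auto intro: order_trans[OF down])
  qed
  have "1 \<le> (\<Sum>j\<le>M. f m)" unfolding s[symmetric] by (intro sum_mono le) simp
  then show "1 \<le> real (Suc M) * (real (M choose m) * p ^ m * (1 - p) ^ k)"
    by (simp add: fm)
qed

section \<open>Second moments of the exponents\<close>

lemma card_multi_indices_shift:
  assumes i: "i < n" and k: "k \<le> m" and Q: "\<And>\<alpha> x. Q (\<alpha>(i := x)) \<longleftrightarrow> Q \<alpha>"
  shows "card {\<alpha> \<in> multi_indices m n. k \<le> \<alpha> i \<and> Q \<alpha>} = card {\<alpha> \<in> multi_indices (m - k) n. Q \<alpha>}"
proof -
  have s: "(\<Sum>j<n. (\<alpha>(i := x)) j) = x + (\<Sum>j\<in>{..<n} - {i}. \<alpha> j)" for \<alpha> x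
    using i by (subst sum.remove[of _ i]) (auto intro!: sum.cong)
  have s': "(\<Sum>j<n. \<alpha> j) = \<alpha> i + (\<Sum>j\<in>{..<n} - {i}. \<alpha> j)" for \<alpha> :: "nat \<Rightarrow> nat"
    using i by (subst sum.remove[of _ i]) auto
  have up: "\<alpha>(i := \<alpha> i + k) \<in> {\<alpha> \<in> multi_indices m n. k \<le> \<alpha> i \<and> Q \<alpha>}"
    if "\<alpha> \<in> {\<alpha> \<in> multi_indices (m - k) n. Q \<alpha>}" for \<alpha>
  proof -
    have "(\<Sum>j<n. (\<alpha>(i := \<alpha> i + k)) j) = m"
      using that k unfolding s by (auto simp: multi_indices_def s')
    then show ?thesis using that i by (auto simp: multi_indices_def Q)
  qed
  have down: "\<alpha>(i := \<alpha> i - k) \<in> {\<alpha> \<in> multi_indices (m - k) n. Q \<alpha>}"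
    if "\<alpha> \<in> {\<alpha> \<in> multi_indices m n. k \<le> \<alpha> i \<and> Q \<alpha>}" for \<alpha>
  proof -
    have "(\<Sum>j<n. (\<alpha>(i := \<alpha> i - k)) j) = m - k"
      using that unfolding s by (auto simp: multi_indices_def s')
    then show ?thesis using that i by (auto simp: multi_indices_def Q)
  qed
  have "bij_betw (\<lambda>\<alpha>. \<alpha>(i := \<alpha> i - k)) {\<alpha> \<in> multi_indices m n. k \<le> \<alpha> i \<and> Q \<alpha>}
      {\<alpha> \<in> multi_indices (m - k) n. Q \<alpha>}"
    by (rule bij_betw_byWitness[where f'="\<lambda>\<alpha>. \<alpha>(i := \<alpha> i + k)"])
      (use up down in \<open>auto simp: fun_eq_iff\<close>)
  then show ?thesis by (rule bij_betw_same_card)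
qed

lemma card_multi_indices_ge:
  assumes "i < n" "k \<le> m"
  shows "card {\<alpha> \<in> multi_indices m n. k \<le> \<alpha> i} = card (multi_indices (m - k) n)"
  using card_multi_indices_shift[OF assms, of "\<lambda>_. True"] by simp

text \<open>Two successive shifts. The predicate \<open>Q\<close> of
  \<open>card_multi_indices_shift\<close>, which cannot see the coordinate \<open>i\<close>, carries
  the constraint on \<open>j\<close> through the first one.\<close>

lemma card_multi_indices_ge2:
  assumes "i < n" "j < n" "i \<noteq> j" "k + l \<le> m"
  shows "card {\<alpha> \<in> multi_indices m n. k \<le> \<alpha> i \<and> l \<le> \<alpha> j} = card (multi_indices (m - k - l) n)"
  using card_multi_indices_shift[of i n k m "\<lambda>\<alpha>. l \<le> \<alpha> j"] card_multi_indices_ge[of j n l "m - k"] assms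
  by simp

text \<open>Layer-cake form of a natural number. It turns moments of the exponents into counts of
  multi-indices above thresholds.\<close>

lemma real_eq_sum_of_bool:
  fixes a m :: nat
  assumes "a \<le> m"
  shows "real a = (\<Sum>k=1..m. of_bool (k \<le> a))"
proof -
  have "(\<Sum>k=1..m. of_bool (k \<le> a)) = real (card ({1..m} \<inter> {k. k \<le> a}))"
    by (simp add: sum.If_cases of_bool_def Int_def)
  also have "{1..m} \<inter> {k. k \<le> a} = {1..a}" using assms by auto
  finally show ?thesis by simp
qed

definition index_moment :: "nat \<Rightarrow> nat \<Rightarrow> nat \<Rightarrow> nat \<Rightarrow> real" where
  "index_moment m n i j = (\<Sum>\<alpha>\<in>multi_indices m n. real (\<alpha> i) * real (\<alpha> j))"

lemma multi_indices_le: "\<alpha> \<in> multi_indices m n \<Longrightarrow> \<alpha> i \<le> m"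
  by (cases "i < n") (auto simp: multi_indices_def intro: member_le_sum)

lemma index_moment_eq:
  "index_moment m n i j =
    (\<Sum>k=1..m. \<Sum>l=1..m. real (card {\<alpha> \<in> multi_indices m n. k \<le> \<alpha> i \<and> l \<le> \<alpha> j}))"
proof -
  have "index_moment m n i j =
     (\<Sum>\<alpha>\<in>multi_indices m n. \<Sum>k=1..m. \<Sum>l=1..m. of_bool (k \<le> \<alpha> i) * of_bool (l \<le> \<alpha> j))"
    unfolding index_moment_def
  proof (intro sum.cong refl)
    fix \<alpha> assume a: "\<alpha> \<in> multi_indices m n"
    show "real (\<alpha> i) * real (\<alpha> j) = (\<Sum>k=1..m. \<Sum>l=1..m. of_bool (k \<le> \<alpha> i) * of_bool (l \<le> \<alpha> j))"
      unfolding real_eq_sum_of_bool[OF multi_indices_le[OF a], of i] real_eq_sum_of_bool[OF multi_indices_le[OF a], of j]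
        sum_product ..
  qed
  also have "\<dots> = (\<Sum>k=1..m. \<Sum>l=1..m. \<Sum>\<alpha>\<in>multi_indices m n. of_bool (k \<le> \<alpha> i \<and> l \<le> \<alpha> j))"
    by (subst sum.swap, intro sum.cong refl, subst sum.swap) (simp add: of_bool_conj)
  also have "\<dots> = (\<Sum>k=1..m. \<Sum>l=1..m. real (card {\<alpha> \<in> multi_indices m n. k \<le> \<alpha> i \<and> l \<le> \<alpha> j}))"
    by (simp add: of_bool_def sum.If_cases finite_multi_indices Int_def)
  finally show ?thesis .
qed

text \<open>By \<open>card_multi_indices_ge2\<close> the counts in \<open>index_moment_eq\<close>
  depend only on \<open>k + l\<close>, not on the pair of coordinates; for \<open>k + l > m\<close>
  they vanish, as two distinct exponents add up to at most \<open>m\<close>.\<close>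

lemma index_moment_offdiag:
  assumes "i < n" "j < n" "i \<noteq> j" "i' < n" "j' < n" "i' \<noteq> j'"
  shows "index_moment m n i j = index_moment m n i' j'"
  unfolding index_moment_eq
proof (intro sum.cong refl arg_cong[where f=real])
  fix k l
  show "card {\<alpha> \<in> multi_indices m n. k \<le> \<alpha> i \<and> l \<le> \<alpha> j} = card {\<alpha> \<in> multi_indices m n. k \<le> \<alpha> i' \<and> l \<le> \<alpha> j'}"
  proof (cases "k + l \<le> m")
    case True
    then show ?thesis using assms by (simp add: card_multi_indices_ge2)
  next
    case False
    have "{\<alpha> \<in> multi_indices m n. k \<le> \<alpha> i \<and> l \<le> \<alpha> j} = {}" if "i < n" "j < n" "i \<noteq> j" for i j
    proof -
      have "\<alpha> i + \<alpha> j \<le> m" if "\<alpha> \<in> multi_indices m n" for \<alpha>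
      proof -
        have "(\<Sum>t\<in>{i, j}. \<alpha> t) \<le> (\<Sum>t<n. \<alpha> t)"
          using \<open>i < n\<close> \<open>j < n\<close> by (intro sum_mono2) auto
        then show ?thesis using that \<open>i \<noteq> j\<close> by (simp add: multi_indices_def)
      qed
      then show ?thesis using False by force
    qed
    then have "{\<alpha> \<in> multi_indices m n. k \<le> \<alpha> i \<and> l \<le> \<alpha> j} = {}" "{\<alpha> \<in> multi_indices m n. k \<le> \<alpha> i' \<and> l \<le> \<alpha> j'} = {}"
      using assms by blast+
    then show ?thesis by (simp only:)
  qed
qed

text \<open>Lowering the degree from \<open>t + 1\<close> to \<open>t\<close> multiplies the
  cardinality by \<open>(t + 1) / (t + 1 + k)\<close>. This increases with \<open>t\<close> and is
  therefore at most \<open>m / (m + k)\<close>, so the counts decay geometrically.\<close>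

lemma card_multi_indices_ratio:
  assumes r: "real m \<le> r * real (m + k)" and "0 \<le> r" "j \<le> m"
  shows "real (card (multi_indices (m - j) (Suc k))) \<le> r ^ j * real (card (multi_indices m (Suc k)))"
  using \<open>j \<le> m\<close>
proof (induction j)
  case (Suc j)
  define t where "t = m - Suc j"
  have t: "m - j = Suc t" using Suc.prems by (simp add: t_def)
  have "(Suc t + k) * (t + k choose t) = (Suc t + k choose Suc t) * Suc t"
    using Suc_times_binomial_eq[of "t + k" t] by simp
  then have e: "real (Suc t + k) * real (t + k choose t) = real (Suc t + k choose Suc t) * real (Suc t)"
    by (metis of_nat_mult)
  have "real (Suc t) * real (m + k) \<le> real m * real (Suc t + k)"
    using t Suc.prems mult_right_mono[of "real (Suc t)" "real m" "real k"]
    by (simp add: algebra_simps)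
  also have "\<dots> \<le> r * real (m + k) * real (Suc t + k)"
    by (intro mult_right_mono r) simp
  finally have "real (m + k) * real (Suc t) \<le> real (m + k) * (r * real (Suc t + k))"
    by (simp add: mult_ac)
  moreover have "0 < real (m + k)" using Suc.prems by simp
  ultimately have st: "real (Suc t) \<le> r * real (Suc t + k)"
    by (simp only: mult_le_cancel_left_pos)
  have "real (Suc t + k) * real (t + k choose t) \<le> real (Suc t + k choose Suc t) * (r * real (Suc t + k))"
    unfolding e by (intro mult_left_mono st) simp
  then have "real (Suc t + k) * real (t + k choose t) \<le> real (Suc t + k) * (r * real (Suc t + k choose Suc t))"
    by (simp only: mult_ac)
  then have "real (t + k choose t) \<le> r * real (Suc t + k choose Suc t)"
    by (rule mult_left_le_imp_le) simp
  then have "real (card (multi_indices (m - Suc j) (Suc k))) \<le> r * real (card (multi_indices (m - j) (Suc k)))"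
    unfolding t by (simp only: card_multi_indices flip: t_def)
  also have "\<dots> \<le> r * (r ^ j * real (card (multi_indices m (Suc k))))"
    using Suc \<open>0 \<le> r\<close> by (intro mult_left_mono) auto
  finally show ?case by (simp add: mult.assoc)
qed simp

lemma sum_odd_geometric: "(\<Sum>k=1..M. (2 * real k - 1) * (2 / 3) ^ k) = 10 - (4 * real M + 10) * (2 / 3) ^ M"
  by (induction M) (simp_all add: field_simps)

text \<open>A square is a sum of consecutive odd numbers, so the layer-cake argument gives weights
  \<open>2 * j - 1\<close>. The hypothesis says \<open>m / (m + k) \<le> 2 / 3\<close>, hence the
  counts decay like \<open>(2 / 3) ^ j\<close>, and 10 is the sum of the infinite series in
  \<open>sum_odd_geometric\<close>.\<close>

lemma index_moment_diag:
  assumes "3 * m \<le> 2 * (m + k)" and i: "i < Suc k"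
  shows "index_moment m (Suc k) i i \<le> 10 * real (card (multi_indices m (Suc k)))"
proof -
  let ?N = "real (card (multi_indices m (Suc k)))"
  have sq: "real (a ^ 2) = (\<Sum>j=1..m. (2 * real j - 1) * of_bool (j \<le> a))" if "a \<le> m" for a
  proof -
    have "(\<Sum>j=1..m. (2 * real j - 1) * of_bool (j \<le> a)) = (\<Sum>j\<in>{1..m} \<inter> {j. j \<le> a}. 2 * real j - 1)"
      by (rule sum.mono_neutral_cong_right) auto
    also have "{1..m} \<inter> {j. j \<le> a} = {1..a}" using that by auto
    also have "(\<Sum>j=1..a. 2 * real j - 1) = real (a ^ 2)"
      by (induction a) (auto simp: power2_eq_square algebra_simps)
    finally show ?thesis ..
  qed
  have "index_moment m (Suc k) i i = (\<Sum>\<alpha>\<in>multi_indices m (Suc k). real ((\<alpha> i) ^ 2))"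
    by (simp add: index_moment_def power2_eq_square)
  also have "\<dots> = (\<Sum>\<alpha>\<in>multi_indices m (Suc k). \<Sum>j=1..m. (2 * real j - 1) * of_bool (j \<le> \<alpha> i))"
    by (intro sum.cong refl sq multi_indices_le)
  also have "\<dots> = (\<Sum>j=1..m. (2 * real j - 1) * (\<Sum>\<alpha>\<in>multi_indices m (Suc k). of_bool (j \<le> \<alpha> i)))"
    by (subst sum.swap) (simp add: sum_distrib_left)
  also have "\<dots> = (\<Sum>j=1..m. (2 * real j - 1) * real (card {\<alpha> \<in> multi_indices m (Suc k). j \<le> \<alpha> i}))"
    by (simp add: of_bool_def sum.If_cases finite_multi_indices Int_def)
  also have "\<dots> \<le> (\<Sum>j=1..m. (2 * real j - 1) * ((2 / 3) ^ j * ?N))"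
  proof (intro sum_mono mult_left_mono)
    fix j assume j: "j \<in> {1..m}"
    then show "real (card {\<alpha> \<in> multi_indices m (Suc k). j \<le> \<alpha> i}) \<le> (2 / 3) ^ j * ?N"
      using assms by (subst card_multi_indices_ge) (auto intro!: card_multi_indices_ratio)
  qed auto
  also have "\<dots> = (\<Sum>j=1..m. (2 * real j - 1) * (2 / 3) ^ j) * ?N"
    by (simp add: sum_distrib_right mult.assoc)
  also have "\<dots> \<le> 10 * ?N"
    unfolding sum_odd_geometric by (intro mult_right_mono) auto
  finally show ?thesis .
qed

text \<open>The off-diagonal moments all agree, so on mean-zero vectors the quadratic form is diagonal.\<close>

lemma sum_multi_indices_quadratic:
  assumes "3 * m \<le> 2 * (m + k)" and \<theta>: "(\<Sum>i<Suc k. \<theta> i) = 0"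
  shows "(\<Sum>\<alpha>\<in>multi_indices m (Suc k). (\<Sum>i<Suc k. real (\<alpha> i) * \<theta> i)\<^sup>2)
    \<le> 10 * real (card (multi_indices m (Suc k))) * (\<Sum>i<Suc k. (\<theta> i)\<^sup>2)"
proof -
  let ?N = "real (card (multi_indices m (Suc k)))" and ?n = "Suc k"
  \<comment> \<open>The value of the common off-diagonal moment stays uncomputed: its sign suffices
    to drop it at the end. With a single variable there is no off-diagonal pair, and
    \<open>0\<close> serves.\<close>
  obtain C where C: "0 \<le> C" "\<And>i j. i < ?n \<Longrightarrow> j < ?n \<Longrightarrow> i \<noteq> j \<Longrightarrow> index_moment m ?n i j = C"
  proof (cases "k = 0")
    case True
    then show ?thesis using that[of 0] by auto
  next
    case False
    show ?thesis
    proof (rule that)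
      show "0 \<le> index_moment m ?n 0 1" by (simp add: index_moment_def sum_nonneg)
      show "index_moment m ?n i j = index_moment m ?n 0 1" if "i < ?n" "j < ?n" "i \<noteq> j" for i j
        using that False by (intro index_moment_offdiag) auto
    qed
  qed
  have "(\<Sum>\<alpha>\<in>multi_indices m ?n. (\<Sum>i<?n. real (\<alpha> i) * \<theta> i)\<^sup>2) =
     (\<Sum>\<alpha>\<in>multi_indices m ?n. \<Sum>i<?n. \<Sum>j<?n. \<theta> i * \<theta> j * (real (\<alpha> i) * real (\<alpha> j)))"
    unfolding power2_eq_square sum_product by (intro sum.cong refl) (simp add: mult_ac)
  also have "\<dots> = (\<Sum>i<?n. \<Sum>j<?n. \<theta> i * \<theta> j * index_moment m ?n i j)"
    unfolding index_moment_def sum_distrib_left by (subst sum.swap, intro sum.cong refl, subst sum.swap) (rule refl)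
  also have "\<dots> = (\<Sum>i<?n. \<Sum>j<?n. C * (\<theta> i * \<theta> j) + (if j = i then (index_moment m ?n i i - C) * (\<theta> i)\<^sup>2 else 0))"
    by (intro sum.cong refl) (use C in \<open>auto simp: algebra_simps power2_eq_square\<close>)
  also have "\<dots> = C * ((\<Sum>i<?n. \<theta> i) * (\<Sum>j<?n. \<theta> j)) + (\<Sum>i<?n. (index_moment m ?n i i - C) * (\<theta> i)\<^sup>2)"
    unfolding sum.distrib
  proof (rule arg_cong2[where f="(+)"])
    show "(\<Sum>i<?n. \<Sum>j<?n. C * (\<theta> i * \<theta> j)) = C * ((\<Sum>i<?n. \<theta> i) * (\<Sum>j<?n. \<theta> j))"
      unfolding sum_product unfolding sum_distrib_left ..
    show "(\<Sum>i<?n. \<Sum>j<?n. if j = i then (index_moment m ?n i i - C) * (\<theta> i)\<^sup>2 else 0) =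
      (\<Sum>i<?n. (index_moment m ?n i i - C) * (\<theta> i)\<^sup>2)"
      by (simp del: sum.lessThan_Suc)
  qed
  also have "\<dots> = (\<Sum>i<?n. (index_moment m ?n i i - C) * (\<theta> i)\<^sup>2)" by (simp only: \<theta> mult_zero_left mult_zero_right add_0)
  also have "\<dots> \<le> (\<Sum>i<?n. (10 * ?N) * (\<theta> i)\<^sup>2)"
  proof (intro sum_mono mult_right_mono)
    fix i assume "i \<in> {..<?n}"
    then show "index_moment m ?n i i - C \<le> 10 * ?N"
      using index_moment_diag[OF assms(1), of i] C(1) by simp
  qed simp
  also have "\<dots> = 10 * ?N * (\<Sum>i<?n. (\<theta> i)\<^sup>2)" by (simp only: sum_distrib_left)
  finally show ?thesis .
qed

section \<open>Polynomials on the polydisc\<close>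

lemma norm_cis_diff_le: "cmod (cis a - cis b) \<le> \<bar>a - b\<bar>"
proof -
  have "(cmod (cis a - cis b))\<^sup>2 = 2 - 2 * cos (a - b)"
    using sin_cos_squared_add[of a] sin_cos_squared_add[of b]
    by (simp only: cmod_power2 cos_diff, simp add: power2_eq_square algebra_simps)
  also have "\<dots> = 4 * (sin ((a - b) / 2))\<^sup>2"
    using cos_double_sin[of "(a - b) / 2"] by (simp only: times_divide_eq_right nonzero_mult_div_cancel_left zero_neq_numeral not_False_eq_True) simp
  also have "\<dots> \<le> 4 * ((a - b) / 2)\<^sup>2"
    using abs_sin_x_le_abs_x[of "(a - b) / 2"] by (intro mult_left_mono) (simp_all only: abs_le_square_iff zero_le_numeral)
  also have "\<dots> = \<bar>a - b\<bar>\<^sup>2" by (simp add: power2_eq_square field_simps)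
  finally show ?thesis by (rule power2_le_imp_le) simp
qed

lemma nearby_root_angle:
  assumes "0 < Q" "0 \<le> x" "x < 2 * pi"
  obtains j where "j < Q" "2 * pi * real j / real Q \<le> x" "x \<le> 2 * pi * real j / real Q + 2 * pi / real Q"
proof -
  define j where "j = nat \<lfloor>x * real Q / (2 * pi)\<rfloor>"
  have y: "0 \<le> x * real Q / (2 * pi)" "x * real Q / (2 * pi) < real Q"
    using assms by (auto simp: field_simps)
  have j: "real j \<le> x * real Q / (2 * pi)" "x * real Q / (2 * pi) \<le> real j + 1"
    using y by (simp_all add: j_def)
  show ?thesis
  proof (rule that)
    show "j < Q" using j y by linarith
    show "2 * pi * real j / real Q \<le> x" using j(1) assms by (simp add: field_simps)
    show "x \<le> 2 * pi * real j / real Q + 2 * pi / real Q"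
      using j(2) assms by (simp add: field_simps)
  qed
qed

lemma unit_complex_angle:
  assumes "cmod z = 1" obtains x where "0 \<le> x" "x < 2 * pi" "z = cis x"
  using assms that[of "Arg2pi z"] Arg2pi_ge_0 Arg2pi_lt_2pi complex_norm_eq_1_exp[of z]
  by (metis Arg2pi_eq cis_conv_exp mult_1 of_real_1)

text \<open>One of \<open>K\<close> equally spaced directions is within the angle
  \<open>2 * pi / K\<close> of \<open>x\<close>, so projecting onto it loses at most the cosine of
  that angle. Tails of moduli thus reduce to tails of real Gaussians at the cost of a union over
  \<open>K\<close> directions.\<close>

lemma direction_exists:
  assumes "2 \<le> K"
  obtains k where "k < K" "cos (2 * pi / real K) * cmod x \<le> Re (cis (- (2 * pi * real k / real K)) * x)"
proof -
  obtain \<psi> where \<psi>: "0 \<le> \<psi>" "\<psi> < 2 * pi" "x = complex_of_real (cmod x) * cis \<psi>"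
    by (metis Arg2pi_eq Arg2pi_ge_0 Arg2pi_lt_2pi cis_conv_exp)
  obtain k where k: "k < K" "2 * pi * real k / real K \<le> \<psi>" "\<psi> \<le> 2 * pi * real k / real K + 2 * pi / real K"
    using nearby_root_angle[of K \<psi>] assms \<psi> by auto
  have "Re (cis (- (2 * pi * real k / real K)) * x) = cmod x * Re (cis (- (2 * pi * real k / real K)) * cis \<psi>)"
    by (subst \<psi>(3)) (simp add: algebra_simps)
  also have "\<dots> = cmod x * cos (\<psi> - 2 * pi * real k / real K)"
    by (simp add: cis_mult)
  also have "\<dots> \<ge> cmod x * cos (2 * pi / real K)"
  proof (intro mult_left_mono cos_monotone_0_pi_le)
    show "2 * pi / real K \<le> pi" using assms by (simp add: field_simps)
  qed (use k in auto)
  finally show ?thesis using that k by (simp add: mult.commute)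
qed

section \<open>Discretisation at roots of unity\<close>

lemma coeff_bound_roots_unity:
  fixes c :: "nat \<Rightarrow> complex"
  assumes Q: "m < Q" and A: "\<And>w. w ^ Q = 1 \<Longrightarrow> cmod (\<Sum>k\<le>m. c k * w ^ k) \<le> A" and l: "l \<le> m"
  shows "cmod (c l) \<le> A"
proof -
  define r where "r j = cis (2 * pi * real j / real Q)" for j
  have r: "r j ^ Q = 1" "cmod (r j) = 1" "r j * cnj (r j) = 1" for j
    using Q by (auto simp: r_def Complex.DeMoivre complex_norm_square[symmetric])
  have rp: "r j ^ k = r k ^ j" for j k
    by (simp add: r_def Complex.DeMoivre mult_ac)
  \<comment> \<open>Discrete Fourier inversion: since \<open>m < Q\<close>, the exponents up to
    \<open>m\<close> are distinct modulo \<open>Q\<close>, and summing against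
    \<open>cnj (r j) ^ l\<close> isolates the coefficient \<open>c l\<close> without
    aliasing.\<close>
  have orth: "(\<Sum>j<Q. r j ^ k * cnj (r j) ^ l) = (if k = l then of_nat Q else 0)" if "k \<le> m" for k
  proof (cases "k = l")
    case True
    then show ?thesis by (simp add: r flip: power_mult_distrib)
  next
    case False
    define \<omega> where "\<omega> = r k * cnj (r l)"
    have "r k \<noteq> r l"
      using Complex.bij_betw_roots_unity[of Q] that l Q False
      by (auto simp: bij_betw_def inj_on_def r_def)
    have "\<omega> \<noteq> 1"
    proof
      assume "\<omega> = 1"
      then have "\<omega> * r l = r l" by simp
      then have "r k = r l" using r(3)[of l] by (simp add: \<omega>_def mult.assoc mult.commute[of "cnj _"])
      then show False using \<open>r k \<noteq> r l\<close> by simp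
    qed
    have "\<omega> ^ Q = 1" by (simp add: \<omega>_def power_mult_distrib r flip: complex_cnj_power)
    have "(\<Sum>j<Q. r j ^ k * cnj (r j) ^ l) = (\<Sum>j<Q. \<omega> ^ j)"
      by (simp add: \<omega>_def power_mult_distrib rp[of _ k] rp[of _ l] flip: complex_cnj_power)
    also have "\<dots> = 0" using \<open>\<omega> \<noteq> 1\<close> \<open>\<omega> ^ Q = 1\<close> by (simp add: geometric_sum)
    finally show ?thesis using False by simp
  qed
  have "(\<Sum>j<Q. (\<Sum>k\<le>m. c k * r j ^ k) * cnj (r j) ^ l) = (\<Sum>k\<le>m. c k * (\<Sum>j<Q. r j ^ k * cnj (r j) ^ l))"
    unfolding sum_distrib_right sum_distrib_left by (subst sum.swap) (simp add: mult.assoc)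
  also have "\<dots> = (\<Sum>k\<le>m. if k = l then c l * of_nat Q else 0)"
    by (intro sum.cong refl) (simp add: orth)
  also have "\<dots> = c l * of_nat Q" using l by simp
  finally have "real Q * cmod (c l) = cmod (\<Sum>j<Q. (\<Sum>k\<le>m. c k * r j ^ k) * cnj (r j) ^ l)"
    by (simp add: norm_mult)
  also have "\<dots> \<le> (\<Sum>j<Q. A)"
    by (rule sum_norm_le) (auto simp: norm_mult norm_power r intro!: A)
  finally show ?thesis using Q by simp
qed

text \<open>The values at the roots of unity bound every coefficient by \<open>A\<close>. Each point
  of the circle is within \<open>7 / Q\<close> of such a root, where 7 exceeds
  \<open>2 * pi\<close>, and moving there changes each of the \<open>m + 1\<close> terms by at most
  \<open>A * (m + 1) * 7 / Q\<close>. The maximum modulus principle extends the bound to the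
  disc.\<close>

lemma roots_unity_disc_bound:
  fixes c :: "nat \<Rightarrow> complex"
  assumes Q: "m < Q" and A: "\<And>w. w ^ Q = 1 \<Longrightarrow> cmod (\<Sum>k\<le>m. c k * w ^ k) \<le> A" and z: "cmod z \<le> 1"
  shows "cmod (\<Sum>k\<le>m. c k * z ^ k) \<le> (1 + 7 * (real m + 1)\<^sup>2 / real Q) * A"
proof -
  let ?p = "\<lambda>z. \<Sum>k\<le>m. c k * z ^ k" and ?B = "(1 + 7 * (real m + 1)\<^sup>2 / real Q) * A"
  have A0: "0 \<le> A" using order_trans[OF norm_ge_zero A[of 1]] by simp
  have circ: "cmod (?p z) \<le> ?B" if z: "cmod z = 1" for z
  proof -
    obtain x where x: "0 \<le> x" "x < 2 * pi" "z = cis x" by (rule unit_complex_angle[OF z])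
    obtain j where j: "j < Q" "2 * pi * real j / real Q \<le> x" "x \<le> 2 * pi * real j / real Q + 2 * pi / real Q"
      using nearby_root_angle[of Q x] Q x by auto
    define w where "w = cis (2 * pi * real j / real Q)"
    have w: "w ^ Q = 1" "cmod w = 1" using Q by (auto simp: w_def Complex.DeMoivre)
    have "cmod (z - w) \<le> \<bar>x - 2 * pi * real j / real Q\<bar>"
      unfolding x(3) w_def by (rule norm_cis_diff_le)
    also have "\<dots> \<le> 2 * pi / real Q" using j by linarith
    also have "\<dots> \<le> 7 / real Q" using pi_less_4 pi_approx by (intro divide_right_mono) auto
    finally have d: "cmod (z - w) \<le> 7 / real Q" .
    have "cmod (?p z - ?p w) = cmod (\<Sum>k\<le>m. c k * (z ^ k - w ^ k))"
      by (simp add: sum_subtractf algebra_simps)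
    also have "\<dots> \<le> (\<Sum>k\<le>m. A * ((real m + 1) * (7 / real Q)))"
    proof (rule sum_norm_le)
      fix k assume k: "k \<in> {..m}"
      have "cmod (z ^ k - w ^ k) \<le> real k * cmod (z - w)"
        using z w by (intro norm_power_diff) auto
      also have "\<dots> \<le> (real m + 1) * (7 / real Q)" using k d by (intro mult_mono) auto
      finally show "cmod (c k * (z ^ k - w ^ k)) \<le> A * ((real m + 1) * (7 / real Q))"
        unfolding norm_mult using coeff_bound_roots_unity[OF Q A, of k] k A0 by (intro mult_mono) auto
    qed
    also have "\<dots> = 7 * (real m + 1)\<^sup>2 / real Q * A" by (simp add: power2_eq_square field_simps)
    finally have "cmod (?p z - ?p w) \<le> 7 * (real m + 1)\<^sup>2 / real Q * A" .
    moreover have "cmod (?p z) \<le> cmod (?p w) + cmod (?p z - ?p w)"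
      by (rule norm_triangle_sub)
    ultimately show ?thesis using A[OF w(1)] by (simp add: distrib_right)
  qed
  show ?thesis
  proof (cases "cmod z = 1")
    case False
    show ?thesis
    proof (rule maximum_modulus_frontier[of ?p "ball 0 1" ?B z])
      show "?p holomorphic_on interior (ball 0 1)" by (intro holomorphic_intros)
      show "continuous_on (closure (ball 0 1)) ?p" by (intro continuous_intros)
    qed (use z circ False in \<open>auto simp: frontier_ball\<close>)
  qed (rule circ)
qed

lemma hom_poly_coord:
  assumes "i < n"
  shows "\<exists>c. \<forall>x. hom_poly m n a (z(i := x)) = (\<Sum>k\<le>m. c k * x ^ k)"
proof (intro exI allI)
  fix x
  let ?c = "\<lambda>k. \<Sum>\<alpha>\<in>{\<alpha> \<in> multi_indices m n. \<alpha> i = k}. a \<alpha> * (\<Prod>j\<in>{..<n} - {i}. z j ^ \<alpha> j)"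
  have "hom_poly m n a (z(i := x)) = (\<Sum>\<alpha>\<in>multi_indices m n. a \<alpha> * (\<Prod>j\<in>{..<n} - {i}. z j ^ \<alpha> j) * x ^ \<alpha> i)"
    unfolding hom_poly_def
  proof (intro sum.cong refl)
    fix \<alpha> :: "nat \<Rightarrow> nat"
    have "(\<Prod>j<n. (z(i := x)) j ^ \<alpha> j) = x ^ \<alpha> i * (\<Prod>j\<in>{..<n} - {i}. (z(i := x)) j ^ \<alpha> j)"
      using assms by (subst prod.remove[of _ i]) auto
    also have "(\<Prod>j\<in>{..<n} - {i}. (z(i := x)) j ^ \<alpha> j) = (\<Prod>j\<in>{..<n} - {i}. z j ^ \<alpha> j)"
      by (intro prod.cong) auto
    finally show "a \<alpha> * (\<Prod>j<n. (z(i := x)) j ^ \<alpha> j) = a \<alpha> * (\<Prod>j\<in>{..<n} - {i}. z j ^ \<alpha> j) * x ^ \<alpha> i"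
      by simp
  qed
  also have "\<dots> = (\<Sum>k\<le>m. \<Sum>\<alpha>\<in>{\<alpha> \<in> multi_indices m n. \<alpha> i = k}. a \<alpha> * (\<Prod>j\<in>{..<n} - {i}. z j ^ \<alpha> j) * x ^ \<alpha> i)"
    by (rule sum.group[symmetric]) (auto simp: finite_multi_indices multi_indices_le)
  also have "\<dots> = (\<Sum>k\<le>m. ?c k * x ^ k)"
    unfolding sum_distrib_right by (intro sum.cong refl) auto
  finally show "hom_poly m n a (z(i := x)) = (\<Sum>k\<le>m. ?c k * x ^ k)" .
qed

lemma hom_poly_cong: "(\<And>i. i < n \<Longrightarrow> z i = w i) \<Longrightarrow> hom_poly m n a z = hom_poly m n a w"
  unfolding hom_poly_def by (auto intro!: sum.cong prod.cong)

text \<open>The coordinates are released from the roots of unity to the disc one at a time;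
  \<open>k\<close> counts those already released, and each release costs one factor of the
  one-variable bound.\<close>

lemma hom_poly_net_bound:
  assumes Q: "m < Q" and A: "\<And>z. (\<And>i. i < n \<Longrightarrow> z i ^ Q = 1) \<Longrightarrow> cmod (hom_poly m n a z) \<le> A"
    and z: "\<And>i. i < n \<Longrightarrow> cmod (z i) \<le> 1"
  shows "cmod (hom_poly m n a z) \<le> (1 + 7 * (real m + 1)\<^sup>2 / real Q) ^ n * A"
proof -
  let ?q = "1 + 7 * (real m + 1)\<^sup>2 / real Q"
  have "cmod (hom_poly m n a z) \<le> ?q ^ k * A"
    if "k \<le> n" "\<And>i. i < k \<Longrightarrow> cmod (z i) \<le> 1" "\<And>i. k \<le> i \<Longrightarrow> i < n \<Longrightarrow> z i ^ Q = 1" for k z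
    using that
  proof (induction k arbitrary: z)
    case 0
    then show ?case using A by simp
  next
    case (Suc k)
    obtain c where c: "\<And>x. hom_poly m n a (z(k := x)) = (\<Sum>l\<le>m. c l * x ^ l)"
      using hom_poly_coord[of k n m a z] Suc.prems by auto
    have "cmod (\<Sum>l\<le>m. c l * z k ^ l) \<le> ?q * (?q ^ k * A)"
    proof (rule roots_unity_disc_bound[OF Q])
      fix w :: complex assume w: "w ^ Q = 1"
      show "cmod (\<Sum>l\<le>m. c l * w ^ l) \<le> ?q ^ k * A"
        unfolding c[symmetric] by (rule Suc.IH) (use Suc.prems w in auto)
    qed (use Suc.prems in auto)
    then show ?case unfolding c[symmetric] by (simp add: mult.assoc)
  qed
  from this[of n z] show ?thesis using z by simp
qed

lemma hom_poly_scale: "hom_poly m n a (\<lambda>i. c * z i) = c ^ m * hom_poly m n a z"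
proof -
  have "(\<Prod>i<n. (c * z i) ^ \<alpha> i) = c ^ m * (\<Prod>i<n. z i ^ \<alpha> i)" if "\<alpha> \<in> multi_indices m n" for \<alpha>
    using that by (simp add: multi_indices_def power_mult_distrib prod.distrib flip: power_sum)
  then show ?thesis
    unfolding hom_poly_def sum_distrib_left by (intro sum.cong refl) simp
qed

lemma poly_sup_norm_le:
  assumes Q: "m < Q" and A: "\<And>z. (\<And>i. i < n \<Longrightarrow> z i ^ Q = 1) \<Longrightarrow> cmod (hom_poly m n a z) \<le> A"
  shows "poly_sup_norm m n a \<le> (1 + 7 * (real m + 1)\<^sup>2 / real Q) ^ n * A"
  unfolding poly_sup_norm_def
proof (rule cSUP_least[OF polydisc_nonempty])
  fix z assume "z \<in> polydisc n"
  then have "cmod (z i) \<le> 1" if "i < n" for i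
    using that by (force simp: polydisc_def PiE_iff)
  then show "cmod (hom_poly m n a z) \<le> (1 + 7 * (real m + 1)\<^sup>2 / real Q) ^ n * A"
    by (intro hom_poly_net_bound[OF Q A])
qed

text \<open>The supremum is taken over the open polydisc, whereas the grids lie on the torus. By
  homogeneity the value at \<open>r * z\<close> is \<open>r ^ m\<close> times the value at
  \<open>z\<close>, and \<open>r\<close> tends to 1 from below.\<close>

lemma hom_poly_le_sup_norm:
  assumes z: "\<And>i. i < n \<Longrightarrow> cmod (z i) \<le> 1"
  shows "cmod (hom_poly m n a z) \<le> poly_sup_norm m n a"
proof -
  have "cmod (complex_of_real r ^ m * hom_poly m n a z) \<le> poly_sup_norm m n a" if "0 < r" "r < 1" for r
  proof -
    let ?w = "restrict (\<lambda>i. complex_of_real r * z i) {..<n}"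
    have "cmod (complex_of_real r * z i) < 1" if "i < n" for i
    proof -
      have "r * cmod (z i) \<le> r * 1" using z[OF that] \<open>0 < r\<close> by (intro mult_left_mono) auto
      then have "r * cmod (z i) < 1" using \<open>r < 1\<close> by linarith
      then show ?thesis using \<open>0 < r\<close> by (simp add: norm_mult)
    qed
    then have "?w \<in> polydisc n" by (auto simp: polydisc_def)
    then have "cmod (hom_poly m n a ?w) \<le> poly_sup_norm m n a"
      unfolding poly_sup_norm_def by (intro cSUP_upper bdd_above_hom_poly)
    also have "hom_poly m n a ?w = hom_poly m n a (\<lambda>i. complex_of_real r * z i)"
      by (rule hom_poly_cong) simp
    finally show ?thesis by (simp add: hom_poly_scale)
  qed
  then have "\<forall>\<^sub>F r in at_left 1. cmod (complex_of_real r ^ m * hom_poly m n a z) \<le> poly_sup_norm m n a"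
    by (intro eventually_at_leftI[of 0]) auto
  moreover have "((\<lambda>r. cmod (complex_of_real r ^ m * hom_poly m n a z)) \<longlongrightarrow>
      cmod (complex_of_real 1 ^ m * hom_poly m n a z)) (at_left 1)"
    by (intro tendsto_intros)
  ultimately show ?thesis
    using tendsto_upperbound[of _ _ "at_left (1::real)"] by fastforce
qed

section \<open>Monomials on the torus and their increments\<close>

definition torus_monom :: "nat \<Rightarrow> (nat \<Rightarrow> real) \<Rightarrow> (nat \<Rightarrow> nat) \<Rightarrow> complex" where
  "torus_monom n x \<alpha> = cis (\<Sum>i<n. real (\<alpha> i) * x i)"

lemma prod_cis_power: "(\<Prod>i<n. cis (x i) ^ \<alpha> i) = torus_monom n x \<alpha>"
  unfolding torus_monom_def
  by (induction n) (simp_all add: Complex.DeMoivre cis_mult)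

lemma hom_poly_torus:
  "hom_poly m n a (\<lambda>i. cis (x i)) = (\<Sum>\<alpha>\<in>multi_indices m n. torus_monom n x \<alpha> * a \<alpha>)"
  unfolding hom_poly_def prod_cis_power by (simp add: mult.commute)

lemma norm_hom_poly_rotate:
  "cmod (hom_poly m n a (\<lambda>i. cis (x i + t))) = cmod (hom_poly m n a (\<lambda>i. cis (x i)))"
proof -
  have "hom_poly m n a (\<lambda>i. cis (x i + t)) = hom_poly m n a (\<lambda>i. cis t * cis (x i))"
    by (simp add: cis_mult add.commute)
  then show ?thesis by (simp add: hom_poly_scale norm_mult norm_power)
qed

text \<open>Since \<open>t\<close> is the mean difference of the arguments, the corrected
  differences sum to zero and \<open>sum_multi_indices_quadratic\<close> applies. As
  \<open>t\<close> is at most \<delta> in absolute value, each of them is at most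
  \<open>2 * \<delta>\<close>, which turns the constant 10 into 40.\<close>

lemma sum_norm_torus_monom_diff:
  assumes "3 * m \<le> 2 * (m + k)" and d: "\<And>i. i < Suc k \<Longrightarrow> \<bar>x i - y i\<bar> \<le> \<delta>"
  defines "t \<equiv> (\<Sum>i<Suc k. x i - y i) / real (Suc k)"
  shows "(\<Sum>\<alpha>\<in>multi_indices m (Suc k). (cmod (torus_monom (Suc k) x \<alpha> - torus_monom (Suc k) (\<lambda>i. y i + t) \<alpha>))\<^sup>2)
    \<le> 40 * real (card (multi_indices m (Suc k))) * real (Suc k) * \<delta>\<^sup>2"
proof -
  let ?N = "real (card (multi_indices m (Suc k)))" and ?\<theta> = "\<lambda>i. x i - y i - t"
  have \<delta>: "0 \<le> \<delta>" using d[of 0] by simp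
  have "\<bar>\<Sum>i<Suc k. x i - y i\<bar> \<le> real (Suc k) * \<delta>"
    using order_trans[OF sum_abs[of "\<lambda>i. x i - y i" "{..<Suc k}"] sum_bounded_above[of "{..<Suc k}" "\<lambda>i. \<bar>x i - y i\<bar>" \<delta>]] d
    by (simp del: sum.lessThan_Suc)
  then have t: "\<bar>t\<bar> \<le> \<delta>" unfolding t_def by (simp add: field_simps del: sum.lessThan_Suc)
  have "(\<Sum>\<alpha>\<in>multi_indices m (Suc k). (cmod (torus_monom (Suc k) x \<alpha> - torus_monom (Suc k) (\<lambda>i. y i + t) \<alpha>))\<^sup>2)
     \<le> (\<Sum>\<alpha>\<in>multi_indices m (Suc k). (\<Sum>i<Suc k. real (\<alpha> i) * ?\<theta> i)\<^sup>2)"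
  proof (rule sum_mono)
    fix \<alpha>
    have "cmod (torus_monom (Suc k) x \<alpha> - torus_monom (Suc k) (\<lambda>i. y i + t) \<alpha>) \<le>
        \<bar>(\<Sum>i<Suc k. real (\<alpha> i) * x i) - (\<Sum>i<Suc k. real (\<alpha> i) * (y i + t))\<bar>"
      unfolding torus_monom_def by (rule norm_cis_diff_le)
    also have "(\<Sum>i<Suc k. real (\<alpha> i) * x i) - (\<Sum>i<Suc k. real (\<alpha> i) * (y i + t)) = (\<Sum>i<Suc k. real (\<alpha> i) * ?\<theta> i)"
      unfolding sum_subtractf[symmetric] by (intro sum.cong refl) (simp add: algebra_simps)
    finally have "(cmod (torus_monom (Suc k) x \<alpha> - torus_monom (Suc k) (\<lambda>i. y i + t) \<alpha>))\<^sup>2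
        \<le> \<bar>\<Sum>i<Suc k. real (\<alpha> i) * ?\<theta> i\<bar>\<^sup>2"
      by (intro power_mono norm_ge_zero)
    then show "(cmod (torus_monom (Suc k) x \<alpha> - torus_monom (Suc k) (\<lambda>i. y i + t) \<alpha>))\<^sup>2
        \<le> (\<Sum>i<Suc k. real (\<alpha> i) * ?\<theta> i)\<^sup>2"
      by (simp only: power2_abs)
  qed
  also have "\<dots> \<le> 10 * ?N * (\<Sum>i<Suc k. (?\<theta> i)\<^sup>2)"
  proof (rule sum_multi_indices_quadratic[OF assms(1)])
    have "(\<Sum>i<Suc k. ?\<theta> i) = (\<Sum>i<Suc k. x i - y i) - real (Suc k) * t"
      by (simp only: sum_subtractf[of "\<lambda>i. x i - y i" "\<lambda>_. t"] sum_constant card_lessThan)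
    then show "(\<Sum>i<Suc k. ?\<theta> i) = 0" unfolding t_def by (simp del: sum.lessThan_Suc of_nat_Suc)
  qed
  also have "\<dots> \<le> 10 * ?N * (\<Sum>i<Suc k. (2 * \<delta>)\<^sup>2)"
  proof (intro mult_left_mono sum_mono)
    fix i assume "i \<in> {..<Suc k}"
    then have "\<bar>?\<theta> i\<bar> \<le> \<bar>2 * \<delta>\<bar>" using d[of i] t \<delta> by simp
    then show "(?\<theta> i)\<^sup>2 \<le> (2 * \<delta>)\<^sup>2" by (simp only: abs_le_square_iff)
  qed simp
  also have "\<dots> = 40 * ?N * real (Suc k) * \<delta>\<^sup>2" by (simp add: power_mult_distrib)
  finally show ?thesis .
qed

section \<open>From the sphere to Gaussian vectors\<close>

text \<open>By higher-order unification these two rules match every measurability goal, which makes the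
  method diverge.\<close>

declare measurable_coeff [measurable del] measurable_gauss_coord [measurable del]

lemma gauss_eq_density:
  assumes I: "finite I"
  shows "gauss I = density (coeff_lborel I)
    (\<lambda>a. ennreal (exp (- (lp_norm 2 I a)\<^sup>2 / 2) / (2 * pi) ^ card I))" (is "_ = ?P")
  unfolding gauss_def
proof (rule product_sigma_finite.PiM_eqI[symmetric])
  show "product_sigma_finite (\<lambda>_::'a. cgauss)" ..
  interpret L: product_sigma_finite "\<lambda>_::'a. lborel :: complex measure" ..
  show "sets ?P = sets (Pi\<^sub>M I (\<lambda>_. cgauss))"
    using sets_gauss[of I] by (simp add: gauss_def)
  let ?f = "\<lambda>z. ennreal (exp (- (cmod z)\<^sup>2 / 2) / (2 * pi))"
  fix A :: "'a \<Rightarrow> complex set" assume "\<And>i. i \<in> I \<Longrightarrow> A i \<in> sets cgauss"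
  then have [measurable]: "\<And>i. i \<in> I \<Longrightarrow> A i \<in> sets borel" by simp
  have PA [measurable]: "Pi\<^sub>E I A \<in> sets (coeff_lborel I)"
    unfolding coeff_lborel_def by (rule sets_PiM_I_finite[OF I]) simp
  have "emeasure ?P (Pi\<^sub>E I A) = (\<integral>\<^sup>+a. ennreal (exp (- (lp_norm 2 I a)\<^sup>2 / 2) / (2 * pi) ^ card I)
      * indicator (Pi\<^sub>E I A) a \<partial>coeff_lborel I)"
    by (rule emeasure_density) measurable
  also have "\<dots> = (\<integral>\<^sup>+a. (\<Prod>i\<in>I. ?f (a i) * indicator (A i) (a i)) \<partial>coeff_lborel I)"
  proof (rule nn_integral_cong)
    fix a :: "'a \<Rightarrow> complex" assume a: "a \<in> space (coeff_lborel I)"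
    have "exp (- (lp_norm 2 I a)\<^sup>2 / 2) / (2 * pi) ^ card I = (\<Prod>i\<in>I. exp (- (cmod (a i))\<^sup>2 / 2) / (2 * pi))"
      by (simp add: lp_norm_2 sum_nonneg prod_dividef exp_sum[OF I, symmetric] sum_negf sum_divide_distrib)
    moreover have "(\<Prod>i\<in>I. indicator (A i) (a i)) = (indicator (Pi\<^sub>E I A) a :: ennreal)"
      using a I by (auto simp: indicator_def space_coeff_lborel PiE_iff)
    ultimately show "ennreal (exp (- (lp_norm 2 I a)\<^sup>2 / 2) / (2 * pi) ^ card I) * indicator (Pi\<^sub>E I A) a
       = (\<Prod>i\<in>I. ?f (a i) * indicator (A i) (a i))"
      by (simp add: prod.distrib prod_ennreal)
  qed
  also have "\<dots> = (\<Prod>i\<in>I. \<integral>\<^sup>+z. ?f z * indicator (A i) z \<partial>lborel)"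
    unfolding coeff_lborel_def by (rule L.product_nn_integral_prod[OF I]) measurable
  also have "\<dots> = (\<Prod>i\<in>I. emeasure cgauss (A i))"
    unfolding cgauss_def by (intro prod.cong refl) (subst emeasure_density; simp)
  finally show "emeasure ?P (Pi\<^sub>E I A) = (\<Prod>i\<in>I. emeasure cgauss (A i))" .
qed (rule I)

lemma emeasure_coeff_lborel_scale:
  assumes I: "finite I" and r: "0 < r" and E: "E \<in> sets (coeff_lborel I)"
  shows "emeasure (coeff_lborel I) {a \<in> space (coeff_lborel I). (\<lambda>i\<in>I. complex_of_real r * a i) \<in> E}
    * ennreal (r ^ (2 * card I)) = emeasure (coeff_lborel I) E"
proof -
  interpret L: product_sigma_finite "\<lambda>_::'a. lborel :: complex measure" ..
  let ?S = "\<lambda>a. \<lambda>i\<in>I. complex_of_real r * a i"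
  have S [measurable]: "?S \<in> coeff_lborel I \<rightarrow>\<^sub>M coeff_lborel I"
    unfolding coeff_lborel_def by (rule measurable_restrict) measurable
  have one: "emeasure lborel {z. complex_of_real r * z \<in> A} * ennreal (r ^ 2) = emeasure lborel A"
    if [measurable]: "A \<in> sets borel" for A :: "complex set"
  proof -
    have "emeasure lborel A = emeasure (density (distr lborel borel (\<lambda>x. 0 + r *\<^sub>R x)) (\<lambda>_. ennreal (\<bar>r\<bar> ^ DIM(complex)))) A"
      using r by (subst lborel_affine[of r 0]) simp_all
    also have "\<dots> = ennreal (r ^ 2) * emeasure lborel {z. complex_of_real r * z \<in> A}"
      using r by (subst emeasure_density_const) (simp_all add: emeasure_distr scaleR_conv_of_real vimage_def)
    finally show ?thesis by (simp add: mult.commute)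
  qed
  have "density (distr (coeff_lborel I) (coeff_lborel I) ?S) (\<lambda>_. ennreal (r ^ (2 * card I))) = coeff_lborel I" (is "?P = _")
    unfolding coeff_lborel_def
  proof (rule L.PiM_eqI[OF I], unfold coeff_lborel_def[symmetric])
    fix A :: "'a \<Rightarrow> complex set" assume "\<And>i. i \<in> I \<Longrightarrow> A i \<in> sets lborel"
    then have A [measurable]: "\<And>i. i \<in> I \<Longrightarrow> A i \<in> sets borel" by simp
    have PA [measurable]: "Pi\<^sub>E I A \<in> sets (coeff_lborel I)"
      unfolding coeff_lborel_def by (rule sets_PiM_I_finite[OF I]) simp
    have A': "{z. complex_of_real r * z \<in> A i} \<in> sets borel" if "i \<in> I" for i
      using measurable_sets[OF _ A[OF that], of "\<lambda>z. complex_of_real r * z" borel] by (simp add: vimage_def)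
    have eq: "?S -` Pi\<^sub>E I A \<inter> space (coeff_lborel I) = Pi\<^sub>E I (\<lambda>i. {z. complex_of_real r * z \<in> A i})"
      by (auto simp: space_coeff_lborel PiE_iff)
    have "emeasure ?P (Pi\<^sub>E I A) = ennreal (r ^ (2 * card I)) * emeasure (coeff_lborel I) (Pi\<^sub>E I (\<lambda>i. {z. complex_of_real r * z \<in> A i}))"
      using PA by (subst emeasure_density_const) (simp_all add: emeasure_distr[OF S PA] eq)
    also have "\<dots> = (\<Prod>i\<in>I. ennreal (r ^ 2)) * (\<Prod>i\<in>I. emeasure lborel {z. complex_of_real r * z \<in> A i})"
      unfolding coeff_lborel_def using r A'
      by (subst L.emeasure_PiM[OF I]) (simp_all add: power_mult flip: ennreal_power)
    also have "\<dots> = (\<Prod>i\<in>I. emeasure lborel (A i))"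
      unfolding prod.distrib[symmetric]
    proof (intro prod.cong refl)
      fix i assume "i \<in> I"
      show "ennreal (r ^ 2) * emeasure lborel {z. complex_of_real r * z \<in> A i} = emeasure lborel (A i)"
        using one[OF A[OF \<open>i \<in> I\<close>]] by (simp only: mult.commute)
    qed
    finally show "emeasure ?P (Pi\<^sub>E I A) = (\<Prod>i\<in>I. emeasure lborel (A i))" .
  qed simp
  then have "emeasure (coeff_lborel I) E = emeasure ?P E" by simp
  also have "\<dots> = ennreal (r ^ (2 * card I)) * emeasure (coeff_lborel I) {a \<in> space (coeff_lborel I). ?S a \<in> E}"
    using E by (subst emeasure_density_const) (simp_all add: emeasure_distr vimage_def Int_def conj_commute)
  finally show ?thesis by (simp add: mult.commute)
qed

lemma lp_norm_2_scale:
  assumes "0 \<le> r"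
  shows "lp_norm 2 I (\<lambda>i\<in>I. complex_of_real r * a i) = r * lp_norm 2 I a"
  using assms
  by (simp add: lp_norm_2 norm_mult power_mult_distrib real_sqrt_mult flip: sum_distrib_left)

text \<open>Measurability is built in, and only positive factors are allowed, so membership of the
  origin is left open. Events about a scale-invariant measurable quantity are of this kind.\<close>

definition cone :: "'i set \<Rightarrow> ('i \<Rightarrow> complex) set \<Rightarrow> bool" where
  "cone I C \<longleftrightarrow> C \<in> sets (coeff_lborel I) \<and>
    (\<forall>a r. a \<in> C \<longrightarrow> 0 < r \<longrightarrow> (\<lambda>i\<in>I. complex_of_real r * a i) \<in> C)"

lemma cone_scale_iff:
  assumes "cone I C" "0 < r" "a \<in> space (coeff_lborel I)"
  shows "(\<lambda>i\<in>I. complex_of_real r * a i) \<in> C \<longleftrightarrow> a \<in> C"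
proof
  assume "(\<lambda>i\<in>I. complex_of_real r * a i) \<in> C"
  then have "(\<lambda>i\<in>I. complex_of_real (1 / r) * (\<lambda>i\<in>I. complex_of_real r * a i) i) \<in> C"
    using assms unfolding cone_def by (meson zero_less_divide_1_iff)
  also have "(\<lambda>i\<in>I. complex_of_real (1 / r) * (\<lambda>i\<in>I. complex_of_real r * a i) i) = a"
    using assms by (auto simp: space_coeff_lborel fun_eq_iff PiE_iff extensional_def)
  finally show "a \<in> C" .
qed (use assms in \<open>auto simp: cone_def\<close>)

text \<open>The parameter \<open>s\<close> is a squared radius; hence the exponent
  \<open>card I\<close>, half of the real dimension.\<close>

lemma emeasure_cone_ball:
  assumes I: "finite I" and C: "cone I C" and s: "0 < s"
  shows "emeasure (coeff_lborel I) {a \<in> C. (lp_norm 2 I a)\<^sup>2 \<le> s} =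
    ennreal (s ^ card I) * emeasure (coeff_lborel I) {a \<in> C. (lp_norm 2 I a)\<^sup>2 \<le> 1}"
proof -
  let ?L = "coeff_lborel I" and ?r = "sqrt s"
  have [measurable]: "C \<in> sets ?L" using C by (simp add: cone_def)
  have sub: "C \<subseteq> space ?L" using sets.sets_into_space[of C ?L] by simp
  have m: "{a \<in> C. (lp_norm 2 I a)\<^sup>2 \<le> s} \<in> sets ?L" for s
  proof -
    have "{a \<in> C. (lp_norm 2 I a)\<^sup>2 \<le> s} = C \<inter> {a \<in> space ?L. (lp_norm 2 I a)\<^sup>2 \<le> s}" using sub by auto
    then show ?thesis by simp
  qed
  have "{a \<in> space ?L. (\<lambda>i\<in>I. complex_of_real ?r * a i) \<in> {a \<in> C. (lp_norm 2 I a)\<^sup>2 \<le> s}}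
      = {a \<in> C. (lp_norm 2 I a)\<^sup>2 \<le> 1}"
    using s sub cone_scale_iff[OF C, of ?r] by (auto simp: lp_norm_2_scale power_mult_distrib)
  moreover have "?r ^ (2 * card I) = s ^ card I" "0 < ?r" using s by (simp_all add: power_mult)
  ultimately have "emeasure ?L {a \<in> C. (lp_norm 2 I a)\<^sup>2 \<le> 1} * ennreal (s ^ card I) =
      emeasure ?L {a \<in> C. (lp_norm 2 I a)\<^sup>2 \<le> s}"
    using emeasure_coeff_lborel_scale[OF I _ m[of s], of ?r] by (simp only:)
  then show ?thesis by (simp only: mult.commute)
qed

text \<open>Writing the Gaussian density as a mixture of indicators of balls, the Gaussian measure of a
  cone is a constant, independent of the cone, times its volume inside the unit ball.\<close>

lemma emeasure_gauss_cone:
  assumes I: "finite I"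
  obtains K where "\<And>C. cone I C \<Longrightarrow>
    emeasure (gauss I) C = K * emeasure (coeff_lborel I) {a \<in> C. (lp_norm 2 I a)\<^sup>2 \<le> 1}"
proof
  let ?L = "coeff_lborel I"
  let ?k = "ennreal (1 / (2 * pi) ^ card I)"
  \<comment> \<open>The cut-off at \<open>0\<close> leaves only balls of positive radius, to which
    \<open>emeasure_cone_ball\<close> applies.\<close>
  let ?g = "\<lambda>s::real. ennreal (exp (- s / 2) / 2) * indicator {0<..} s"
  define K where "K = (\<integral>\<^sup>+s. ?k * (?g s * ennreal (s ^ card I)) \<partial>lborel)"
  fix C assume C: "cone I C"
  have [measurable]: "C \<in> sets ?L" using C by (simp add: cone_def)
  have sub: "C \<subseteq> space ?L" using sets.sets_into_space[of C ?L] by simp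
  interpret L: product_sigma_finite "\<lambda>_::'a. lborel :: complex measure" ..
  interpret L': sigma_finite_measure ?L unfolding coeff_lborel_def by (rule L.sigma_finite[OF I])
  interpret pair_sigma_finite lborel ?L ..
  \<comment> \<open>With \<open>x\<close> the squared norm of a point, the indicator of
    \<open>{x..}\<close> at \<open>s\<close> says that the point lies in the ball of squared radius
    \<open>s\<close>; this is the announced mixture.\<close>
  have lay: "ennreal (exp (- x / 2)) = (\<integral>\<^sup>+s. ?g s * indicator {x..} s \<partial>lborel)" if "0 \<le> x" for x :: real
  proof -
    have "(\<integral>\<^sup>+s. ennreal (exp (- s / 2) / 2) * indicator {x..} s \<partial>lborel) = ennreal (0 - (- exp (- x / 2)))"
    proof (rule nn_integral_FTC_atLeast)
      show "((\<lambda>s::real. - exp (- s / 2)) \<longlongrightarrow> 0) at_top" by real_asymp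
    qed (auto intro!: derivative_eq_intros)
    moreover have "(\<integral>\<^sup>+s. ?g s * indicator {x..} s \<partial>lborel) = (\<integral>\<^sup>+s. ennreal (exp (- s / 2) / 2) * indicator {x..} s \<partial>lborel)"
      by (rule nn_integral_cong_AE)
        (use AE_lborel_singleton[of "0::real"] that in \<open>auto elim!: eventually_mono simp: indicator_def\<close>)
    ultimately show ?thesis by simp
  qed
  have "emeasure (gauss I) C = (\<integral>\<^sup>+a. ennreal (exp (- (lp_norm 2 I a)\<^sup>2 / 2) / (2 * pi) ^ card I) * indicator C a \<partial>?L)"
    unfolding gauss_eq_density[OF I] by (rule emeasure_density) measurable
  also have "\<dots> = (\<integral>\<^sup>+a. (\<integral>\<^sup>+s. ?k * (?g s * (indicator {(lp_norm 2 I a)\<^sup>2..} s * indicator C a)) \<partial>lborel) \<partial>?L)"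
  proof (rule nn_integral_cong)
    fix a
    have "ennreal (exp (- (lp_norm 2 I a)\<^sup>2 / 2) / (2 * pi) ^ card I) = ?k * ennreal (exp (- (lp_norm 2 I a)\<^sup>2 / 2))"
      by (simp flip: ennreal_mult)
    then have "ennreal (exp (- (lp_norm 2 I a)\<^sup>2 / 2) / (2 * pi) ^ card I) * indicator C a =
       ?k * ((\<integral>\<^sup>+s. ?g s * indicator {(lp_norm 2 I a)\<^sup>2..} s \<partial>lborel) * indicator C a)"
      by (simp only: lay[OF zero_le_power2] mult.assoc)
    also have "\<dots> = ?k * (\<integral>\<^sup>+s. ?g s * indicator {(lp_norm 2 I a)\<^sup>2..} s * indicator C a \<partial>lborel)"
      by (subst nn_integral_multc) simp_all
    also have "\<dots> = (\<integral>\<^sup>+s. ?k * (?g s * indicator {(lp_norm 2 I a)\<^sup>2..} s * indicator C a) \<partial>lborel)"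
      by (rule nn_integral_cmult[symmetric]) simp
    finally show "ennreal (exp (- (lp_norm 2 I a)\<^sup>2 / 2) / (2 * pi) ^ card I) * indicator C a =
      (\<integral>\<^sup>+s. ?k * (?g s * (indicator {(lp_norm 2 I a)\<^sup>2..} s * indicator C a)) \<partial>lborel)"
      by (simp only: mult.assoc)
  qed
  also have "\<dots> = (\<integral>\<^sup>+s. (\<integral>\<^sup>+a. ?k * (?g s * (indicator {(lp_norm 2 I a)\<^sup>2..} s * indicator C a)) \<partial>?L) \<partial>lborel)"
  proof (rule Fubini')
    have "(\<lambda>(s, a). ?k * (?g s * (indicator {(lp_norm 2 I a)\<^sup>2..} s * indicator C a)))
      = (\<lambda>p. ?k * (?g (fst p) * ((if (lp_norm 2 I (snd p))\<^sup>2 \<le> fst p then 1 else 0) * indicator C (snd p))))"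
      by (auto simp: fun_eq_iff indicator_def)
    then show "(\<lambda>(s, a). ?k * (?g s * (indicator {(lp_norm 2 I a)\<^sup>2..} s * indicator C a)))
      \<in> borel_measurable (lborel \<Otimes>\<^sub>M ?L)" by simp
  qed
  also have "\<dots> = (\<integral>\<^sup>+s. ?k * (?g s * ennreal (s ^ card I)) * emeasure ?L {a \<in> C. (lp_norm 2 I a)\<^sup>2 \<le> 1} \<partial>lborel)"
  proof (rule nn_integral_cong)
    fix s :: real
    have m: "{a \<in> C. (lp_norm 2 I a)\<^sup>2 \<le> s} \<in> sets ?L"
    proof -
      have "{a \<in> C. (lp_norm 2 I a)\<^sup>2 \<le> s} = C \<inter> {a \<in> space ?L. (lp_norm 2 I a)\<^sup>2 \<le> s}" using sub by auto
      then show ?thesis by simp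
    qed
    have "(\<integral>\<^sup>+a. ?k * (?g s * (indicator {(lp_norm 2 I a)\<^sup>2..} s * indicator C a)) \<partial>?L)
      = (\<integral>\<^sup>+a. ?k * ?g s * indicator {a \<in> C. (lp_norm 2 I a)\<^sup>2 \<le> s} a \<partial>?L)"
      by (rule nn_integral_cong) (auto simp: indicator_def)
    also have "\<dots> = ?k * ?g s * emeasure ?L {a \<in> C. (lp_norm 2 I a)\<^sup>2 \<le> s}"
      using m by (rule nn_integral_cmult_indicator)
    also have "\<dots> = ?k * (?g s * ennreal (s ^ card I)) * emeasure ?L {a \<in> C. (lp_norm 2 I a)\<^sup>2 \<le> 1}"
    proof (cases "0 < s")
      case True
      then show ?thesis by (subst emeasure_cone_ball[OF I C True]) (simp only: mult.assoc)
    qed simp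
    finally show "(\<integral>\<^sup>+a. ?k * (?g s * (indicator {(lp_norm 2 I a)\<^sup>2..} s * indicator C a)) \<partial>?L)
      = ?k * (?g s * ennreal (s ^ card I)) * emeasure ?L {a \<in> C. (lp_norm 2 I a)\<^sup>2 \<le> 1}" .
  qed
  also have "\<dots> = K * emeasure ?L {a \<in> C. (lp_norm 2 I a)\<^sup>2 \<le> 1}"
    unfolding K_def by (rule nn_integral_multc) measurable
  finally show "emeasure (gauss I) C = K * emeasure (coeff_lborel I) {a \<in> C. (lp_norm 2 I a)\<^sup>2 \<le> 1}" .
qed

lemma emeasure_gauss_lp_norm_eq_0:
  assumes I: "finite I" "I \<noteq> {}"
  shows "emeasure (gauss I) {a \<in> space (gauss I). lp_norm 2 I a = 0} = 0"
proof -
  interpret G: product_sigma_finite "\<lambda>_::'a. cgauss" ..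
  have "{a \<in> space (gauss I). lp_norm 2 I a = 0} = Pi\<^sub>E I (\<lambda>_. {0})"
    using I by (auto simp: space_gauss lp_norm_2 sum_nonneg_eq_0_iff PiE_iff fun_eq_iff extensional_def)
  moreover have "emeasure cgauss {0} = 0"
    unfolding cgauss_def by (subst emeasure_density) (simp_all add: nn_integral_null_set cong: nn_integral_cong)
  then have "emeasure (gauss I) (Pi\<^sub>E I (\<lambda>_. {0})) = 0"
    unfolding gauss_def by (subst G.emeasure_PiM) (use I in \<open>simp_all add: card_gt_0_iff\<close>)
  ultimately show ?thesis by (simp only:)
qed

text \<open>Both measures of a cone are fixed multiples of its volume in the unit ball: the Gaussian
  one by \<open>emeasure_gauss_cone\<close>, the spherical one by polar coordinates. The whole
  space, where both have mass one, shows that the multiples agree.\<close>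

lemma normalized_sphere_measure_cone:
  assumes I: "finite I" "I \<noteq> {}" and C: "cone I C"
  shows "measure (normalized_sphere_measure I) (C \<inter> unit_sphere I) = measure (gauss I) C"
proof -
  let ?L = "coeff_lborel I" and ?S = "unit_sphere I" and ?\<sigma> = "sphere_surface_measure I"
  interpret gauss: prob_space "gauss I" by (rule prob_space_gauss)
  have Cm [measurable]: "C \<in> sets ?L" and Cg: "C \<in> sets (gauss I)" using C by (simp_all add: cone_def sets_gauss)
  have sp: "space (gauss I) = space ?L" by (simp add: space_gauss space_coeff_lborel)
  have sub: "C \<subseteq> space ?L" using sets.sets_into_space[OF Cm] .
  obtain K where K: "\<And>C. cone I C \<Longrightarrow> emeasure (gauss I) C = K * emeasure ?L {a \<in> C. (lp_norm 2 I a)\<^sup>2 \<le> 1}"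
    using emeasure_gauss_cone[OF I(1)] by blast
  \<comment> \<open>The sphere sees only the punctured ball, so cones are compared without the
    origin; by \<open>null\<close> this costs no Gaussian mass.\<close>
  let ?D = "\<lambda>C. {a \<in> C. 0 < lp_norm 2 I a}"
  have pos: "0 \<le> lp_norm 2 I a" for a by (simp add: lp_norm_2 sum_nonneg)
  have coneD: "cone I (?D C)" if "cone I C" for C
  proof -
    have C: "C \<in> sets ?L" using that by (simp add: cone_def)
    then have "?D C = C \<inter> {a \<in> space ?L. 0 < lp_norm 2 I a}" using sets.sets_into_space by blast
    then have "?D C \<in> sets ?L" using C by simp
    then show ?thesis using that by (auto simp: cone_def lp_norm_2_scale)
  qed
  have coneU: "cone I (space ?L)"
    unfolding cone_def by (intro conjI allI impI sets.top) (auto simp: space_coeff_lborel)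
  have sg: "emeasure ?\<sigma> (?S \<inter> C) = of_nat (2 * card I) * emeasure ?L {a \<in> ?D C. (lp_norm 2 I a)\<^sup>2 \<le> 1}"
    if C: "cone I C" for C
  proof -
    have Cm: "C \<in> sets ?L" using C by (simp add: cone_def)
    have "?S \<inter> C \<in> sets ?\<sigma>"
      using Cm by (simp add: sets_restrict_space)
    moreover have "{a \<in> punctured_ball I. radial_proj I a \<in> ?S \<inter> C} = {a \<in> ?D C. (lp_norm 2 I a)\<^sup>2 \<le> 1}"
    proof -
      have "radial_proj I a \<in> C \<longleftrightarrow> a \<in> C" if "a \<in> punctured_ball I" for a
      proof -
        have "radial_proj I a = (\<lambda>i\<in>I. complex_of_real (1 / lp_norm 2 I a) * a i)"
          by (auto simp: radial_proj_def)
        then show ?thesis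
          using cone_scale_iff[OF C, of "1 / lp_norm 2 I a" a] that
          by (simp add: punctured_ball_def space_coeff_lborel)
      qed
      moreover have "a \<in> punctured_ball I \<longleftrightarrow> 0 < lp_norm 2 I a \<and> (lp_norm 2 I a)\<^sup>2 \<le> 1" if "a \<in> C" for a
        using that sets.sets_into_space[OF Cm] pos[of a]
        by (auto simp: punctured_ball_def space_coeff_lborel abs_square_le_1)
      ultimately show ?thesis using radial_proj_in_sphere[of _ I] by blast
    qed
    ultimately show ?thesis
      using emeasure_sphere_surface_measure[of "?S \<inter> C" I] cone_eq[of "?S \<inter> C" I] by simp
  qed
  have null: "emeasure (gauss I) (?D C) = emeasure (gauss I) C" if "cone I C" for C
  proof (rule emeasure_eq_AE)
    have "AE a in gauss I. lp_norm 2 I a \<noteq> 0"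
      using emeasure_gauss_lp_norm_eq_0[OF I]
      by (subst AE_iff_measurable[OF _ refl]) (auto simp: sets_gauss sp)
    then show "AE a in gauss I. a \<in> ?D C \<longleftrightarrow> a \<in> C"
      by eventually_elim (use pos in \<open>auto simp: less_le\<close>)
    show "?D C \<in> sets (gauss I)" "C \<in> sets (gauss I)"
      using coneD[OF that] that by (auto simp: cone_def sets_gauss)
  qed
  have one: "K * emeasure ?L {a \<in> ?D (space ?L). (lp_norm 2 I a)\<^sup>2 \<le> 1} = 1"
    using K[OF coneD[OF coneU]] null[OF coneU] gauss.emeasure_space_1 by (simp add: sp)
  let ?v = "\<lambda>C. emeasure ?L {a \<in> ?D C. (lp_norm 2 I a)\<^sup>2 \<le> 1}"
  have v0: "?v (space ?L) \<noteq> 0" using one by auto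
  have SU: "?S \<inter> space ?L = ?S" by (auto simp: unit_sphere_def space_coeff_lborel)
  have vtop: "?v (space ?L) \<noteq> \<infinity>"
  proof -
    have "{a \<in> ?D (space ?L). (lp_norm 2 I a)\<^sup>2 \<le> 1} = punctured_ball I"
      using pos by (auto simp: punctured_ball_def space_coeff_lborel abs_square_le_1)
    then show ?thesis using emeasure_punctured_ball(2)[OF I] by simp
  qed
  have "emeasure (normalized_sphere_measure I) (C \<inter> ?S) = emeasure ?\<sigma> (?S \<inter> C) / emeasure ?\<sigma> ?S"
  proof -
    have "?S \<in> sets ?\<sigma>" "?S \<inter> C \<in> sets ?\<sigma>" using sets.top[of ?\<sigma>] by (simp_all add: sets_restrict_space)
    then show ?thesis
      unfolding normalized_sphere_measure_def
      by (subst emeasure_uniform_measure) (simp_all add: Int_ac)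
  qed
  also have "\<dots> = (of_nat (2 * card I) * ?v C) / (of_nat (2 * card I) * ?v (space ?L))"
    using sg[OF C] sg[OF coneU] by (simp add: SU)
  also have "\<dots> = K * ?v C"
  proof -
    let ?c = "of_nat (2 * card I) :: ennreal"
    have "?c * ?v C = (?c * ?v C) * (K * ?v (space ?L))" by (simp only: one mult_1_right)
    also have "\<dots> = (K * ?v C) * (?c * ?v (space ?L))" by (simp only: mult_ac)
    finally have e: "?c * ?v C = (K * ?v C) * (?c * ?v (space ?L))" .
    have "?c * ?v (space ?L) \<noteq> 0" using v0 I by simp
    moreover have "?c * ?v (space ?L) \<noteq> \<top>"
      using vtop by (simp add: ennreal_mult_eq_top_iff ennreal_of_nat_neq_top)
    ultimately show ?thesis unfolding e by (rule mult_divide_eq_ennreal)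
  qed
  also have "\<dots> = emeasure (gauss I) C" using K[OF coneD[OF C]] null[OF C] by simp
  finally show ?thesis by (simp add: measure_def)
qed

section \<open>Gaussian tails\<close>

abbreviation std_tail :: "real \<Rightarrow> real" where
  "std_tail t \<equiv> measure std_normal_distribution {t<..}"

lemma emeasure_std_normal:
  "A \<in> sets borel \<Longrightarrow> emeasure std_normal_distribution A = (\<integral>\<^sup>+x. ennreal (std_normal_density x) * indicator A x \<partial>lborel)"
  by (rule emeasure_density) auto

text \<open>After a shift by \<open>t\<close>, the inequality
  \<open>(t + x)\<^sup>2 \<ge> t\<^sup>2 + x\<^sup>2\<close> for positive \<open>x\<close> splits
  off the exponential and leaves at most the total mass.\<close>

lemma std_tail_upper:
  assumes "0 \<le> t" shows "std_tail t \<le> exp (- t\<^sup>2 / 2)"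
proof -
  have "emeasure std_normal_distribution {t<..} = (\<integral>\<^sup>+x. ennreal (std_normal_density x) * indicator {t<..} x \<partial>lborel)"
    by (rule emeasure_std_normal) simp
  also have "\<dots> = (\<integral>\<^sup>+x. ennreal (std_normal_density (t + 1 * x)) * indicator {t<..} (t + 1 * x) \<partial>lborel)"
    by (subst nn_integral_real_affine[where c=1 and t=t]) simp_all
  also have "\<dots> \<le> (\<integral>\<^sup>+x. ennreal (exp (- t\<^sup>2 / 2)) * ennreal (std_normal_density x) \<partial>lborel)"
  proof (rule nn_integral_mono)
    fix x :: real
    show "ennreal (std_normal_density (t + 1 * x)) * indicator {t<..} (t + 1 * x)
       \<le> ennreal (exp (- t\<^sup>2 / 2)) * ennreal (std_normal_density x)"
    proof (cases "0 < x")
      case True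
      have "0 \<le> t * x" using assms True by simp
      then have "- (t + x)\<^sup>2 / 2 \<le> - t\<^sup>2 / 2 + - x\<^sup>2 / 2" by (simp add: power2_eq_square field_simps)
      then have "exp (- (t + x)\<^sup>2 / 2) \<le> exp (- t\<^sup>2 / 2) * exp (- x\<^sup>2 / 2)" by (simp flip: exp_add)
      then have "std_normal_density (t + x) \<le> exp (- t\<^sup>2 / 2) * std_normal_density x"
        by (simp add: std_normal_density_def divide_right_mono)
      then show ?thesis using True by (simp flip: ennreal_mult)
    qed simp
  qed
  also have "\<dots> = ennreal (exp (- t\<^sup>2 / 2)) * emeasure std_normal_distribution UNIV"
    by (simp add: nn_integral_cmult emeasure_std_normal)
  also have "\<dots> = ennreal (exp (- t\<^sup>2 / 2))"
    using std_normal.emeasure_space_1 by simp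
  finally show ?thesis by (simp add: std_normal.emeasure_eq_measure)
qed

lemma measure_std_normal_Ioc_le:
  assumes "a \<le> b" "\<And>x. a < x \<Longrightarrow> x \<le> b \<Longrightarrow> std_normal_density x \<le> C" "0 \<le> C"
  shows "measure std_normal_distribution {a<..b} \<le> C * (b - a)"
proof -
  have "emeasure std_normal_distribution {a<..b} = (\<integral>\<^sup>+x. ennreal (std_normal_density x) * indicator {a<..b} x \<partial>lborel)"
    by (rule emeasure_std_normal) simp
  also have "\<dots> \<le> (\<integral>\<^sup>+x. ennreal C * indicator {a<..b} x \<partial>lborel)"
    using assms by (intro nn_integral_mono) (auto simp: indicator_def intro: ennreal_leI)
  also have "\<dots> = ennreal (C * (b - a))"
    using assms by (simp add: nn_integral_cmult_indicator ennreal_mult)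
  finally show ?thesis using assms by (simp add: std_normal.emeasure_eq_measure)
qed

lemma measure_std_normal_Ioc_ge:
  assumes "a \<le> b" "\<And>x. a < x \<Longrightarrow> x \<le> b \<Longrightarrow> C \<le> std_normal_density x" "0 \<le> C"
  shows "C * (b - a) \<le> measure std_normal_distribution {a<..b}"
proof -
  have "ennreal (C * (b - a)) = (\<integral>\<^sup>+x. ennreal C * indicator {a<..b} x \<partial>lborel)"
    using assms by (simp add: nn_integral_cmult_indicator ennreal_mult)
  also have "\<dots> \<le> (\<integral>\<^sup>+x. ennreal (std_normal_density x) * indicator {a<..b} x \<partial>lborel)"
    using assms by (intro nn_integral_mono) (auto simp: indicator_def intro: ennreal_leI)
  also have "\<dots> = emeasure std_normal_distribution {a<..b}"
    by (rule emeasure_std_normal[symmetric]) simp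
  finally show ?thesis using assms by (simp add: std_normal.emeasure_eq_measure)
qed

text \<open>On the interval of length \<open>1 / (1 + t)\<close> to the right of \<open>t\<close>
  the square grows by at most 3, so the exponential loses less than a factor \<open>exp 2\<close>
  there. The constant 27 is 9 times 3, with 9 bounding \<open>exp 2\<close> and 3 bounding
  \<open>sqrt (2 * pi)\<close>.\<close>

lemma std_tail_lower:
  assumes t: "0 \<le> t" shows "exp (- t\<^sup>2 / 2) / (27 * (1 + t)) \<le> std_tail t"
proof -
  define b where "b = t + 1 / (1 + t)"
  let ?C = "exp (- t\<^sup>2 / 2) / 27"
  have b: "t \<le> b" using t by (simp add: b_def)
  have "?C * (b - t) \<le> measure std_normal_distribution {t<..b}"
  proof (rule measure_std_normal_Ioc_ge[OF b])
    fix x assume x: "t < x" "x \<le> b"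
    have "x\<^sup>2 \<le> b\<^sup>2" using x t by (intro power_mono) auto
    also have "b\<^sup>2 = t\<^sup>2 + 2 * (t / (1 + t)) + (1 / (1 + t))\<^sup>2"
      by (simp add: b_def power2_eq_square algebra_simps)
    also have "\<dots> \<le> t\<^sup>2 + 2 * 1 + 1\<^sup>2"
      using t by (intro add_mono mult_left_mono power_mono) auto
    finally have "- t\<^sup>2 / 2 + (-2) \<le> - x\<^sup>2 / 2" by simp
    then have e: "exp (- t\<^sup>2 / 2) * exp (-2) \<le> exp (- x\<^sup>2 / 2)" by (simp flip: exp_add)
    have "sqrt (2 * pi) \<le> sqrt (3\<^sup>2)" using pi_less_4 by (intro real_sqrt_le_mono) simp
    then have s: "sqrt (2 * pi) \<le> 3" by simp
    have e2: "(1::real) / 27 \<le> exp (-2) / 3"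
    proof -
      have "exp (2::real) = (exp 1)\<^sup>2" by (simp flip: exp_double)
      also have "\<dots> \<le> 3\<^sup>2" using exp_le by (intro power_mono) auto
      finally have "exp (2::real) \<le> 9" by simp
      then show ?thesis by (simp add: exp_minus field_simps)
    qed
    have "?C \<le> exp (- t\<^sup>2 / 2) * exp (-2) / 3"
      using mult_left_mono[OF e2, of "exp (- t\<^sup>2 / 2)"] by (simp add: field_simps)
    also have "\<dots> \<le> exp (- x\<^sup>2 / 2) / sqrt (2 * pi)"
      using e s by (intro frac_le) auto
    finally show "?C \<le> std_normal_density x" by (simp add: std_normal_density_def)
  qed simp
  also have "\<dots> \<le> std_tail t" by (intro std_normal.finite_measure_mono) auto
  finally show ?thesis by (simp add: b_def field_simps)
qed

lemma std_tail_pos: "0 \<le> t \<Longrightarrow> 0 < std_tail t"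
  by (rule less_le_trans[OF _ std_tail_lower]) auto

text \<open>A correlation between two values acts like a slight lowering of the level by
  \<open>h\<close>. The added mass lies in an interval of length \<open>h\<close>, on which the
  density is at most \<open>exp (t * h)\<close> times \<open>exp (- t\<^sup>2 / 2)\<close>.\<close>

lemma std_tail_shift:
  assumes h: "0 \<le> h" "h \<le> t"
  shows "std_tail (t - h) \<le> std_tail t + h * (exp (t * h) * exp (- t\<^sup>2 / 2))"
proof -
  have "std_tail (t - h) = measure std_normal_distribution ({t - h<..t} \<union> {t<..})"
    using h by (intro arg_cong[where f="measure _"]) auto
  also have "\<dots> = measure std_normal_distribution {t - h<..t} + std_tail t"
    by (intro std_normal.finite_measure_Union) auto
  also have "measure std_normal_distribution {t - h<..t} \<le> (exp (t * h) * exp (- t\<^sup>2 / 2)) * (t - (t - h))"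
  proof (rule measure_std_normal_Ioc_le)
    fix x assume x: "t - h < x" "x \<le> t"
    have "(t - h)\<^sup>2 \<le> x\<^sup>2" using x h by (intro power_mono) auto
    moreover have "t\<^sup>2 - 2 * (t * h) \<le> (t - h)\<^sup>2" by (simp add: power2_eq_square algebra_simps)
    ultimately have "- x\<^sup>2 / 2 \<le> t * h + - t\<^sup>2 / 2" by linarith
    then have "exp (- x\<^sup>2 / 2) \<le> exp (t * h) * exp (- t\<^sup>2 / 2)" by (simp flip: exp_add)
    moreover have "1 \<le> sqrt (2 * pi)" using pi_gt3 by simp
    ultimately have "exp (- x\<^sup>2 / 2) / sqrt (2 * pi) \<le> (exp (t * h) * exp (- t\<^sup>2 / 2)) / 1"
      by (intro frac_le) auto
    then show "std_normal_density x \<le> exp (t * h) * exp (- t\<^sup>2 / 2)"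
      by (simp add: std_normal_density_def)
  qed (use h in auto)
  finally show ?thesis by (simp add: mult.commute)
qed

lemma real_form_tail:
  assumes I: "finite I" and V: "(\<Sum>i\<in>I. (cmod (c i))\<^sup>2) \<le> V" and t: "0 \<le> t"
  shows "measure (gauss I) {a \<in> space (gauss I). t < real_form I c a} \<le> exp (- t\<^sup>2 / (2 * V))"
proof (cases "(\<Sum>i\<in>I. (cmod (c i))\<^sup>2) = 0")
  case True
  then have "real_form I c a = 0" for a
    using I by (simp add: real_form_def sum_nonneg_eq_0_iff)
  then have "{a \<in> space (gauss I). t < real_form I c a} = {}" using t by auto
  then show ?thesis by (simp only: measure_empty exp_ge_zero)
next
  case False
  define \<sigma> where "\<sigma> = sqrt (\<Sum>i\<in>I. (cmod (c i))\<^sup>2)"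
  have s0: "0 \<le> (\<Sum>i\<in>I. (cmod (c i))\<^sup>2)" by (simp add: sum_nonneg)
  then have \<sigma>: "0 < \<sigma>" "\<sigma>\<^sup>2 = (\<Sum>i\<in>I. (cmod (c i))\<^sup>2)" using False by (simp_all add: \<sigma>_def less_le)
  let ?c = "\<lambda>i. complex_of_real (1 / \<sigma>) * c i"
  have "(\<Sum>i\<in>I. (cmod (?c i))\<^sup>2) = (\<Sum>i\<in>I. (cmod (c i))\<^sup>2) / \<sigma>\<^sup>2"
    unfolding sum_divide_distrib by (intro sum.cong refl) (simp add: norm_divide power_divide)
  also have "\<dots> = 1" using False by (simp add: \<sigma>(2))
  finally have one: "(\<Sum>i\<in>I. (cmod (?c i))\<^sup>2) = 1" .
  have "{a \<in> space (gauss I). t < real_form I c a} = {a \<in> space (gauss I). real_form I ?c a \<in> {t / \<sigma><..}}"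
    unfolding real_form_scale using \<sigma> by (auto simp: field_simps)
  then have "measure (gauss I) {a \<in> space (gauss I). t < real_form I c a} = std_tail (t / \<sigma>)"
    using prob_real_form[OF I one, of "{t / \<sigma><..}"] by simp
  also have "\<dots> \<le> exp (- (t / \<sigma>)\<^sup>2 / 2)" using t \<sigma> by (intro std_tail_upper) auto
  also have "\<dots> \<le> exp (- t\<^sup>2 / (2 * V))"
  proof -
    have "0 < \<sigma>\<^sup>2" using \<sigma>(1) by (rule zero_less_power)
    moreover have "\<sigma>\<^sup>2 \<le> V" unfolding \<sigma>(2) by (rule V)
    ultimately have "t\<^sup>2 / (2 * V) \<le> t\<^sup>2 / (2 * \<sigma>\<^sup>2)" by (intro frac_le) auto
    then show ?thesis by (simp add: power_divide mult.commute)
  qed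
  finally show ?thesis .
qed

lemma measurable_linear_form: "(\<lambda>a. \<Sum>i\<in>I. c i * a i) \<in> borel_measurable (gauss I)"
  by (intro borel_measurable_sum borel_measurable_times borel_measurable_const measurable_gauss_coord)

text \<open>A union over the \<open>K\<close> directions of \<open>direction_exists\<close>. From
  \<open>K = 5\<close> on, the angle \<open>2 * pi / K\<close> is less than a right angle and the
  cosine is positive; as \<open>K\<close> grows, the loss in the exponent disappears.\<close>

lemma linear_form_tail:
  assumes I: "finite I" and V: "(\<Sum>i\<in>I. (cmod (c i))\<^sup>2) \<le> V" and t: "0 \<le> t" and K: "5 \<le> K"
  shows "measure (gauss I) {a \<in> space (gauss I). t < cmod (\<Sum>i\<in>I. c i * a i)}
    \<le> real K * exp (- (t * cos (2 * pi / real K))\<^sup>2 / (2 * V))"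
proof -
  interpret prob_space "gauss I" by (rule prob_space_gauss)
  let ?\<kappa> = "cos (2 * pi / real K)"
  have \<kappa>: "0 < ?\<kappa>" using K by (intro cos_gt_zero_pi) (auto simp: field_simps intro: less_le_trans[of _ 0])
  let ?c = "\<lambda>k i. cis (- (2 * pi * real k / real K)) * c i"
  let ?A = "\<lambda>k. {a \<in> space (gauss I). t * ?\<kappa> < real_form I (?c k) a}"
  have m: "?A k \<in> sets (gauss I)" for k by measurable
  have "{a \<in> space (gauss I). t < cmod (\<Sum>i\<in>I. c i * a i)} \<subseteq> (\<Union>k<K. ?A k)"
  proof
    fix a assume a: "a \<in> {a \<in> space (gauss I). t < cmod (\<Sum>i\<in>I. c i * a i)}"
    let ?x = "\<Sum>i\<in>I. c i * a i"
    obtain k where k: "k < K" "?\<kappa> * cmod ?x \<le> Re (cis (- (2 * pi * real k / real K)) * ?x)"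
      using direction_exists[of K ?x] K by auto
    have "t * ?\<kappa> < ?\<kappa> * cmod ?x" using a \<kappa> by (simp add: mult.commute)
    also note k(2)
    also have "Re (cis (- (2 * pi * real k / real K)) * ?x) = real_form I (?c k) a"
      unfolding real_form_def by (simp only: sum_distrib_left mult.assoc)
    finally show "a \<in> (\<Union>k<K. ?A k)" using a k by auto
  qed
  then have "prob {a \<in> space (gauss I). t < cmod (\<Sum>i\<in>I. c i * a i)} \<le> prob (\<Union>k<K. ?A k)"
    using m by (intro finite_measure_mono) auto
  also have "\<dots> \<le> (\<Sum>k<K. prob (?A k))"
    using m by (intro finite_measure_subadditive_finite) auto
  also have "\<dots> \<le> (\<Sum>k<K. exp (- (t * ?\<kappa>)\<^sup>2 / (2 * V)))"
  proof (rule sum_mono)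
    fix k
    have "(\<Sum>i\<in>I. (cmod (?c k i))\<^sup>2) \<le> V" using V by (simp add: norm_mult)
    then show "prob (?A k) \<le> exp (- (t * ?\<kappa>)\<^sup>2 / (2 * V))"
      using real_form_tail[OF I, of "?c k" V "t * ?\<kappa>"] t \<kappa> by simp
  qed
  finally show ?thesis by simp
qed

section \<open>Upper bound for the supremum norm\<close>

text \<open>Here \<open>t\<close> is the level allowed on the coarse grid and \<open>s\<close> the
  level for the increments from a fine grid point to its coarse neighbour. The rotation
  \<open>\<tau> g\<close> depends on the fine point, but the modulus at a rotated coarse point
  equals that at the point itself, so the first union still ranges over only
  \<open>q ^ Suc k\<close> events. The second ranges over \<open>Q ^ Suc k\<close> increments, whose
  variance is \<open>N\<close> times a quantity of order \<open>Suc k / q\<^sup>2\<close>.\<close>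

lemma prob_sup_norm_upper:
  assumes mk: "3 * m \<le> 2 * (m + k)" and Q: "m < Q" and q: "0 < q" and K: "5 \<le> K" and ts: "0 \<le> t" "0 \<le> s"
  defines "I \<equiv> multi_indices m (Suc k)"
  defines "N \<equiv> real (card I)"
  shows "measure (gauss I) {a \<in> space (gauss I).
      (1 + 7 * (real m + 1)\<^sup>2 / real Q) ^ Suc k * (t + s) < poly_sup_norm m (Suc k) a}
    \<le> real q ^ Suc k * (real K * exp (- (t * cos (2 * pi / real K))\<^sup>2 / (2 * N)))
      + real Q ^ Suc k * (real K * exp (- (s * cos (2 * pi / real K))\<^sup>2 / (2 * (40 * N * real (Suc k) * (2 * pi / real q)\<^sup>2))))"
proof -
  interpret prob_space "gauss I" by (rule prob_space_gauss)
  let ?n = "Suc k"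
  have I: "finite I" by (simp add: I_def finite_multi_indices)
  define x where "x = (\<lambda>(g::nat \<Rightarrow> nat) i. 2 * pi * real (g i) / real Q)"
  define y where "y = (\<lambda>(h::nat \<Rightarrow> nat) i. 2 * pi * real (h i) / real q)"
  have "\<exists>h\<in>{..<?n} \<rightarrow>\<^sub>E {..<q}. \<forall>i<?n. \<bar>x g i - y h i\<bar> \<le> 2 * pi / real q" if g: "g \<in> {..<?n} \<rightarrow>\<^sub>E {..<Q}" for g
  proof -
    have "\<exists>j<q. \<bar>x g i - 2 * pi * real j / real q\<bar> \<le> 2 * pi / real q" if i: "i < ?n" for i
    proof -
      have "g i < Q" using g i by (auto simp: PiE_iff)
      then have "0 \<le> x g i" "x g i < 2 * pi" by (simp_all add: x_def field_simps)
      then obtain j where "j < q" "2 * pi * real j / real q \<le> x g i" "x g i \<le> 2 * pi * real j / real q + 2 * pi / real q"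
        using nearby_root_angle[OF q] by blast
      then show ?thesis by (intro exI[of _ j]) auto
    qed
    then obtain f where f: "\<And>i. i < ?n \<Longrightarrow> f i < q \<and> \<bar>x g i - 2 * pi * real (f i) / real q\<bar> \<le> 2 * pi / real q"
      by metis
    show ?thesis
      by (rule bexI[of _ "restrict f {..<?n}"]) (use f in \<open>auto simp: y_def\<close>)
  qed
  then obtain H where H: "\<And>g. g \<in> {..<?n} \<rightarrow>\<^sub>E {..<Q} \<Longrightarrow> H g \<in> {..<?n} \<rightarrow>\<^sub>E {..<q}"
    "\<And>g i. g \<in> {..<?n} \<rightarrow>\<^sub>E {..<Q} \<Longrightarrow> i < ?n \<Longrightarrow> \<bar>x g i - y (H g) i\<bar> \<le> 2 * pi / real q"
    by metis
  define \<tau> where "\<tau> g = (\<Sum>i<?n. x g i - y (H g) i) / real ?n" for g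
  let ?P = "\<lambda>x a. \<Sum>\<alpha>\<in>I. torus_monom ?n x \<alpha> * a \<alpha>"
  let ?d = "\<lambda>g \<alpha>. torus_monom ?n (x g) \<alpha> - torus_monom ?n (\<lambda>i. y (H g) i + \<tau> g) \<alpha>"
  let ?A = "\<lambda>h. {a \<in> space (gauss I). t < cmod (?P (y h) a)}"
  let ?B = "\<lambda>g. {a \<in> space (gauss I). s < cmod (\<Sum>\<alpha>\<in>I. ?d g \<alpha> * a \<alpha>)}"
  let ?T1 = "{..<?n} \<rightarrow>\<^sub>E {..<q}" and ?T2 = "{..<?n} \<rightarrow>\<^sub>E {..<Q}"
  have fin: "finite ?T1" "finite ?T2" by (auto intro: finite_PiE)
  have card: "card ?T1 = q ^ ?n" "card ?T2 = Q ^ ?n" by (simp_all add: card_PiE)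
  have mA: "?A h \<in> sets (gauss I)" for h
    using measurable_linear_form[of "torus_monom ?n (y h)" I] by measurable
  have mB: "?B g \<in> sets (gauss I)" for g
    using measurable_linear_form[of "?d g" I] by measurable
  have sub: "{a \<in> space (gauss I). (1 + 7 * (real m + 1)\<^sup>2 / real Q) ^ ?n * (t + s) < poly_sup_norm m ?n a}
     \<subseteq> (\<Union>h\<in>?T1. ?A h) \<union> (\<Union>g\<in>?T2. ?B g)"
  proof (rule ccontr)
    assume "\<not> ?thesis"
    then obtain a where a: "a \<in> space (gauss I)"
      "(1 + 7 * (real m + 1)\<^sup>2 / real Q) ^ ?n * (t + s) < poly_sup_norm m ?n a"
      "\<And>h. h \<in> ?T1 \<Longrightarrow> cmod (?P (y h) a) \<le> t" "\<And>g. g \<in> ?T2 \<Longrightarrow> cmod (\<Sum>\<alpha>\<in>I. ?d g \<alpha> * a \<alpha>) \<le> s"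
      by (auto simp: subset_eq not_less)
    have "poly_sup_norm m ?n a \<le> (1 + 7 * (real m + 1)\<^sup>2 / real Q) ^ ?n * (t + s)"
    proof (rule poly_sup_norm_le[OF Q])
      fix z :: "nat \<Rightarrow> complex" assume z: "\<And>i. i < ?n \<Longrightarrow> z i ^ Q = 1"
      have "\<exists>j<Q. z i = cis (2 * pi * real j / real Q)" if "i < ?n" for i
      proof -
        have "z i \<in> (\<lambda>k. cis (2 * pi * real k / real Q)) ` {..<Q}"
          using Complex.bij_betw_roots_unity[of Q] Q z[OF that] by (simp add: bij_betw_def)
        then show ?thesis by auto
      qed
      then obtain f where f: "\<And>i. i < ?n \<Longrightarrow> f i < Q \<and> z i = cis (2 * pi * real (f i) / real Q)" by metis
      define g where "g = restrict f {..<?n}"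
      have g: "g \<in> ?T2" using f by (auto simp: g_def)
      have "hom_poly m ?n a z = hom_poly m ?n a (\<lambda>i. cis (x g i))"
        by (rule hom_poly_cong) (use f in \<open>auto simp: g_def x_def\<close>)
      also have "\<dots> = (\<Sum>\<alpha>\<in>I. ?d g \<alpha> * a \<alpha>) + hom_poly m ?n a (\<lambda>i. cis (y (H g) i + \<tau> g))"
        unfolding hom_poly_torus I_def by (simp add: left_diff_distrib sum_subtractf)
      finally have "cmod (hom_poly m ?n a z) \<le> cmod (\<Sum>\<alpha>\<in>I. ?d g \<alpha> * a \<alpha>) + cmod (hom_poly m ?n a (\<lambda>i. cis (y (H g) i + \<tau> g)))"
        by (simp only: norm_triangle_ineq)
      also have "cmod (hom_poly m ?n a (\<lambda>i. cis (y (H g) i + \<tau> g))) = cmod (?P (y (H g)) a)"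
        unfolding norm_hom_poly_rotate by (simp only: hom_poly_torus I_def)
      also have "cmod (\<Sum>\<alpha>\<in>I. ?d g \<alpha> * a \<alpha>) + cmod (?P (y (H g)) a) \<le> s + t"
        by (intro add_mono a(4)[OF g] a(3)[OF H(1)[OF g]])
      finally show "cmod (hom_poly m ?n a z) \<le> t + s" by simp
    qed
    with a(2) show False by simp
  qed
  have "prob {a \<in> space (gauss I). (1 + 7 * (real m + 1)\<^sup>2 / real Q) ^ ?n * (t + s) < poly_sup_norm m ?n a}
     \<le> prob ((\<Union>h\<in>?T1. ?A h) \<union> (\<Union>g\<in>?T2. ?B g))"
    by (rule finite_measure_mono[OF sub]) (intro sets.Un sets.finite_UN fin mA mB)
  also have "\<dots> \<le> prob (\<Union>h\<in>?T1. ?A h) + prob (\<Union>g\<in>?T2. ?B g)"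
    by (intro measure_Un_le sets.finite_UN fin mA mB)
  also have "\<dots> \<le> (\<Sum>h\<in>?T1. prob (?A h)) + (\<Sum>g\<in>?T2. prob (?B g))"
    using fin mA mB by (intro add_mono finite_measure_subadditive_finite) auto
  also have "(\<Sum>h\<in>?T1. prob (?A h)) \<le> (\<Sum>h\<in>?T1. real K * exp (- (t * cos (2 * pi / real K))\<^sup>2 / (2 * N)))"
    by (intro sum_mono linear_form_tail[OF I _ ts(1) K]) (simp add: torus_monom_def N_def)
  also have "(\<Sum>g\<in>?T2. prob (?B g)) \<le> (\<Sum>g\<in>?T2. real K * exp (- (s * cos (2 * pi / real K))\<^sup>2 / (2 * (40 * N * real (Suc k) * (2 * pi / real q)\<^sup>2))))"
  proof (intro sum_mono linear_form_tail[OF I _ ts(2) K])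
    fix g assume "g \<in> ?T2"
    then show "(\<Sum>\<alpha>\<in>I. (cmod (?d g \<alpha>))\<^sup>2) \<le> 40 * N * real (Suc k) * (2 * pi / real q)\<^sup>2"
      unfolding I_def N_def \<tau>_def by (intro sum_norm_torus_monom_diff mk H(2))
  qed
  finally show ?thesis by (simp only: sum_constant card of_nat_power)
qed

section \<open>The second moment method\<close>

text \<open>Chebyshev's inequality for the number \<open>Z\<close> of events that occur: where none
  occurs, \<open>(Z x - \<mu>)\<^sup>2\<close> equals \<open>\<mu>\<^sup>2\<close>. In the second
  moment every pair is charged \<open>J\<close>, and a bad pair additionally the probability of a
  single event. The bound is effective when \<open>J\<close> is close to
  \<open>\<pi>\<^sup>2\<close>, the value for independent events.\<close>

lemma (in prob_space) second_moment_bound: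
  assumes G: "finite G" "G \<noteq> {}" and A: "\<And>g. g \<in> G \<Longrightarrow> A g \<in> events" "\<And>g. g \<in> G \<Longrightarrow> prob (A g) = \<pi>" and \<pi>: "0 < \<pi>"
    and bad: "\<And>g. g \<in> G \<Longrightarrow> real (card {h \<in> G. bad g h}) \<le> b"
    and J: "0 \<le> J" "\<And>g h. g \<in> G \<Longrightarrow> h \<in> G \<Longrightarrow> \<not> bad g h \<Longrightarrow> prob (A g \<inter> A h) \<le> J"
  shows "prob (space M - (\<Union>g\<in>G. A g)) \<le> b / (real (card G) * \<pi>) + J / \<pi>\<^sup>2 - 1"
proof -
  define Z where "Z x = (\<Sum>g\<in>G. indicator (A g) x :: real)" for x
  define \<mu> where "\<mu> = real (card G) * \<pi>"
  have cG: "0 < real (card G)" using G by (simp add: card_gt_0_iff)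
  have \<mu>: "0 < \<mu>" using cG \<pi> by (simp add: \<mu>_def)
  have iA: "integrable M (indicator (A g) :: _ \<Rightarrow> real)" if "g \<in> G" for g
    using A(1)[OF that] by (simp add: integrable_indicator_iff emeasure_eq_measure)
  have iZ: "integrable M Z" unfolding Z_def using iA by auto
  have EZ: "(\<integral>x. Z x \<partial>M) = \<mu>" unfolding Z_def using iA A by (simp add: \<mu>_def)
  have Z2: "(Z x)\<^sup>2 = (\<Sum>g\<in>G. \<Sum>h\<in>G. indicator (A g \<inter> A h) x)" for x
    unfolding Z_def power2_eq_square sum_product by (simp add: indicator_inter_arith)
  have iAA: "integrable M (indicator (A g \<inter> A h) :: _ \<Rightarrow> real)" if "g \<in> G" "h \<in> G" for g h
    using A(1)[OF that(1)] A(1)[OF that(2)] by (simp add: integrable_indicator_iff emeasure_eq_measure)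
  have iZ2: "integrable M (\<lambda>x. (Z x)\<^sup>2)" unfolding Z2 using iAA by auto
  have "(\<integral>x. (Z x)\<^sup>2 \<partial>M) = (\<Sum>g\<in>G. \<Sum>h\<in>G. prob (A g \<inter> A h))"
    unfolding Z2 using iAA A(1) by (simp add: Bochner_Integration.integral_sum)
  also have "\<dots> \<le> (\<Sum>g\<in>G. b * \<pi> + real (card G) * J)"
  proof (rule sum_mono)
    fix g assume g: "g \<in> G"
    have "(\<Sum>h\<in>G. prob (A g \<inter> A h)) \<le> (\<Sum>h\<in>G. (if bad g h then \<pi> else 0) + J)"
    proof (rule sum_mono)
      fix h assume h: "h \<in> G"
      have "prob (A g \<inter> A h) \<le> prob (A g)" using A(1)[OF g] A(1)[OF h] by (intro finite_measure_mono) auto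
      then show "prob (A g \<inter> A h) \<le> (if bad g h then \<pi> else 0) + J"
        using J(2)[OF g h] A(2)[OF g] J(1) by auto
    qed
    also have "\<dots> = real (card {h \<in> G. bad g h}) * \<pi> + real (card G) * J"
      using G by (simp add: sum.distrib sum.If_cases Int_def)
    also have "\<dots> \<le> b * \<pi> + real (card G) * J"
      using bad[OF g] \<pi> by simp
    finally show "(\<Sum>h\<in>G. prob (A g \<inter> A h)) \<le> b * \<pi> + real (card G) * J" .
  qed
  also have "\<dots> = real (card G) * (b * \<pi> + real (card G) * J)" by simp
  finally have EZ2: "(\<integral>x. (Z x)\<^sup>2 \<partial>M) \<le> real (card G) * (b * \<pi> + real (card G) * J)" .
  let ?E = "space M - (\<Union>g\<in>G. A g)"
  have E: "?E \<in> events" using G A(1) by auto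
  have "\<mu>\<^sup>2 * prob ?E = (\<integral>x. \<mu>\<^sup>2 * indicator ?E x \<partial>M)" using E by simp
  also have "\<dots> \<le> (\<integral>x. (Z x)\<^sup>2 - 2 * \<mu> * Z x + \<mu>\<^sup>2 \<partial>M)"
  proof (rule integral_mono)
    show "integrable M (\<lambda>x. \<mu>\<^sup>2 * indicator ?E x)"
      using E by (simp add: integrable_indicator_iff emeasure_eq_measure)
    show "integrable M (\<lambda>x. (Z x)\<^sup>2 - 2 * \<mu> * Z x + \<mu>\<^sup>2)" using iZ iZ2 by auto
    fix x
    have "Z x = 0" if "x \<in> ?E" using that by (simp add: Z_def)
    moreover have "0 \<le> (Z x - \<mu>)\<^sup>2" by simp
    then have "0 \<le> (Z x)\<^sup>2 - 2 * \<mu> * Z x + \<mu>\<^sup>2" by (simp add: power2_diff algebra_simps)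
    ultimately show "\<mu>\<^sup>2 * indicator ?E x \<le> (Z x)\<^sup>2 - 2 * \<mu> * Z x + \<mu>\<^sup>2"
      by (auto simp: indicator_def)
  qed
  also have "\<dots> = (\<integral>x. (Z x)\<^sup>2 \<partial>M) - \<mu>\<^sup>2"
    using iZ iZ2 by (simp add: EZ prob_space power2_eq_square)
  also have "\<dots> \<le> real (card G) * (b * \<pi> + real (card G) * J) - \<mu>\<^sup>2" using EZ2 by simp
  also have "\<dots> = \<mu>\<^sup>2 * (b / (real (card G) * \<pi>) + J / \<pi>\<^sup>2 - 1)"
    using cG \<pi> unfolding \<mu>_def by (simp add: power2_eq_square field_simps)
  finally show ?thesis using \<mu> by (simp add: mult_le_cancel_left_pos)
qed

section \<open>Lower bound for the supremum norm\<close>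

text \<open>Gram-Schmidt: the second form is \<rho> times the first plus \<sigma> times a form
  \<open>d'\<close> independent of it. If the first value is at most \<open>2 * t\<close>, it
  contributes at most \<open>2 * r * t\<close> to the second, so the independent part must exceed
  \<open>t - 2 * r * t\<close>. Otherwise the first value exceeds \<open>2 * t\<close>, an event
  with a much smaller tail.\<close>

lemma joint_tail:
  assumes I: "finite I" and c: "(\<Sum>i\<in>I. (cmod (c i))\<^sup>2) = 1" and d: "(\<Sum>i\<in>I. (cmod (d i))\<^sup>2) = 1"
    and r: "\<bar>\<Sum>i\<in>I. Re (c i * cnj (d i))\<bar> \<le> r" "r \<le> 1 / 2" and t: "0 \<le> t"
  shows "measure (gauss I) {a \<in> space (gauss I). t < real_form I c a \<and> t < real_form I d a}
    \<le> std_tail t * std_tail (t - 2 * r * t) + std_tail (2 * t)"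
proof -
  interpret prob_space "gauss I" by (rule prob_space_gauss)
  define \<rho> where "\<rho> = (\<Sum>i\<in>I. Re (c i * cnj (d i)))"
  define \<sigma> where "\<sigma> = sqrt (1 - \<rho>\<^sup>2)"
  have \<rho>: "\<bar>\<rho>\<bar> \<le> r" "\<bar>\<rho>\<bar> \<le> 1 / 2" using r by (simp_all add: \<rho>_def)
  have "\<bar>\<rho>\<bar>\<^sup>2 \<le> (1 / 2)\<^sup>2" using \<rho>(2) by (intro power_mono) auto
  then have \<rho>2: "\<rho>\<^sup>2 \<le> 1 / 4" by (simp add: power2_eq_square)
  have \<sigma>: "0 < \<sigma>" "\<sigma> \<le> 1" "\<sigma>\<^sup>2 = 1 - \<rho>\<^sup>2" using \<rho>2 by (simp_all add: \<sigma>_def)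
  define d' where "d' i = complex_of_real (1 / \<sigma>) * (d i + complex_of_real (- \<rho>) * c i)" for i
  have "(\<Sum>i\<in>I. (cmod (d i + complex_of_real (- \<rho>) * c i))\<^sup>2)
      = (\<Sum>i\<in>I. (cmod (d i))\<^sup>2) + \<rho>\<^sup>2 * (\<Sum>i\<in>I. (cmod (c i))\<^sup>2) - 2 * \<rho> * (\<Sum>i\<in>I. Re (c i * cnj (d i)))"
    unfolding sum_distrib_left sum.distrib[symmetric] sum_subtractf[symmetric]
    by (intro sum.cong refl) (simp only: cmod_power2, simp add: power2_eq_square algebra_simps)
  also have "\<dots> = \<sigma>\<^sup>2" unfolding c d \<rho>_def[symmetric] \<sigma>(3) by (simp add: power2_eq_square)
  finally have e: "(\<Sum>i\<in>I. (cmod (d i + complex_of_real (- \<rho>) * c i))\<^sup>2) = \<sigma>\<^sup>2" .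
  have "(\<Sum>i\<in>I. (cmod (d' i))\<^sup>2) = (\<Sum>i\<in>I. (cmod (d i + complex_of_real (- \<rho>) * c i))\<^sup>2) / \<sigma>\<^sup>2"
    unfolding sum_divide_distrib d'_def
    by (intro sum.cong refl) (simp only: norm_mult norm_of_real power_mult_distrib, simp add: power_divide)
  also have "\<dots> = 1" unfolding e using \<sigma>(1) by simp
  finally have d'1: "(\<Sum>i\<in>I. (cmod (d' i))\<^sup>2) = 1" .
  have "(\<Sum>i\<in>I. Re (c i * cnj (d' i)))
      = (1 / \<sigma>) * ((\<Sum>i\<in>I. Re (c i * cnj (d i))) - \<rho> * (\<Sum>i\<in>I. (cmod (c i))\<^sup>2))"
    unfolding sum_distrib_left sum_subtractf[symmetric] d'_def
    by (intro sum.cong refl) (simp only: cmod_power2, simp add: power2_eq_square field_simps)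
  also have "\<dots> = 0" unfolding c \<rho>_def[symmetric] by simp
  finally have orth: "(\<Sum>i\<in>I. Re (c i * cnj (d' i))) = 0" .
  have dd: "real_form I d a = \<rho> * real_form I c a + \<sigma> * real_form I d' a" for a
  proof -
    have "real_form I d' a = (1 / \<sigma>) * (real_form I d a + (- \<rho>) * real_form I c a)"
      unfolding d'_def by (simp only: real_form_scale real_form_add)
    then show ?thesis using \<sigma>(1) by (simp add: field_simps)
  qed
  let ?A = "{a \<in> space (gauss I). real_form I c a \<in> {t<..} \<and> real_form I d' a \<in> {t - 2 * r * t<..}}"
  let ?B = "{a \<in> space (gauss I). real_form I c a \<in> {2 * t<..}}"
  have "?A \<in> events" "?B \<in> events" by measurable
  moreover have "{a \<in> space (gauss I). t < real_form I c a \<and> t < real_form I d a} \<subseteq> ?A \<union> ?B"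
  proof
    fix a assume a: "a \<in> {a \<in> space (gauss I). t < real_form I c a \<and> t < real_form I d a}"
    show "a \<in> ?A \<union> ?B"
    proof (cases "real_form I c a \<le> 2 * t")
      case True
      have "\<rho> * real_form I c a \<le> \<bar>\<rho>\<bar> * \<bar>real_form I c a\<bar>" by (simp flip: abs_mult)
      also have "\<dots> \<le> r * (2 * t)" using True a t \<rho> by (intro mult_mono) auto
      finally have "t - 2 * r * t < \<sigma> * real_form I d' a" using a dd[of a] by simp
      \<comment> \<open>A nonnegative level forces the independent part to be positive, and then
        omitting the factor \<open>\<sigma> \<le> 1\<close> only increases it.\<close>
      moreover have "0 \<le> t - 2 * r * t" using r t mult_right_mono[of "2 * r" 1 t] by simp
      ultimately have p: "0 < \<sigma> * real_form I d' a" by linarith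
      then have "0 < real_form I d' a" using \<sigma>(1) by (simp add: zero_less_mult_iff)
      then have "\<sigma> * real_form I d' a \<le> 1 * real_form I d' a" using \<sigma>(2) by (intro mult_right_mono) auto
      then have "t - 2 * r * t < real_form I d' a" using \<open>t - 2 * r * t < \<sigma> * real_form I d' a\<close> by linarith
      then show ?thesis using a by auto
    qed (use a in auto)
  qed
  ultimately have "prob {a \<in> space (gauss I). t < real_form I c a \<and> t < real_form I d a} \<le> prob (?A \<union> ?B)"
    by (intro finite_measure_mono) auto
  also have "\<dots> \<le> prob ?A + prob ?B"
    by (intro measure_Un_le) measurable
  also have "prob ?A = std_tail t * std_tail (t - 2 * r * t)"
    by (rule prob_real_form_pair[OF I c d'1 orth]) auto
  also have "prob ?B = std_tail (2 * t)"
    by (rule prob_real_form[OF I c]) auto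
  finally show ?thesis .
qed

section \<open>Decay of correlations between grid points\<close>

lemma norm_root_unity:
  fixes z :: complex
  assumes "0 < q" "z ^ q = 1"
  shows "cmod z = 1"
proof -
  have "cmod z ^ q = 1 ^ q" using assms(2) by (simp flip: norm_power)
  then show ?thesis by (rule power_eq_imp_eq_base) (use assms(1) in auto)
qed

text \<open>If \<open>\<omega>\<close> is a root of unity other than 1, its powers sum to zero, so they cannot all be near 1.\<close>

lemma root_unity_separation:
  fixes \<omega> :: complex
  assumes "0 < q" "\<omega> ^ q = 1" "\<omega> \<noteq> 1"
  shows "2 / real q \<le> cmod (\<omega> - 1)"
proof -
  have n1: "cmod \<omega> = 1"
    using assms by (simp add: norm_root_unity)
  have "(\<Sum>k<q. \<omega> ^ k) = 0" using assms by (simp add: geometric_sum)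
  then have "real q = cmod (\<Sum>k<q. \<omega> ^ k - 1)" by (simp add: sum_subtractf)
  also have "\<dots> \<le> (\<Sum>k<q. real k * cmod (\<omega> - 1))"
  proof (rule sum_norm_le)
    fix k show "cmod (\<omega> ^ k - 1) \<le> real k * cmod (\<omega> - 1)"
      using norm_power_diff[of \<omega> 1 k] n1 by simp
  qed
  also have "\<dots> = (\<Sum>k<q. real k) * cmod (\<omega> - 1)" by (simp add: sum_distrib_right)
  also have "(\<Sum>k<q. real k) \<le> real q * real q / 2"
    by (induction q) (auto simp: field_simps)
  finally have "real q \<le> real q * real q / 2 * cmod (\<omega> - 1)" by (simp add: mult_right_mono)
  then have "real q * 2 \<le> real q * (real q * cmod (\<omega> - 1))" by simp
  then have "2 \<le> real q * cmod (\<omega> - 1)" using assms(1) by (simp only: mult_le_cancel_left_pos of_nat_0_less_iff)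
  then show ?thesis using assms(1) by (simp add: field_simps)
qed

lemma norm_one_minus_scaled:
  assumes "cmod z = 1"
  shows "(cmod (1 - complex_of_real p * z))\<^sup>2 = (1 - p)\<^sup>2 + p * (cmod (1 - z))\<^sup>2"
proof -
  have "(Re z)\<^sup>2 + (Im z)\<^sup>2 = 1" using assms by (simp add: cmod_def)
  then have "(1 - p * Re z)\<^sup>2 + (p * Im z)\<^sup>2 = (1 - p)\<^sup>2 + p * ((1 - Re z)\<^sup>2 + (Im z)\<^sup>2)" by algebra
  then show ?thesis unfolding cmod_power2 by simp
qed

text \<open>The factor is largest at \<open>z = 1\<close>. At distance at least \<open>1 / q\<close>
  from there, \<open>norm_one_minus_scaled\<close> adds at least \<open>y = p / q\<^sup>2\<close> to
  the squared denominator. As \<open>(1 - p)\<^sup>2 \<le> 1\<close>, this gains at least the factor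
  \<open>1 + y\<close>, which dominates \<open>exp (y / 2)\<close> for
  \<open>y \<le> 1\<close>.\<close>

lemma geometric_factor_bound:
  fixes z :: complex
  assumes z: "cmod z = 1" and p: "0 < p" "p < 1" and q: "0 < q"
  shows "cmod (inverse (1 - complex_of_real p * z)) \<le> 1 / (1 - p)"
    and "1 / real q \<le> cmod (1 - z) \<Longrightarrow>
      cmod (inverse (1 - complex_of_real p * z)) \<le> 1 / (1 - p) * exp (- (p / (4 * (real q)\<^sup>2)))"
proof -
  have "(1 - p)\<^sup>2 \<le> (cmod (1 - complex_of_real p * z))\<^sup>2"
    using p by (simp add: norm_one_minus_scaled[OF z])
  then have le: "1 - p \<le> cmod (1 - complex_of_real p * z)" by (rule power2_le_imp_le) simp
  then show "cmod (inverse (1 - complex_of_real p * z)) \<le> 1 / (1 - p)"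
    unfolding norm_inverse inverse_eq_divide[symmetric] using p by (intro le_imp_inverse_le) auto
  assume far: "1 / real q \<le> cmod (1 - z)"
  define y where "y = p / (real q)\<^sup>2"
  have q1: "1 \<le> (real q)\<^sup>2" using q by simp
  have "p \<le> (real q)\<^sup>2" using p q1 by linarith
  then have y: "0 < y" "y \<le> 1" using p q by (simp_all add: y_def)
  have "exp (y / 2) \<le> 1 + y / 2 + (y / 2)\<^sup>2" using y by (intro exp_bound) auto
  also have "\<dots> \<le> 1 + y"
  proof -
    have "y * y \<le> y * 1" using y by (intro mult_left_mono) auto
    moreover have "(y / 2)\<^sup>2 = y * y / 4" by (simp add: power2_eq_square)
    ultimately show ?thesis using y by linarith
  qed
  finally have ex: "exp (y / 2) \<le> 1 + y" .
  have "((1 - p) * exp (y / 4))\<^sup>2 = (1 - p)\<^sup>2 * exp (y / 2)"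
    by (simp add: power_mult_distrib flip: exp_double)
  also have "\<dots> \<le> (1 - p)\<^sup>2 * (1 + y)" by (intro mult_left_mono ex) simp
  also have "\<dots> \<le> (1 - p)\<^sup>2 + 1 * y"
  proof -
    have "(1 - p)\<^sup>2 \<le> 1\<^sup>2" using p by (intro power_mono) auto
    then have "(1 - p)\<^sup>2 * y \<le> 1 * y" using y by (intro mult_right_mono) auto
    then show ?thesis by (simp add: algebra_simps)
  qed
  also have "1 * y \<le> p * (cmod (1 - z))\<^sup>2"
  proof -
    have "(1 / real q)\<^sup>2 \<le> (cmod (1 - z))\<^sup>2" using far by (intro power_mono) auto
    then have "p * (1 / real q)\<^sup>2 \<le> p * (cmod (1 - z))\<^sup>2" using p by (intro mult_left_mono) auto
    then show ?thesis by (simp add: y_def power_divide)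
  qed
  finally have "((1 - p) * exp (y / 4))\<^sup>2 \<le> (cmod (1 - complex_of_real p * z))\<^sup>2"
    by (simp add: norm_one_minus_scaled[OF z])
  then have "(1 - p) * exp (y / 4) \<le> cmod (1 - complex_of_real p * z)" by (rule power2_le_imp_le) simp
  then have "inverse (cmod (1 - complex_of_real p * z)) \<le> inverse ((1 - p) * exp (y / 4))"
    using p by (intro le_imp_inverse_le) auto
  then show "cmod (inverse (1 - complex_of_real p * z)) \<le> 1 / (1 - p) * exp (- (p / (4 * (real q)\<^sup>2)))"
  proof -
    have "inverse ((1 - p) * exp (y / 4)) = 1 / (1 - p) * exp (- (y / 4))"
      unfolding exp_minus inverse_mult_distrib divide_inverse by (simp only: mult_1)
    moreover have "y / 4 = p / (4 * (real q)\<^sup>2)" by (simp add: y_def)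
    moreover note \<open>inverse (cmod (1 - complex_of_real p * z)) \<le> inverse ((1 - p) * exp (y / 4))\<close>
    ultimately show ?thesis by (simp only: norm_inverse)
  qed
qed

text \<open>The radius \<open>p = m / (m + k)\<close> maximises \<open>p ^ m * (1 - p) ^ k\<close>,
  so by \<open>binomial_mode\<close> Cauchy's estimate with all factors at their worst already gives
  the size \<open>N\<close> up to a polynomial factor. The exponential gain comes from the factors
  away from their pole, and on every point of the circle there are at least \<open>e\<close> of
  them.\<close>

lemma complete_hom_decay:
  assumes mk: "0 < m" "0 < k" and q: "0 < q" and w: "\<And>i. i < Suc k \<Longrightarrow> w i ^ q = 1"
    and far: "\<And>v. v ^ q = 1 \<Longrightarrow> e \<le> card {i \<in> {..<Suc k}. w i \<noteq> v}"
  defines "p \<equiv> real m / real (m + k)"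
  shows "cmod (complete_hom w m (Suc k)) \<le> real (card (multi_indices m (Suc k))) *
    (real (Suc (m + k)) / (1 - p) * exp (- (p / (4 * (real q)\<^sup>2))) ^ e)"
proof -
  let ?n = "Suc k" and ?E = "exp (- (p / (4 * (real q)\<^sup>2)))" and ?N = "real (card (multi_indices m (Suc k)))"
  have p: "0 < p" "p < 1" using mk by (auto simp: p_def)
  have n1: "cmod z = 1" if "z ^ q = 1" for z :: complex
    using that q by (rule norm_root_unity[rotated])
  have E: "0 < ?E" "?E \<le> 1" using p by auto
  have B: "cmod (\<Prod>i<?n. inverse (1 - w i * x)) \<le> (1 / (1 - p)) ^ ?n * ?E ^ e" if x: "cmod x = p" for x
  proof -
    define u where "u = x / complex_of_real p"
    have u: "cmod u = 1" "x = complex_of_real p * u" using x p by (auto simp: u_def norm_divide)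
    let ?S = "{i \<in> {..<?n}. 1 / real q \<le> cmod (1 - w i * u)}"
    \<comment> \<open>Two coordinates within \<open>1 / q\<close> of the pole would be less than
      \<open>2 / q\<close> apart, so by \<open>root_unity_separation\<close> they are the same root
      \<open>v\<close>, and every index with another value lies in \<open>?S\<close>. If no
      coordinate is that close, all indices lie in \<open>?S\<close> and any root will do.\<close>
    have "\<exists>v. v ^ q = 1 \<and> {i \<in> {..<?n}. w i \<noteq> v} \<subseteq> ?S"
    proof (cases "\<exists>j<?n. cmod (1 - w j * u) < 1 / real q")
      case True
      then obtain j where j: "j < ?n" "cmod (1 - w j * u) < 1 / real q" by blast
      have "i \<in> ?S" if i: "i < ?n" "w i \<noteq> w j" for i
      proof (rule ccontr)
        assume "i \<notin> ?S"
        then have i': "cmod (1 - w i * u) < 1 / real q" using i by simp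
        have wj: "w j \<noteq> 0" using n1[OF w[OF j(1)]] by auto
        have "2 / real q \<le> cmod (w i / w j - 1)"
          using i w[OF i(1)] w[OF j(1)] wj q by (intro root_unity_separation) (auto simp: power_divide)
        also have "\<dots> = cmod (w i - w j)"
        proof -
          have "w i / w j - 1 = (w i - w j) / w j" using wj by (simp add: diff_divide_distrib)
          then show ?thesis by (simp only: norm_divide n1[OF w[OF j(1)]] div_by_1)
        qed
        also have "\<dots> = cmod ((1 - w j * u) - (1 - w i * u))"
          using u(1) by (simp add: norm_mult flip: left_diff_distrib)
        also have "\<dots> \<le> cmod (1 - w j * u) + cmod (1 - w i * u)" by (rule norm_triangle_ineq4)
        also have "\<dots> < 2 / real q" using i' j(2) by (simp add: field_simps)
        finally show False by simp
      qed
      then show ?thesis using w[OF j(1)] by (intro exI[of _ "w j"]) auto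
    next
      case False
      then show ?thesis by (intro exI[of _ 1]) auto
    qed
    then obtain v where v: "v ^ q = 1" "{i \<in> {..<?n}. w i \<noteq> v} \<subseteq> ?S" by blast
    have "e \<le> card ?S" by (rule order_trans[OF far[OF v(1)] card_mono[OF _ v(2)]]) simp
    then have "?E ^ card ?S \<le> ?E ^ e" using E by (intro power_decreasing) auto
    have "cmod (\<Prod>i<?n. inverse (1 - w i * x)) = (\<Prod>i<?n. cmod (inverse (1 - w i * x)))"
      by (rule prod_norm[symmetric])
    also have "\<dots> \<le> (\<Prod>i<?n. (1 / (1 - p)) * (if i \<in> ?S then ?E else 1))"
    proof (rule prod_mono, intro conjI norm_ge_zero)
      fix i assume i: "i \<in> {..<?n}"
      have z: "cmod (w i * u) = 1" using n1[OF w] i u(1) by (simp add: norm_mult)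
      have eq: "1 - w i * x = 1 - complex_of_real p * (w i * u)" by (simp add: u(2) mult_ac)
      show "cmod (inverse (1 - w i * x)) \<le> (1 / (1 - p)) * (if i \<in> ?S then ?E else 1)"
        unfolding eq using geometric_factor_bound[OF z p q] i by (cases "i \<in> ?S") simp_all
    qed
    also have "\<dots> = (1 / (1 - p)) ^ ?n * (\<Prod>i<?n. if i \<in> ?S then ?E else 1)"
      by (simp only: prod.distrib prod_constant card_lessThan)
    also have "(\<Prod>i<?n. if i \<in> ?S then ?E else 1) = ?E ^ card ?S"
    proof -
      have "(\<Prod>i<?n. if i \<in> ?S then ?E else 1) = (\<Prod>i\<in>{..<?n} \<inter> ?S. ?E)"
        by (rule prod.inter_restrict[symmetric]) simp
      also have "{..<?n} \<inter> ?S = ?S" by blast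
      finally show ?thesis by simp
    qed
    also have "(1 / (1 - p)) ^ ?n * ?E ^ card ?S \<le> (1 / (1 - p)) ^ ?n * ?E ^ e"
      using p \<open>?E ^ card ?S \<le> ?E ^ e\<close> by (intro mult_left_mono) auto
    finally show ?thesis .
  qed
  have H: "cmod (complete_hom w m ?n) * p ^ m \<le> (1 / (1 - p)) ^ ?n * ?E ^ e"
    using n1[OF w] p by (intro complete_hom_bound B) auto
  have mode: "1 \<le> real (Suc (m + k)) * (?N * p ^ m * (1 - p) ^ k)"
    unfolding card_multi_indices p_def by (rule binomial_mode(2)[OF mk])
  have "cmod (complete_hom w m ?n) * 1 \<le> cmod (complete_hom w m ?n) * (real (Suc (m + k)) * (?N * p ^ m * (1 - p) ^ k))"
    by (intro mult_left_mono mode) simp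
  also have "\<dots> = (cmod (complete_hom w m ?n) * p ^ m) * (real (Suc (m + k)) * ?N * (1 - p) ^ k)"
    by (simp only: mult_ac)
  also have "\<dots> \<le> ((1 / (1 - p)) ^ ?n * ?E ^ e) * (real (Suc (m + k)) * ?N * (1 - p) ^ k)"
    using p by (intro mult_right_mono H) auto
  also have "\<dots> = ((1 / (1 - p)) ^ ?n * (1 - p) ^ k) * (?N * real (Suc (m + k)) * ?E ^ e)"
    by (simp only: mult_ac)
  also have "(1 / (1 - p)) ^ ?n * (1 - p) ^ k = 1 / (1 - p)"
    using p by (simp add: power_one_over)
  finally show ?thesis by (simp add: mult_ac)
qed

section \<open>Counting grid points that almost agree up to a rotation\<close>

lemma roots_unity_card:
  assumes "0 < q"
  shows "finite {z::complex. z ^ q = 1}" "card {z::complex. z ^ q = 1} = q"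
  using bij_betw_finite[OF Complex.bij_betw_roots_unity[OF assms]]
    bij_betw_same_card[OF Complex.bij_betw_roots_unity[OF assms]] by simp_all

text \<open>Such an \<open>h\<close> is determined by the constant \<open>v\<close>, the exceptional
  set \<open>J\<close> and its values on \<open>J\<close>, since elsewhere
  \<open>g i = v * h i\<close>. This leaves \<open>q\<close> constants, at most \<open>2 ^ n\<close>
  sets and at most \<open>q ^ e\<close> values. Against the \<open>q ^ n\<close> grid points the
  factor \<open>2 ^ n\<close> is harmless once \<open>ln q\<close> grows.\<close>

lemma card_nearly_parallel:
  fixes g :: "nat \<Rightarrow> complex"
  assumes q: "0 < q"
  defines "R \<equiv> {z::complex. z ^ q = 1}"
  shows "card {h \<in> {..<n} \<rightarrow>\<^sub>E R. \<exists>v\<in>R. card {i \<in> {..<n}. g i * cnj (h i) \<noteq> v} < e} \<le> q * (2 ^ n * q ^ e)"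
proof -
  have R: "finite R" "card R = q" using roots_unity_card[OF q] by (simp_all add: R_def)
  have n1: "cmod z = 1" if "z \<in> R" for z
    using that q by (simp add: R_def norm_root_unity)
  let ?F = "\<lambda>v J. {h \<in> {..<n} \<rightarrow>\<^sub>E R. \<forall>i\<in>{..<n} - J. g i * cnj (h i) = v}"
  let ?JJ = "{J. J \<subseteq> {..<n} \<and> card J < e}"
  have finJ: "finite ?JJ" by (rule finite_subset[of _ "Pow {..<n}"]) auto
  have "card ?JJ \<le> card (Pow {..<n})" by (intro card_mono) auto
  then have cJ: "card ?JJ \<le> 2 ^ n" by (simp add: card_Pow)
  have F: "card (?F v J) \<le> q ^ e" if v: "v \<in> R" and J: "J \<in> ?JJ" for v J
  proof -
    have "card (?F v J) \<le> card (J \<rightarrow>\<^sub>E R)"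
    proof (rule card_inj_on_le)
      show "inj_on (\<lambda>h. restrict h J) (?F v J)"
      proof (rule inj_onI)
        fix h h' assume h: "h \<in> ?F v J" "h' \<in> ?F v J" and e: "restrict h J = restrict h' J"
        have "h i = h' i" if i: "i < n" for i
        proof (cases "i \<in> J")
          case True
          then show ?thesis using fun_cong[OF e, of i] by simp
        next
          case False
          have hR: "h i \<in> R" "h' i \<in> R" using h i by (auto simp: PiE_iff)
          have eq: "g i * cnj (h i) = v" "g i * cnj (h' i) = v" using h i False by auto
          have u: "cnj (h i) * h i = 1" "cnj (h' i) * h' i = 1"
            using n1[OF hR(1)] n1[OF hR(2)] by (simp_all add: mult.commute[of "cnj _"] complex_norm_square[symmetric])
          have "g i = v * h i" "g i = v * h' i"
            using eq u by (metis mult.assoc mult.right_neutral)+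
          moreover have "v \<noteq> 0" using n1[OF v] by auto
          ultimately show ?thesis by auto
        qed
        then show "h = h'" using h by (intro PiE_ext[of h "{..<n}" "\<lambda>_. R"]) auto
      qed
    qed (use J R in \<open>auto intro!: finite_PiE intro: finite_subset\<close>)
    also have "\<dots> = q ^ card J" using J R by (simp add: card_PiE finite_subset[of J "{..<n}"])
    also have "\<dots> \<le> q ^ e" using J q by (intro power_increasing) auto
    finally show ?thesis .
  qed
  have "{h \<in> {..<n} \<rightarrow>\<^sub>E R. \<exists>v\<in>R. card {i \<in> {..<n}. g i * cnj (h i) \<noteq> v} < e} \<subseteq> (\<Union>v\<in>R. \<Union>J\<in>?JJ. ?F v J)"
  proof
    fix h assume "h \<in> {h \<in> {..<n} \<rightarrow>\<^sub>E R. \<exists>v\<in>R. card {i \<in> {..<n}. g i * cnj (h i) \<noteq> v} < e}"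
    then obtain v where v: "h \<in> {..<n} \<rightarrow>\<^sub>E R" "v \<in> R" "card {i \<in> {..<n}. g i * cnj (h i) \<noteq> v} < e" by blast
    let ?J = "{i \<in> {..<n}. g i * cnj (h i) \<noteq> v}"
    have "?J \<in> ?JJ" "h \<in> ?F v ?J" using v by auto
    then show "h \<in> (\<Union>v\<in>R. \<Union>J\<in>?JJ. ?F v J)" using v(2) by blast
  qed
  moreover have "finite (\<Union>v\<in>R. \<Union>J\<in>?JJ. ?F v J)"
  proof (rule finite_subset)
    show "(\<Union>v\<in>R. \<Union>J\<in>?JJ. ?F v J) \<subseteq> {..<n} \<rightarrow>\<^sub>E R" by blast
    show "finite ({..<n} \<rightarrow>\<^sub>E R)" by (intro finite_PiE finite_lessThan R)
  qed
  ultimately have "card {h \<in> {..<n} \<rightarrow>\<^sub>E R. \<exists>v\<in>R. card {i \<in> {..<n}. g i * cnj (h i) \<noteq> v} < e}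
      \<le> card (\<Union>v\<in>R. \<Union>J\<in>?JJ. ?F v J)" by (intro card_mono)
  also have "\<dots> \<le> (\<Sum>v\<in>R. card (\<Union>J\<in>?JJ. ?F v J))" by (rule card_UN_le[OF R(1)])
  also have "\<dots> \<le> (\<Sum>v\<in>R. \<Sum>J\<in>?JJ. card (?F v J))" by (intro sum_mono card_UN_le finJ)
  also have "\<dots> \<le> (\<Sum>v\<in>R. \<Sum>J\<in>?JJ. q ^ e)" by (intro sum_mono F)
  also have "\<dots> = q * (card ?JJ * q ^ e)" by (simp add: R)
  also have "\<dots> \<le> q * (2 ^ n * q ^ e)" using cJ by (intro mult_left_mono mult_right_mono) auto
  finally show ?thesis .
qed

text \<open>Real parts suffice for a lower bound on moduli. On the grid of tuples of
  \<open>q\<close>-th roots of unity, divided by \<open>sqrt N\<close>, they are standard normal,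
  and the covariance at \<open>g\<close> and \<open>h\<close> is the real part of
  \<open>complete_hom\<close> at the quotients \<open>g i * cnj (h i)\<close>, divided by
  \<open>N\<close>. A constant quotient is a common rotation, under which the correlation need not
  decay; hence a pair is bad if fewer than \<open>e\<close> quotients differ from some constant. For
  other pairs \<open>complete_hom_decay\<close> bounds the covariance by \<open>r\<close>.\<close>

lemma prob_sup_norm_lower:
  fixes m k q e :: nat
  assumes mk: "0 < m" "0 < k" and q: "0 < q" and t: "0 \<le> t"
  defines "p \<equiv> real m / real (m + k)" and "I \<equiv> multi_indices m (Suc k)"
  defines "r \<equiv> real (Suc (m + k)) / (1 - p) * exp (- (p / (4 * (real q)\<^sup>2))) ^ e"
  assumes r: "r \<le> 1 / 2"
  shows "measure (gauss I) {a \<in> space (gauss I). poly_sup_norm m (Suc k) a \<le> sqrt (real (card I)) * t}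
    \<le> real (q * (2 ^ Suc k * q ^ e)) / (real q ^ Suc k * std_tail t)
      + (std_tail t * std_tail (t - 2 * r * t) + std_tail (2 * t)) / (std_tail t)\<^sup>2 - 1"
proof -
  interpret prob_space "gauss I" by (rule prob_space_gauss)
  let ?n = "Suc k"
  define R where "R = {z::complex. z ^ q = 1}"
  define G where "G = {..<?n} \<rightarrow>\<^sub>E R"
  have R: "finite R" "card R = q" using roots_unity_card[OF q] by (simp_all add: R_def)
  have R1: "1 \<in> R" by (simp add: R_def)
  have Gf: "finite G" unfolding G_def by (intro finite_PiE finite_lessThan R)
  have Gc: "card G = q ^ ?n" unfolding G_def by (simp add: card_PiE R)
  have "G \<noteq> {}" unfolding G_def PiE_eq_empty_iff using R1 by blast
  note G = Gf Gc this
  have n1: "cmod z = 1" if "z \<in> R" for z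
    using that q by (simp add: R_def norm_root_unity)
  have I: "finite I" "I \<noteq> {}" by (simp_all add: I_def finite_multi_indices multi_indices_nonempty)
  define N where "N = real (card I)"
  have N: "0 < N" using I by (simp add: N_def card_gt_0_iff)
  define c where "c g \<alpha> = complex_of_real (1 / sqrt N) * (\<Prod>i<?n. g i ^ \<alpha> i)" for g :: "nat \<Rightarrow> complex" and \<alpha>
  have gn: "cmod (\<Prod>i<?n. g i ^ \<alpha> i) = 1" if "g \<in> G" for g and \<alpha> :: "nat \<Rightarrow> nat"
  proof -
    have "cmod (g i) = 1" if "i < ?n" for i using \<open>g \<in> G\<close> that n1 by (auto simp: G_def PiE_iff)
    then show ?thesis unfolding prod_norm[symmetric] norm_power by (intro prod.neutral) simp
  qed
  have c1: "(\<Sum>\<alpha>\<in>I. (cmod (c g \<alpha>))\<^sup>2) = 1" if g: "g \<in> G" for g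
  proof -
    have "(cmod (c g \<alpha>))\<^sup>2 = 1 / N" for \<alpha>
      using N unfolding c_def norm_mult gn[OF g] norm_of_real by (simp add: power_divide)
    then show ?thesis using N by (simp add: N_def)
  qed
  define A where "A g = {a \<in> space (gauss I). real_form I (c g) a \<in> {t<..}}" for g
  have A: "A g \<in> events" for g unfolding A_def by measurable
  have pA: "prob (A g) = std_tail t" if "g \<in> G" for g
    unfolding A_def by (rule prob_real_form[OF I(1) c1[OF that]]) simp
  define bad where "bad g h \<longleftrightarrow> (\<exists>v\<in>R. card {i \<in> {..<?n}. g i * cnj (h i) \<noteq> v} < e)" for g h :: "nat \<Rightarrow> complex"
  have r0: "0 \<le> r" unfolding r_def p_def using mk by (intro mult_nonneg_nonneg divide_nonneg_nonneg) auto
  have J: "prob (A g \<inter> A h) \<le> std_tail t * std_tail (t - 2 * r * t) + std_tail (2 * t)"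
    if g: "g \<in> G" and h: "h \<in> G" and nb: "\<not> bad g h" for g h
  proof -
    let ?w = "\<lambda>i. g i * cnj (h i)"
    have "(\<Sum>\<alpha>\<in>I. c g \<alpha> * cnj (c h \<alpha>)) = (\<Sum>\<alpha>\<in>I. complex_of_real (1 / N) * (\<Prod>i<?n. ?w i ^ \<alpha> i))"
    proof (intro sum.cong refl)
      fix \<alpha>
      have "complex_of_real (1 / sqrt N) * complex_of_real (1 / sqrt N) = complex_of_real (1 / N)"
        using N by (simp flip: of_real_mult)
      moreover have "(\<Prod>i<?n. ?w i ^ \<alpha> i) = (\<Prod>i<?n. g i ^ \<alpha> i) * cnj (\<Prod>i<?n. h i ^ \<alpha> i)"
        unfolding cnj_prod complex_cnj_power power_mult_distrib prod.distrib ..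
      moreover have "(u * x) * (u * y) = (u * u) * (x * y)" for u x y :: complex
        by (simp add: mult_ac)
      ultimately show "c g \<alpha> * cnj (c h \<alpha>) = complex_of_real (1 / N) * (\<Prod>i<?n. ?w i ^ \<alpha> i)"
        unfolding c_def complex_cnj_mult complex_cnj_complex_of_real by (simp only:)
    qed
    also have "\<dots> = complex_of_real (1 / N) * complete_hom ?w m ?n"
      by (simp only: complete_hom_def I_def sum_distrib_left)
    finally have e1: "(\<Sum>\<alpha>\<in>I. c g \<alpha> * cnj (c h \<alpha>)) = complex_of_real (1 / N) * complete_hom ?w m ?n" .
    have "cmod (complete_hom ?w m ?n) \<le> N * r"
      unfolding N_def I_def r_def p_def
    proof (rule complete_hom_decay[OF mk q])
      show "?w i ^ q = 1" if "i < ?n" for i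
        using g h that by (auto simp: G_def PiE_iff R_def power_mult_distrib simp flip: complex_cnj_power)
      show "e \<le> card {i \<in> {..<?n}. ?w i \<noteq> v}" if "v ^ q = 1" for v
        using nb that by (auto simp: bad_def R_def not_less)
    qed
    then have "cmod (\<Sum>\<alpha>\<in>I. c g \<alpha> * cnj (c h \<alpha>)) \<le> r"
      using N unfolding e1 norm_mult norm_of_real by (simp add: field_simps)
    then have "\<bar>\<Sum>\<alpha>\<in>I. Re (c g \<alpha> * cnj (c h \<alpha>))\<bar> \<le> r"
      using abs_Re_le_cmod[of "\<Sum>\<alpha>\<in>I. c g \<alpha> * cnj (c h \<alpha>)"] by (simp only: Re_sum)
    from joint_tail[OF I(1) c1[OF g] c1[OF h] this r t]
    have "prob {a \<in> space (gauss I). t < real_form I (c g) a \<and> t < real_form I (c h) a}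
        \<le> std_tail t * std_tail (t - 2 * r * t) + std_tail (2 * t)" .
    also have "{a \<in> space (gauss I). t < real_form I (c g) a \<and> t < real_form I (c h) a} = A g \<inter> A h"
      by (auto simp: A_def)
    finally show ?thesis .
  qed
  have sub: "{a \<in> space (gauss I). poly_sup_norm m ?n a \<le> sqrt N * t} \<subseteq> space (gauss I) - (\<Union>g\<in>G. A g)"
  proof
    fix a assume a: "a \<in> {a \<in> space (gauss I). poly_sup_norm m ?n a \<le> sqrt N * t}"
    have "a \<notin> A g" if g: "g \<in> G" for g
    proof
      assume "a \<in> A g"
      then have "sqrt N * t < sqrt N * real_form I (c g) a" using N by (simp add: A_def)
      also have "\<dots> = Re (hom_poly m ?n a g)"
      proof -
        have "c g \<alpha> * a \<alpha> = complex_of_real (1 / sqrt N) * (a \<alpha> * (\<Prod>i<?n. g i ^ \<alpha> i))" for \<alpha>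
          by (simp only: c_def mult_ac)
        then have "real_form I (c g) a = Re (complex_of_real (1 / sqrt N) * hom_poly m ?n a g)"
          by (simp only: real_form_def hom_poly_def I_def sum_distrib_left)
        also have "\<dots> = Re (hom_poly m ?n a g) / sqrt N" by simp
        finally show ?thesis using N by simp
      qed
      also have "\<dots> \<le> cmod (hom_poly m ?n a g)" by (rule complex_Re_le_cmod)
      also have "\<dots> \<le> poly_sup_norm m ?n a"
        using g n1 by (intro hom_poly_le_sup_norm) (auto simp: G_def PiE_iff)
      finally show False using a by simp
    qed
    then show "a \<in> space (gauss I) - (\<Union>g\<in>G. A g)" using a by auto
  qed
  have "prob {a \<in> space (gauss I). poly_sup_norm m ?n a \<le> sqrt N * t} \<le> prob (space (gauss I) - (\<Union>g\<in>G. A g))"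
    using A G by (intro finite_measure_mono[OF sub]) auto
  also have "\<dots> \<le> real (q * (2 ^ ?n * q ^ e)) / (real (card G) * std_tail t)
      + (std_tail t * std_tail (t - 2 * r * t) + std_tail (2 * t)) / (std_tail t)\<^sup>2 - 1"
  proof (rule second_moment_bound[where A=A and bad=bad])
    show "real (card {h \<in> G. bad g h}) \<le> real (q * (2 ^ ?n * q ^ e))" for g
      unfolding G_def bad_def R_def of_nat_le_iff by (rule card_nearly_parallel[OF q])
  qed (use G A pA J std_tail_pos[OF t] in auto)
  finally show ?thesis by (simp only: G N_def of_nat_power)
qed

section \<open>The coefficient norm\<close>

lemma cgauss_nn_integral:
  assumes "(\<lambda>p. f (complex_of_pair p)) \<in> borel_measurable (borel \<Otimes>\<^sub>M borel)" "f \<in> borel_measurable borel"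
  shows "(\<integral>\<^sup>+z. f z \<partial>cgauss) =
    (\<integral>\<^sup>+x. (\<integral>\<^sup>+y. f (complex_of_pair (x, y)) \<partial>std_normal_distribution) \<partial>std_normal_distribution)"
proof -
  have "(\<integral>\<^sup>+z. f z \<partial>cgauss) = (\<integral>\<^sup>+p. f (complex_of_pair p) \<partial>(std_normal_distribution \<Otimes>\<^sub>M std_normal_distribution))"
    unfolding cgauss_eq using assms(2) by (intro nn_integral_distr) simp_all
  also have "\<dots> = (\<integral>\<^sup>+x. (\<integral>\<^sup>+y. f (complex_of_pair (x, y)) \<partial>std_normal_distribution) \<partial>std_normal_distribution)"
    by (rule std_normal.nn_integral_fst[symmetric])
      (use assms(1) in \<open>simp cong: measurable_cong_sets sets_pair_measure_cong\<close>)
  finally show ?thesis .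
qed

lemma std_normal_moments:
  "(\<integral>x. x\<^sup>2 \<partial>std_normal_distribution) = 1" "(\<integral>x. x ^ 4 \<partial>std_normal_distribution) = 3"
  "integrable std_normal_distribution (\<lambda>x. x ^ k)"
  using std_normal_distribution_even_moments(1)[of 1] std_normal_distribution_even_moments(1)[of 2]
    integrable_std_normal_distribution_moment
  by (simp_all add: fact_numeral)

text \<open>Nonnegative iterated integrals give integrability and value at once. The fourth moment
  is 3 + 2 + 3, the middle term being the mixed one from expanding the square.\<close>

lemma cgauss_moments:
  "integrable cgauss (\<lambda>z. (cmod z)\<^sup>2)" "(\<integral>z. (cmod z)\<^sup>2 \<partial>cgauss) = 2"
  "integrable cgauss (\<lambda>z. (cmod z) ^ 4)" "(\<integral>z. (cmod z) ^ 4 \<partial>cgauss) = 8"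
proof -
  have sq: "(cmod (complex_of_pair (x, y)))\<^sup>2 = x\<^sup>2 + y\<^sup>2" for x y by (simp add: cmod_power2)
  have q4: "(cmod (complex_of_pair (x, y))) ^ 4 = x ^ 4 + (2 * x\<^sup>2) * y\<^sup>2 + y ^ 4" for x y
  proof -
    have "(cmod (complex_of_pair (x, y))) ^ 4 = ((cmod (complex_of_pair (x, y)))\<^sup>2)\<^sup>2" by simp
    also have "\<dots> = (x\<^sup>2 + y\<^sup>2)\<^sup>2" by (simp only: sq)
    finally show ?thesis by (simp add: power2_eq_square power4_eq_xxxx algebra_simps)
  qed
  note int = std_normal_moments(3)
  have i2: "(\<integral>\<^sup>+y. ennreal (c + y\<^sup>2) \<partial>std_normal_distribution) = ennreal (c + 1)" if "0 \<le> c" for c :: real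
    using int[of 2] that by (subst nn_integral_eq_integral) (auto simp: std_normal_moments std_normal.prob_space[simplified])
  have i4: "(\<integral>\<^sup>+y. ennreal (c + d * y\<^sup>2 + y ^ 4) \<partial>std_normal_distribution) = ennreal (c + d + 3)"
    if "0 \<le> c" "0 \<le> d" for c d :: real
    using int[of 2] int[of 4] that by (subst nn_integral_eq_integral) (auto simp: std_normal_moments std_normal.prob_space[simplified])
  have "(\<integral>\<^sup>+z. ennreal ((cmod z)\<^sup>2) \<partial>cgauss) = (\<integral>\<^sup>+x. ennreal (1 + x\<^sup>2) \<partial>std_normal_distribution)"
  proof (subst cgauss_nn_integral)
    show "(\<integral>\<^sup>+x. \<integral>\<^sup>+y. ennreal ((cmod (complex_of_pair (x, y)))\<^sup>2) \<partial>std_normal_distribution \<partial>std_normal_distribution)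
       = (\<integral>\<^sup>+x. ennreal (1 + x\<^sup>2) \<partial>std_normal_distribution)"
      by (rule nn_integral_cong) (simp only: sq, subst i2, simp_all only: add.commute zero_le_power2)
  qed simp_all
  then have 2: "(\<integral>\<^sup>+z. ennreal ((cmod z)\<^sup>2) \<partial>cgauss) = ennreal 2"
    using i2[of 1] by (simp only: zero_le_one one_add_one)
  have "(\<integral>\<^sup>+z. ennreal ((cmod z) ^ 4) \<partial>cgauss) = (\<integral>\<^sup>+x. ennreal (3 + 2 * x\<^sup>2 + x ^ 4) \<partial>std_normal_distribution)"
  proof (subst cgauss_nn_integral)
    show "(\<integral>\<^sup>+x. \<integral>\<^sup>+y. ennreal (cmod (complex_of_pair (x, y)) ^ 4) \<partial>std_normal_distribution \<partial>std_normal_distribution)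
       = (\<integral>\<^sup>+x. ennreal (3 + 2 * x\<^sup>2 + x ^ 4) \<partial>std_normal_distribution)"
      by (rule nn_integral_cong) (simp only: q4, subst i4, simp_all only: add_ac, simp_all)
  qed simp_all
  then have 4: "(\<integral>\<^sup>+z. ennreal ((cmod z) ^ 4) \<partial>cgauss) = ennreal 8"
    using i4[of 3 2] by (simp del: ennreal_plus)
  have m: "(\<lambda>z. (cmod z) ^ k) \<in> borel_measurable cgauss" for k
    unfolding measurable_cong_sets[OF sets_cgauss refl] by simp
  from has_bochner_integral_nn_integral[OF m _ _ 2] has_bochner_integral_nn_integral[OF m _ _ 4]
  show "integrable cgauss (\<lambda>z. (cmod z)\<^sup>2)" "(\<integral>z. (cmod z)\<^sup>2 \<partial>cgauss) = 2"
    "integrable cgauss (\<lambda>z. (cmod z) ^ 4)" "(\<integral>z. (cmod z) ^ 4 \<partial>cgauss) = 8"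
    by (simp_all add: has_bochner_integral_iff)
qed

lemma gauss_integral_prod:
  fixes f :: "'i \<Rightarrow> complex \<Rightarrow> real"
  assumes I: "finite I" and J: "J \<subseteq> I" and f: "\<And>j. j \<in> J \<Longrightarrow> integrable cgauss (f j)"
  shows "integrable (gauss I) (\<lambda>a. \<Prod>j\<in>J. f j (a j))"
    and "(\<integral>a. (\<Prod>j\<in>J. f j (a j)) \<partial>gauss I) = (\<Prod>j\<in>J. \<integral>z. f j z \<partial>cgauss)"
proof -
  interpret P: product_sigma_finite "\<lambda>_::'i. cgauss" ..
  define F where "F i = (if i \<in> J then f i else (\<lambda>_. 1))" for i
  have F: "integrable cgauss (F i)" for i using f by (simp add: F_def)
  have eq: "(\<Prod>i\<in>I. F i (a i)) = (\<Prod>j\<in>J. f j (a j))" for a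
    using I J by (intro prod.mono_neutral_cong_right) (auto simp: F_def)
  have eq': "(\<Prod>i\<in>I. \<integral>z. F i z \<partial>cgauss) = (\<Prod>j\<in>J. \<integral>z. f j z \<partial>cgauss)"
    using I J by (intro prod.mono_neutral_cong_right) (auto simp: F_def cgauss.prob_space[simplified])
  show "integrable (gauss I) (\<lambda>a. \<Prod>j\<in>J. f j (a j))"
    unfolding eq[symmetric] gauss_def by (rule P.product_integrable_prod[OF I F])
  show "(\<integral>a. (\<Prod>j\<in>J. f j (a j)) \<partial>gauss I) = (\<Prod>j\<in>J. \<integral>z. f j z \<partial>cgauss)"
    unfolding eq[symmetric] eq'[symmetric] gauss_def by (rule P.product_integral_prod[OF I F])
qed

lemma gauss_integral_coord:
  fixes f :: "complex \<Rightarrow> real"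
  assumes "finite I" "i \<in> I" "integrable cgauss f"
  shows "integrable (gauss I) (\<lambda>a. f (a i))" "(\<integral>a. f (a i) \<partial>gauss I) = (\<integral>z. f z \<partial>cgauss)"
  using gauss_integral_prod[of I "{i}" "\<lambda>_. f"] assms by simp_all

text \<open>The inequality \<open>exp x \<ge> 1 + x\<close> linearises the power in
  \<open>2 - q\<close>, leaving a logarithm: for \<open>t \<ge> 1\<close> it is absorbed by the
  fourth power, for \<open>t < 1\<close> by \<open>t * (- ln t) \<le> 1\<close> together with
  \<open>t powr q \<le> t\<close>. The \<open>q\<close>-th power sum can thus be compared with the
  sum of squares.\<close>

lemma powr_near_square:
  fixes t q :: real
  assumes t: "0 \<le> t" and q: "1 \<le> q" "q \<le> 2"
  shows "\<bar>t powr q - t\<^sup>2\<bar> \<le> (2 - q) * (1 + t ^ 4)"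
proof (cases "t = 0")
  case True
  then show ?thesis using q by simp
next
  case False
  then have t: "0 < t" using t by simp
  have sq: "t\<^sup>2 = t powr q * t powr (2 - q)" using t by (simp flip: powr_add powr_numeral)
  have e: "1 + (2 - q) * ln t \<le> t powr (2 - q)" "1 - (2 - q) * ln t \<le> t powr (- (2 - q))"
    using exp_ge_add_one_self[of "(2 - q) * ln t"] exp_ge_add_one_self[of "- ((2 - q) * ln t)"] t
    by (simp_all only: powr_def minus_mult_left add_uminus_conv_diff) (simp_all add: algebra_simps)
  show ?thesis
  proof (cases "1 \<le> t")
    case True
    have l: "0 \<le> ln t" "ln t \<le> t" using True ln_le_minus_one[of t] by simp_all
    have "t powr q \<le> t powr 2" using True q by (intro powr_mono) auto
    then have a: "t powr q \<le> t\<^sup>2" using t by simp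
    have b: "t powr q = t\<^sup>2 * t powr (- (2 - q))" using t by (simp flip: powr_add powr_numeral)
    have "t\<^sup>2 - t powr q = t\<^sup>2 * (1 - t powr (- (2 - q)))" by (simp add: b algebra_simps)
    also have "\<dots> \<le> t\<^sup>2 * ((2 - q) * ln t)" using e(2) by (intro mult_left_mono) auto
    also have "\<dots> \<le> t\<^sup>2 * ((2 - q) * t\<^sup>2)"
      using l True q by (intro mult_left_mono order_trans[OF l(2)]) (auto simp: power2_eq_square)
    also have "\<dots> \<le> (2 - q) * (1 + t ^ 4)"
      using q by (simp add: power2_eq_square power4_eq_xxxx algebra_simps)
    finally show ?thesis using a by simp
  next
    case False
    have l: "ln t \<le> 0" using False t by simp
    have l2: "t * (- ln t) \<le> 1"
    proof -
      have "- ln t = ln (1 / t)" using t by (simp add: ln_div)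
      also have "\<dots> \<le> 1 / t" using ln_le_minus_one[of "1 / t"] t by simp
      finally show ?thesis using t by (simp add: field_simps)
    qed
    have "t powr 2 \<le> t powr q" using False t q by (intro powr_mono') auto
    then have a: "t\<^sup>2 \<le> t powr q" using t by simp
    have p: "t powr q \<le> t" using powr_mono'[of 1 q t] False t q by simp
    have "t powr q - t\<^sup>2 = t powr q * (1 - t powr (2 - q))" by (subst sq) (simp add: algebra_simps)
    also have "\<dots> \<le> t powr q * ((2 - q) * (- ln t))" using e(1) by (intro mult_left_mono) auto
    also have "\<dots> \<le> t * ((2 - q) * (- ln t))" using p q l by (intro mult_right_mono mult_nonneg_nonneg) auto
    also have "\<dots> = (2 - q) * (t * (- ln t))" by simp
    also have "\<dots> \<le> (2 - q) * 1" using q l2 by (intro mult_left_mono) auto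
    also have "\<dots> \<le> (2 - q) * (1 + t ^ 4)" using q by (intro mult_left_mono) auto
    finally show ?thesis using a by simp
  qed
qed

text \<open>Half of the deviation is allotted to each of two errors. Replacing powers by squares
  costs at most \<open>G\<close>, whose mean is \<open>9 * (2 - q) * N\<close> with 9 = 1 + 8 from
  the fourth moment, so Markov's inequality suffices. The centred sum of squares \<open>H\<close>
  has variance \<open>4 * N\<close>, and Chebyshev's inequality applies.\<close>

lemma prob_power_sum:
  assumes I: "finite I" "I \<noteq> {}" and q: "1 \<le> q" "q \<le> 2" and \<eta>: "0 < \<eta>"
  defines "N \<equiv> real (card I)"
  shows "measure (gauss I) {a \<in> space (gauss I). \<eta> * N < \<bar>(\<Sum>i\<in>I. cmod (a i) powr q) - 2 * N\<bar>}
    \<le> 18 * (2 - q) / \<eta> + 16 / (N * \<eta>\<^sup>2)"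
proof -
  interpret prob_space "gauss I" by (rule prob_space_gauss)
  have N: "0 < N" using I by (simp add: N_def card_gt_0_iff)
  let ?g = "\<lambda>z. (2 - q) * (1 + (cmod z) ^ 4)"
  let ?h = "\<lambda>z. (cmod z)\<^sup>2 - 2"
  have ig: "integrable cgauss ?g" using cgauss_moments(3) by simp
  have ih: "integrable cgauss ?h" using cgauss_moments(1) by simp
  have ih2: "integrable cgauss (\<lambda>z. (?h z)\<^sup>2)" "(\<integral>z. (?h z)\<^sup>2 \<partial>cgauss) = 4"
  proof -
    have e: "(?h z)\<^sup>2 = (cmod z) ^ 4 - 4 * (cmod z)\<^sup>2 + 4" for z
      by (simp add: power2_eq_square power4_eq_xxxx algebra_simps)
    show "integrable cgauss (\<lambda>z. (?h z)\<^sup>2)" unfolding e using cgauss_moments by simp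
    show "(\<integral>z. (?h z)\<^sup>2 \<partial>cgauss) = 4"
      unfolding e using cgauss_moments by (simp add: cgauss.prob_space[simplified])
  qed
  define G where "G a = (\<Sum>i\<in>I. ?g (a i))" for a :: "'a \<Rightarrow> complex"
  define H where "H a = (\<Sum>i\<in>I. ?h (a i))" for a :: "'a \<Rightarrow> complex"
  have G: "integrable (gauss I) G" "expectation G = 9 * (2 - q) * N"
  proof -
    show "integrable (gauss I) G" unfolding G_def
      by (intro Bochner_Integration.integrable_sum gauss_integral_coord(1)[OF I(1) _ ig])
    have "expectation G = (\<Sum>i\<in>I. expectation (\<lambda>a. ?g (a i)))"
      unfolding G_def by (rule Bochner_Integration.integral_sum) (rule gauss_integral_coord(1)[OF I(1) _ ig])
    also have "\<dots> = (\<Sum>i\<in>I. (\<integral>z. ?g z \<partial>cgauss))"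
      by (intro sum.cong refl gauss_integral_coord(2)[OF I(1) _ ig])
    also have "(\<integral>z. ?g z \<partial>cgauss) = 9 * (2 - q)"
      using cgauss_moments by (simp add: cgauss.prob_space[simplified])
    finally show "expectation G = 9 * (2 - q) * N" by (simp add: N_def)
  qed
  have G0: "0 \<le> G a" for a unfolding G_def using q by (intro sum_nonneg mult_nonneg_nonneg) auto
  have hh: "integrable (gauss I) (\<lambda>a. ?h (a i) * ?h (a j))"
    "expectation (\<lambda>a. ?h (a i) * ?h (a j)) = (if i = j then 4 else 0)" if "i \<in> I" "j \<in> I" for i j
  proof -
    have "integrable (gauss I) (\<lambda>a. ?h (a i) * ?h (a j)) \<and>
      expectation (\<lambda>a. ?h (a i) * ?h (a j)) = (if i = j then 4 else 0)"
    proof (cases "i = j")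
      case True
      then show ?thesis
        using gauss_integral_coord[OF I(1) \<open>i \<in> I\<close> ih2(1)] ih2(2) by (simp add: power2_eq_square)
    next
      case False
      have "(\<integral>z. ?h z \<partial>cgauss) = 0" using cgauss_moments by (simp add: cgauss.prob_space[simplified])
      then show ?thesis
        using gauss_integral_prod[OF I(1), of "{i, j}" "\<lambda>_. ?h"] that False ih by simp
    qed
    then show "integrable (gauss I) (\<lambda>a. ?h (a i) * ?h (a j))"
      "expectation (\<lambda>a. ?h (a i) * ?h (a j)) = (if i = j then 4 else 0)" by auto
  qed
  have HH: "integrable (gauss I) (\<lambda>a. (H a)\<^sup>2)" "expectation (\<lambda>a. (H a)\<^sup>2) = 4 * N"
  proof -
    have e: "(H a)\<^sup>2 = (\<Sum>i\<in>I. \<Sum>j\<in>I. ?h (a i) * ?h (a j))" for a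
      by (simp only: H_def power2_eq_square sum_product)
    show "integrable (gauss I) (\<lambda>a. (H a)\<^sup>2)"
      unfolding e by (intro Bochner_Integration.integrable_sum hh(1))
    have "expectation (\<lambda>a. (H a)\<^sup>2) = (\<Sum>i\<in>I. \<Sum>j\<in>I. if i = j then 4 else 0)"
      unfolding e using hh by (simp add: Bochner_Integration.integral_sum)
    then show "expectation (\<lambda>a. (H a)\<^sup>2) = 4 * N" using I by (simp add: N_def)
  qed
  have H2m: "(\<lambda>a. (H a)\<^sup>2) \<in> borel_measurable (gauss I)" and Gm: "G \<in> borel_measurable (gauss I)"
    using HH(1) G(1) by simp_all
  have ev: "{a \<in> space (gauss I). \<eta> * N / 2 \<le> G a} \<in> events" "{a \<in> space (gauss I). (\<eta> * N / 2)\<^sup>2 \<le> (H a)\<^sup>2} \<in> events"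
    by (rule borel_measurable_le[OF borel_measurable_const Gm] borel_measurable_le[OF borel_measurable_const H2m])+
  have sub: "{a \<in> space (gauss I). \<eta> * N < \<bar>(\<Sum>i\<in>I. cmod (a i) powr q) - 2 * N\<bar>}
    \<subseteq> {a \<in> space (gauss I). \<eta> * N / 2 \<le> G a} \<union> {a \<in> space (gauss I). (\<eta> * N / 2)\<^sup>2 \<le> (H a)\<^sup>2}"
  proof
    fix a assume a: "a \<in> {a \<in> space (gauss I). \<eta> * N < \<bar>(\<Sum>i\<in>I. cmod (a i) powr q) - 2 * N\<bar>}"
    have "(\<Sum>i\<in>I. cmod (a i) powr q) - 2 * N = (\<Sum>i\<in>I. cmod (a i) powr q - (cmod (a i))\<^sup>2) + H a"
      by (simp add: H_def sum_subtractf N_def)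
    moreover have "\<bar>\<Sum>i\<in>I. cmod (a i) powr q - (cmod (a i))\<^sup>2\<bar> \<le> G a"
      unfolding G_def by (intro order_trans[OF sum_abs] sum_mono powr_near_square q) simp
    moreover note abs_triangle_ineq[of "\<Sum>i\<in>I. cmod (a i) powr q - (cmod (a i))\<^sup>2" "H a"]
    moreover have "\<eta> * N < \<bar>(\<Sum>i\<in>I. cmod (a i) powr q) - 2 * N\<bar>" using a by simp
    ultimately have "\<eta> * N < G a + \<bar>H a\<bar>" by linarith
    then have "\<eta> * N / 2 \<le> G a \<or> \<eta> * N / 2 \<le> \<bar>H a\<bar>" by linarith
    moreover have "(\<eta> * N / 2)\<^sup>2 \<le> (H a)\<^sup>2" if "\<eta> * N / 2 \<le> \<bar>H a\<bar>"
      using power_mono[OF that, of 2] \<eta> N by simp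
    ultimately show "a \<in> {a \<in> space (gauss I). \<eta> * N / 2 \<le> G a} \<union> {a \<in> space (gauss I). (\<eta> * N / 2)\<^sup>2 \<le> (H a)\<^sup>2}"
      using a by auto
  qed
  have "prob {a \<in> space (gauss I). \<eta> * N < \<bar>(\<Sum>i\<in>I. cmod (a i) powr q) - 2 * N\<bar>}
    \<le> prob ({a \<in> space (gauss I). \<eta> * N / 2 \<le> G a} \<union> {a \<in> space (gauss I). (\<eta> * N / 2)\<^sup>2 \<le> (H a)\<^sup>2})"
    by (intro finite_measure_mono[OF sub] sets.Un ev)
  also have "\<dots> \<le> prob {a \<in> space (gauss I). \<eta> * N / 2 \<le> G a} + prob {a \<in> space (gauss I). (\<eta> * N / 2)\<^sup>2 \<le> (H a)\<^sup>2}"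
    by (intro measure_Un_le ev)
  also have "prob {a \<in> space (gauss I). \<eta> * N / 2 \<le> G a} \<le> expectation G / (\<eta> * N / 2)"
    using \<eta> N G0 by (intro integral_Markov_inequality_measure[OF G(1), of "{}"]) auto
  also have "prob {a \<in> space (gauss I). (\<eta> * N / 2)\<^sup>2 \<le> (H a)\<^sup>2} \<le> expectation (\<lambda>a. (H a)\<^sup>2) / (\<eta> * N / 2)\<^sup>2"
    using \<eta> N by (intro integral_Markov_inequality_measure[OF HH(1), of "{}"]) auto
  also have "expectation G / (\<eta> * N / 2) + expectation (\<lambda>a. (H a)\<^sup>2) / (\<eta> * N / 2)\<^sup>2
     = 18 * (2 - q) / \<eta> + 16 / (N * \<eta>\<^sup>2)"
    unfolding G(2) HH(2) using \<eta> N by (simp add: power2_eq_square field_simps)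
  finally show ?thesis by simp
qed

section \<open>Asymptotics\<close>

lemma exp_tendsto_0I:
  assumes "0 < \<delta>" "filterlim g at_top sequentially" "\<forall>\<^sub>F m in sequentially. f m \<le> - (\<delta> * g m)"
  shows "(\<lambda>m. exp (f m :: real)) \<longlonglongrightarrow> 0"
proof (rule tendsto_sandwich[where f="\<lambda>_. 0"])
  have "filterlim (\<lambda>m. \<delta> * g m) at_top sequentially"
    using assms by (intro filterlim_tendsto_pos_mult_at_top[OF tendsto_const])
  then have "filterlim (\<lambda>m. - (\<delta> * g m)) at_bot sequentially"
    by (simp add: filterlim_uminus_at_bot)
  then show "(\<lambda>m. exp (- (\<delta> * g m))) \<longlonglongrightarrow> 0" by (rule filterlim_compose[OF exp_at_bot])
  show "\<forall>\<^sub>F m in sequentially. exp (f m) \<le> exp (- (\<delta> * g m))"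
    using assms(3) by eventually_elim simp
qed auto

lemma exp_tendsto_0_ratio:
  assumes "(\<lambda>m. f m / g m) \<longlonglongrightarrow> c" "c < 0" "filterlim g at_top sequentially"
  shows "(\<lambda>m. exp (f m :: real)) \<longlonglongrightarrow> 0"
proof (rule exp_tendsto_0I[of "- c / 2" g])
  have "\<forall>\<^sub>F m in sequentially. f m / g m < c / 2" using assms by (intro order_tendstoD(2)) auto
  moreover have "\<forall>\<^sub>F m in sequentially. 0 < g m"
    using assms(3) by (simp add: filterlim_at_top_dense)
  ultimately show "\<forall>\<^sub>F m in sequentially. f m \<le> - (- c / 2 * g m)"
    by eventually_elim (simp add: field_simps)
qed (use assms in auto)

definition net_size :: "real \<Rightarrow> nat \<Rightarrow> nat" where
  "net_size a m = nat \<lceil>real m powr a\<rceil>"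

lemma net_size_bounds:
  assumes "0 \<le> a" "0 < m"
  shows "real m powr a \<le> real (net_size a m)" "real (net_size a m) \<le> 2 * real m powr a" "0 < net_size a m"
proof -
  have 1: "1 \<le> real m powr a" using assms by (intro ge_one_powr_ge_zero) auto
  show l: "real m powr a \<le> real (net_size a m)" unfolding net_size_def by linarith
  show "real (net_size a m) \<le> 2 * real m powr a"
    using 1 unfolding net_size_def by linarith
  show "0 < net_size a m" using l 1 by linarith
qed

text \<open>Rounding up at most doubles the size, which disappears on the logarithmic scale.\<close>

lemma ln_net_size:
  assumes a: "0 \<le> a"
  shows "(\<lambda>m. ln (real (net_size a m)) / ln (real m)) \<longlonglongrightarrow> a"
proof (rule tendsto_sandwich[where f="\<lambda>_. a" and h="\<lambda>m. a + ln 2 / ln (real m)"])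
  show "(\<lambda>m. a + ln 2 / ln (real m)) \<longlonglongrightarrow> a" by real_asymp
  show "\<forall>\<^sub>F m in sequentially. a \<le> ln (real (net_size a m)) / ln (real m)"
    using eventually_ge_at_top[of 2]
  proof eventually_elim
    case (elim m)
    have "ln (real m powr a) \<le> ln (real (net_size a m))"
      using net_size_bounds[OF a, of m] elim by (intro ln_mono) auto
    then show ?case using elim by (simp add: ln_powr field_simps)
  qed
  show "\<forall>\<^sub>F m in sequentially. ln (real (net_size a m)) / ln (real m) \<le> a + ln 2 / ln (real m)"
    using eventually_ge_at_top[of 2]
  proof eventually_elim
    case (elim m)
    have "ln (real (net_size a m)) \<le> ln (2 * real m powr a)"
      using net_size_bounds[OF a, of m] elim by (intro ln_mono) auto
    also have "\<dots> = ln 2 + a * ln (real m)" using elim by (simp add: ln_mult ln_powr)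
    finally show ?case using elim by (simp add: field_simps)
  qed
qed simp

lemma sets_poly_sup_norm:
  "{a \<in> space (gauss (multi_indices m n)). c < poly_sup_norm m n a} \<in> sets (gauss (multi_indices m n))"
  "{a \<in> space (gauss (multi_indices m n)). poly_sup_norm m n a \<le> c} \<in> sets (gauss (multi_indices m n))"
proof -
  have m: "poly_sup_norm m n \<in> borel_measurable (gauss (multi_indices m n))"
    unfolding measurable_cong_sets[OF sets_gauss refl] by (rule measurable_poly_sup_norm)
  show "{a \<in> space (gauss (multi_indices m n)). c < poly_sup_norm m n a} \<in> sets (gauss (multi_indices m n))"
    by (rule borel_measurable_less[OF borel_measurable_const m])
  show "{a \<in> space (gauss (multi_indices m n)). poly_sup_norm m n a \<le> c} \<in> sets (gauss (multi_indices m n))"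
    by (rule borel_measurable_le[OF m borel_measurable_const])
qed

abbreviation xlnx :: "nat \<Rightarrow> real" where
  "xlnx m \<equiv> real m * ln (real m)"

lemma xlnx_at_top: "filterlim xlnx at_top sequentially" by real_asymp

section \<open>Limits when the number of variables is asymptotic to the degree\<close>

context
  fixes k :: "nat \<Rightarrow> nat"
  assumes k: "(\<lambda>m. real (k m) / real m) \<longlonglongrightarrow> 1"
begin

abbreviation dimension :: "nat \<Rightarrow> real" where
  "dimension m \<equiv> real (card (multi_indices m (Suc (k m))))"

lemma k_bounds: "\<forall>\<^sub>F m in sequentially. 2 \<le> m \<and> 0 < k m \<and> 3 * m \<le> 2 * (m + k m) \<and> real (Suc (k m)) \<le> 2 * real m"
proof -
  have "\<forall>\<^sub>F m in sequentially. 3 / 4 < real (k m) / real m" "\<forall>\<^sub>F m in sequentially. real (k m) / real m < 3 / 2"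
    by (rule order_tendstoD[OF k]; simp)+
  then show ?thesis using eventually_ge_at_top[of 2]
  proof eventually_elim
    case (elim m)
    then have 1: "3 / 4 * real m < real (k m)" and 2: "real (k m) < 3 / 2 * real m" and 3: "2 \<le> real m"
      by (simp_all add: field_simps)
    have "0 < real (k m)" using 1 3 by linarith
    moreover have "real (3 * m) \<le> real (2 * (m + k m))" using 1 by simp
    then have "3 * m \<le> 2 * (m + k m)" by (simp only: of_nat_le_iff)
    moreover have "real (Suc (k m)) \<le> 2 * real m" using 2 3 by simp
    ultimately show ?case using elim by simp
  qed
qed

lemma Suc_k_ratio: "(\<lambda>m. real (Suc (k m)) / real m) \<longlonglongrightarrow> 1"
proof -
  have "(\<lambda>m. real (k m) / real m + 1 / real m) \<longlonglongrightarrow> 1 + 0"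
    by (intro tendsto_add k lim_1_over_n)
  then show ?thesis by (simp add: add_divide_distrib add.commute)
qed

lemma p_limit: "(\<lambda>m. real m / real (m + k m)) \<longlonglongrightarrow> 1 / 2"
proof -
  have "(\<lambda>m. 1 / (1 + real (k m) / real m)) \<longlonglongrightarrow> 1 / (1 + 1)"
    by (intro tendsto_intros k) simp
  moreover have "\<forall>\<^sub>F m in sequentially. 1 / (1 + real (k m) / real m) = real m / real (m + k m)"
    using eventually_gt_at_top[of 0] by eventually_elim (simp add: field_simps)
  ultimately show ?thesis using tendsto_cong by fastforce
qed

lemma dimension_pos: "0 < dimension m"
  using multi_indices_nonempty[of "Suc (k m)" m] by (simp add: card_gt_0_iff finite_multi_indices)

text \<open>By \<open>binomial_mode\<close> the logarithm is
  \<open>- m * ln p - k * ln (1 - p)\<close> up to an error of at most \<open>ln (4 * m)\<close>.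
  Dividing by \<open>m\<close>, with \<open>p\<close> tending to 1/2 and \<open>k / m\<close> to 1,
  leaves \<open>2 * ln 2\<close>.\<close>

lemma ln_dimension: "(\<lambda>m. ln (dimension m) / real m) \<longlonglongrightarrow> 2 * ln 2"
proof -
  define p where "p m = real m / real (m + k m)" for m
  let ?u = "\<lambda>m. - ln (p m) - (real (k m) / real m) * ln (1 - p m)"
  have p: "p \<longlonglongrightarrow> 1 / 2" unfolding p_def by (rule p_limit)
  have "?u \<longlonglongrightarrow> - ln (1 / 2) - 1 * ln (1 - 1 / 2)"
    by (intro tendsto_intros k p) simp_all
  then have u: "?u \<longlonglongrightarrow> 2 * ln 2" by (simp add: ln_div)
  have "(\<lambda>m. ?u m - ln (4 * real m) / real m) \<longlonglongrightarrow> 2 * ln 2 - 0"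
    by (intro tendsto_diff u) real_asymp
  then have l: "(\<lambda>m. ?u m - ln (4 * real m) / real m) \<longlonglongrightarrow> 2 * ln 2" by simp
  have mode: "\<forall>\<^sub>F m in sequentially. ln (dimension m) \<le> real m * ?u m \<and>
      real m * ?u m - ln (4 * real m) \<le> ln (dimension m)"
    using k_bounds
  proof eventually_elim
    case (elim m)
    then have mk: "0 < m" "0 < k m" by simp_all
    have p01: "0 < p m" "p m < 1" using mk by (auto simp: p_def)
    define X where "X = p m ^ m * (1 - p m) ^ k m"
    have X: "0 < X" using p01 by (simp add: X_def)
    have lnX: "ln X = - (real m * ?u m)"
      using p01 mk by (simp add: X_def ln_mult ln_realpow field_simps)
    have c: "dimension m = real (m + k m choose m)" by (simp only: card_multi_indices)
    have up: "dimension m * X \<le> 1"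
      using binomial_mode(1)[OF mk] unfolding c X_def p_def by (simp only: mult.assoc)
    have lo: "1 \<le> real (Suc (m + k m)) * (dimension m * X)"
      using binomial_mode(2)[OF mk] unfolding c X_def p_def by (simp only: mult.assoc)
    have "ln (dimension m * X) \<le> ln 1" using up dimension_pos[of m] X by (intro ln_mono) auto
    then have 1: "ln (dimension m) + ln X \<le> 0" using dimension_pos[of m] X by (simp add: ln_mult)
    have "1 \<le> (4 * real m) * (dimension m * X)"
    proof -
      have "real (Suc (m + k m)) * (dimension m * X) \<le> (4 * real m) * (dimension m * X)"
        using elim dimension_pos[of m] X by (intro mult_right_mono) auto
      then show ?thesis using lo by linarith
    qed
    then have "ln 1 \<le> ln ((4 * real m) * (dimension m * X))" by (intro ln_mono) auto
    also have "\<dots> = ln (4 * real m) + (ln (dimension m) + ln X)"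
      using mk dimension_pos[of m] X by (simp add: ln_mult)
    finally show ?case using 1 lnX by simp
  qed
  have uu: "\<forall>\<^sub>F m in sequentially. ln (dimension m) / real m \<le> ?u m"
    using mode eventually_gt_at_top[of 0] by eventually_elim (simp add: pos_divide_le_eq mult.commute)
  have ll: "\<forall>\<^sub>F m in sequentially. ?u m - ln (4 * real m) / real m \<le> ln (dimension m) / real m"
    using mode eventually_gt_at_top[of 0]
  proof eventually_elim
    case (elim m)
    have "?u m - ln (4 * real m) / real m = (real m * ?u m - ln (4 * real m)) / real m"
      using elim(2) by (simp add: diff_divide_distrib)
    then show ?case using elim by (simp only: divide_right_mono of_nat_0_le_iff)
  qed
  show ?thesis by (rule tendsto_sandwich[OF ll uu l u])
qed

lemma dimension_root: "(\<lambda>m. dimension m powr (1 / (2 * real m))) \<longlonglongrightarrow> 2"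
proof -
  have "(\<lambda>m. exp ((ln (dimension m) / real m) / 2)) \<longlonglongrightarrow> exp ((2 * ln 2) / 2)"
    by (intro tendsto_intros ln_dimension) simp_all
  moreover have "exp ((ln (dimension m) / real m) / 2) = dimension m powr (1 / (2 * real m))" for m
    using dimension_pos[of m] by (simp add: powr_def mult.commute)
  ultimately show ?thesis by simp
qed

lemma inverse_dimension: "(\<lambda>m. 1 / dimension m) \<longlonglongrightarrow> 0"
proof -
  have "(\<lambda>m. exp (- ln (dimension m))) \<longlonglongrightarrow> 0"
  proof (rule exp_tendsto_0_ratio)
    show "(\<lambda>m. - ln (dimension m) / real m) \<longlonglongrightarrow> - (2 * ln 2)"
      using tendsto_minus[OF ln_dimension] by simp
  qed (simp_all add: filterlim_real_sequentially)
  then show ?thesis using dimension_pos by (simp add: exp_minus inverse_eq_divide)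
qed

text \<open>\<open>prob_sup_norm_upper\<close> is used with \<open>K = m\<close> directions, a fine
  grid of \<open>m ^ 4\<close> points per coordinate, and the level split as
  \<open>1 + \<eta> / 2\<close> for the coarse grid and \<open>\<eta> / 8\<close> for the
  increments. The two terms of its bound are \<open>exp (f1 m)\<close> and
  \<open>exp (f2 m)\<close>.\<close>

lemma sup_norm_upper_in_prob:
  assumes \<eta>: "0 < \<eta>" "\<eta> \<le> 1"
  shows "(\<lambda>m. measure (gauss (multi_indices m (Suc (k m))))
    {a \<in> space (gauss (multi_indices m (Suc (k m)))).
      (1 + \<eta>) * sqrt (dimension m * xlnx m) < poly_sup_norm m (Suc (k m)) a}) \<longlonglongrightarrow> 0"
proof (rule tendsto_sandwich[where f="\<lambda>_. 0"])
  \<comment> \<open>The extra entropy \<epsilon> of the coarse grid must stay below the gain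
    \<open>((1 + \<eta> / 2)\<^sup>2 - 1) / 2\<close> from the raised level, which exceeds
    \<open>\<eta> / 2\<close>.\<close>
  define \<epsilon> where "\<epsilon> = \<eta> / 4"
  define q where "q m = net_size (1 / 2 + \<epsilon>) m" for m
  define \<kappa> where "\<kappa> m = cos (2 * pi / real m)" for m :: nat
  define F where "F m = (1 + 7 * (real m + 1)\<^sup>2 / real (m ^ 4)) ^ Suc (k m)" for m
  define f1 where "f1 m = real (Suc (k m)) * ln (real (q m)) + ln (real m) - (1 + \<eta> / 2)\<^sup>2 * (\<kappa> m)\<^sup>2 * xlnx m / 2" for m
  \<comment> \<open>The denominator is \<open>2 * 40 * (2 * pi)\<^sup>2\<close>, from the variance
    of the increments.\<close>
  define C where "C = (\<eta> / 8)\<^sup>2 / (320 * pi\<^sup>2)"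
  define f2 where "f2 m = real (Suc (k m)) * (4 * ln (real m)) + ln (real m)
     - C * (\<kappa> m)\<^sup>2 * xlnx m * (real (q m))\<^sup>2 / real (Suc (k m))" for m
  have \<epsilon>: "0 < \<epsilon>" using \<eta> by (simp add: \<epsilon>_def)
  have C: "0 < C" using \<eta> by (simp add: C_def)
  have \<kappa>: "\<kappa> \<longlonglongrightarrow> 1" unfolding \<kappa>_def by real_asymp
  have lnq: "(\<lambda>m. ln (real (q m)) / ln (real m)) \<longlonglongrightarrow> 1 / 2 + \<epsilon>"
    unfolding q_def using \<epsilon> by (intro ln_net_size) auto
  \<comment> \<open>With \<open>m ^ 4\<close> points per coordinate the discretisation factor is at
    most the exponential of a quantity of order \<open>1 / m\<close>, while the entropy of the fine
    grid remains of order \<open>m ln m\<close>.\<close>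
  have F: "\<forall>\<^sub>F m in sequentially. F m \<le> 1 + \<eta> / 8"
  proof -
    have "(\<lambda>m. exp ((real (Suc (k m)) / real m) * (7 * (real m + 1)\<^sup>2 / real m ^ 3))) \<longlonglongrightarrow> exp (1 * 0)"
    proof (intro tendsto_exp tendsto_mult Suc_k_ratio)
      show "(\<lambda>m. 7 * (real m + 1)\<^sup>2 / real m ^ 3) \<longlonglongrightarrow> 0" by real_asymp
    qed
    then have "\<forall>\<^sub>F m in sequentially. exp ((real (Suc (k m)) / real m) * (7 * (real m + 1)\<^sup>2 / real m ^ 3)) < 1 + \<eta> / 8"
      using \<eta> by (intro order_tendstoD(2)) auto
    then show ?thesis using eventually_gt_at_top[of 0]
    proof eventually_elim
      case (elim m)
      let ?x = "7 * (real m + 1)\<^sup>2 / real (m ^ 4)"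
      have "F m \<le> exp ?x ^ Suc (k m)"
        unfolding F_def by (intro power_mono exp_ge_add_one_self) simp
      also have "\<dots> = exp (real (Suc (k m)) * ?x)" by (simp only: exp_of_nat_mult)
      also have "real (Suc (k m)) * ?x = (real (Suc (k m)) / real m) * (7 * (real m + 1)\<^sup>2 / real m ^ 3)"
        using elim(2) by (simp add: power4_eq_xxxx power3_eq_cube)
      finally show ?case using elim(1) by linarith
    qed
  qed
  have "(\<lambda>m. exp (f1 m)) \<longlonglongrightarrow> 0"
  proof (rule exp_tendsto_0_ratio[OF _ _ xlnx_at_top])
    have "(\<lambda>m. (real (Suc (k m)) / real m) * (ln (real (q m)) / ln (real m)) + 1 / real m - (1 + \<eta> / 2)\<^sup>2 * (\<kappa> m)\<^sup>2 / 2)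
       \<longlonglongrightarrow> 1 * (1 / 2 + \<epsilon>) + 0 - (1 + \<eta> / 2)\<^sup>2 * 1\<^sup>2 / 2"
      by (intro tendsto_intros Suc_k_ratio lnq lim_1_over_n \<kappa>) simp
    moreover have "\<forall>\<^sub>F m in sequentially. (real (Suc (k m)) / real m) * (ln (real (q m)) / ln (real m)) + 1 / real m
        - (1 + \<eta> / 2)\<^sup>2 * (\<kappa> m)\<^sup>2 / 2 = f1 m / xlnx m"
      using eventually_ge_at_top[of 2]
    proof eventually_elim
      case (elim m)
      have "ln (real m) \<noteq> 0" "real m \<noteq> 0" using elim by auto
      then show ?case by (simp add: f1_def field_simps)
    qed
    ultimately show "(\<lambda>m. f1 m / xlnx m) \<longlonglongrightarrow> 1 * (1 / 2 + \<epsilon>) + 0 - (1 + \<eta> / 2)\<^sup>2 * 1\<^sup>2 / 2"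
      by (rule Lim_transform_eventually)
    show "1 * (1 / 2 + \<epsilon>) + 0 - (1 + \<eta> / 2)\<^sup>2 * 1\<^sup>2 / 2 < 0"
    proof -
      have "(1 + \<eta> / 2)\<^sup>2 = 1 + \<eta> + \<eta> * \<eta> / 4" by (simp add: power2_eq_square field_simps)
      moreover have "0 < \<eta> * \<eta>" using \<eta> by simp
      ultimately have "1 / 2 + \<eta> / 4 < (1 + \<eta> / 2)\<^sup>2 / 2" using \<eta> by linarith
      then show ?thesis by (simp only: \<epsilon>_def) simp
    qed
  qed
  moreover have "(\<lambda>m. exp (f2 m)) \<longlonglongrightarrow> 0"
  proof (rule exp_tendsto_0I[OF zero_less_one xlnx_at_top])
    have k2: "\<forall>\<^sub>F m in sequentially. 1 / 2 < \<kappa> m" using \<kappa> by (rule order_tendstoD) simp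
    \<comment> \<open>The exponent of the increments exceeds \<open>m ln m\<close> by the unbounded
      factor \<open>m powr (2 * \<epsilon>)\<close>. Ten units are required: eight for the entropy
      of the fine grid, one for \<open>ln m\<close>, and one that remains.\<close>
    have "filterlim (\<lambda>m. C / 8 * real m powr (2 * \<epsilon>)) at_top sequentially" using C \<epsilon> by real_asymp
    then have "\<forall>\<^sub>F m in sequentially. 10 \<le> C / 8 * real m powr (2 * \<epsilon>)"
      unfolding filterlim_at_top by blast
    then show "\<forall>\<^sub>F m in sequentially. f2 m \<le> - (1 * xlnx m)"
      using k2 k_bounds
    proof eventually_elim
      case (elim m)
      then have m: "2 \<le> real m" "0 < ln (real m)" and n: "real (Suc (k m)) \<le> 2 * real m" by auto
      have L: "0 < xlnx m" "ln (real m) \<le> xlnx m" using m by auto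
      have "1 / 4 \<le> (\<kappa> m)\<^sup>2" using power_mono[of "1 / 2" "\<kappa> m" 2] elim by (simp add: power2_eq_square)
      moreover have "real m powr (2 * \<epsilon>) / 2 \<le> (real (q m))\<^sup>2 / real (Suc (k m))"
      proof -
        have "real m * real m powr (2 * \<epsilon>) = (real m powr (1 / 2 + \<epsilon>))\<^sup>2"
        proof -
          have "(real m powr (1 / 2 + \<epsilon>))\<^sup>2 = real m powr (1 + 2 * \<epsilon>)"
            by (simp add: power2_eq_square flip: powr_add)
          then show ?thesis using m by (simp add: powr_add)
        qed
        also have "\<dots> \<le> (real (q m))\<^sup>2"
          unfolding q_def using \<epsilon> elim by (intro power_mono net_size_bounds) auto
        finally have "real m * real m powr (2 * \<epsilon>) / (2 * real m) \<le> (real (q m))\<^sup>2 / real (Suc (k m))"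
          using n by (intro frac_le) auto
        then show ?thesis using m by simp
      qed
      ultimately have "1 / 4 * (real m powr (2 * \<epsilon>) / 2) \<le> (\<kappa> m)\<^sup>2 * ((real (q m))\<^sup>2 / real (Suc (k m)))"
        by (intro mult_mono) auto
      then have "C * xlnx m * (1 / 4 * (real m powr (2 * \<epsilon>) / 2)) \<le> C * xlnx m * ((\<kappa> m)\<^sup>2 * ((real (q m))\<^sup>2 / real (Suc (k m))))"
        using C L by (intro mult_left_mono) auto
      moreover have "xlnx m * 10 \<le> xlnx m * (C / 8 * real m powr (2 * \<epsilon>))"
        using elim L by (intro mult_left_mono) auto
      moreover have "real (Suc (k m)) * (4 * ln (real m)) \<le> 8 * xlnx m"
        using mult_right_mono[OF n, of "4 * ln (real m)"] m by simp
      ultimately show ?case using L by (simp add: f2_def mult_ac)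
    qed
  qed
  ultimately show "(\<lambda>m. exp (f1 m) + exp (f2 m)) \<longlonglongrightarrow> 0" using tendsto_add[of _ 0 _ _ 0] by fastforce
  show "\<forall>\<^sub>F m in sequentially. measure (gauss (multi_indices m (Suc (k m))))
    {a \<in> space (gauss (multi_indices m (Suc (k m)))).
      (1 + \<eta>) * sqrt (dimension m * xlnx m) < poly_sup_norm m (Suc (k m)) a} \<le> exp (f1 m) + exp (f2 m)"
    using F k_bounds eventually_ge_at_top[of 5]
  proof eventually_elim
    case (elim m)
    interpret prob_space "gauss (multi_indices m (Suc (k m)))" by (rule prob_space_gauss)
    let ?N = "dimension m" and ?n = "Suc (k m)"
    define S where "S = sqrt (?N * xlnx m)"
    have m: "5 \<le> real m" using elim by simp
    have N: "0 < ?N" by (rule dimension_pos)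
    have L: "0 \<le> xlnx m" using m by auto
    have S: "0 \<le> S" "S\<^sup>2 = ?N * xlnx m" using N L by (simp_all add: S_def)
    have q: "0 < q m" unfolding q_def using \<epsilon> m by (intro net_size_bounds) auto
    have Q: "m < m ^ 4" using power_strict_increasing[of 1 4 m] elim by simp
    have "F m * ((1 + \<eta> / 2) * S + \<eta> / 8 * S) \<le> (1 + \<eta> / 8) * ((1 + \<eta> / 2) * S + \<eta> / 8 * S)"
      using elim S \<eta> by (intro mult_right_mono) auto
    also have "\<dots> = ((1 + \<eta> / 8) * (1 + 5 * \<eta> / 8)) * S" by (simp add: algebra_simps)
    also have "\<dots> \<le> (1 + \<eta>) * S"
    proof (intro mult_right_mono S)
      have "\<eta> * \<eta> \<le> \<eta> * 1" using \<eta> by (intro mult_left_mono) auto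
      moreover have "(1 + \<eta> / 8) * (1 + 5 * \<eta> / 8) = 1 + 6 * \<eta> / 8 + 5 * (\<eta> * \<eta>) / 64"
        by (simp add: field_simps)
      ultimately show "(1 + \<eta> / 8) * (1 + 5 * \<eta> / 8) \<le> 1 + \<eta>" using \<eta> by linarith
    qed
    finally have "{a \<in> space (gauss (multi_indices m ?n)). (1 + \<eta>) * S < poly_sup_norm m ?n a}
      \<subseteq> {a \<in> space (gauss (multi_indices m ?n)). F m * ((1 + \<eta> / 2) * S + \<eta> / 8 * S) < poly_sup_norm m ?n a}"
      by auto
    then have "prob {a \<in> space (gauss (multi_indices m ?n)). (1 + \<eta>) * S < poly_sup_norm m ?n a}
      \<le> prob {a \<in> space (gauss (multi_indices m ?n)). F m * ((1 + \<eta> / 2) * S + \<eta> / 8 * S) < poly_sup_norm m ?n a}"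
      by (intro finite_measure_mono sets_poly_sup_norm)
    also have "\<dots> \<le> real (q m) ^ ?n * (real m * exp (- ((1 + \<eta> / 2) * S * cos (2 * pi / real m))\<^sup>2 / (2 * ?N)))
      + real (m ^ 4) ^ ?n * (real m * exp (- (\<eta> / 8 * S * cos (2 * pi / real m))\<^sup>2 / (2 * (40 * ?N * real ?n * (2 * pi / real (q m))\<^sup>2))))"
      unfolding F_def using elim q Q S \<eta> by (intro prob_sup_norm_upper) auto
    also have "real (q m) ^ ?n * (real m * exp (- ((1 + \<eta> / 2) * S * cos (2 * pi / real m))\<^sup>2 / (2 * ?N))) = exp (f1 m)"
    proof -
      have "((1 + \<eta> / 2) * S * cos (2 * pi / real m))\<^sup>2 / (2 * ?N) = (1 + \<eta> / 2)\<^sup>2 * (\<kappa> m)\<^sup>2 * xlnx m / 2"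
        unfolding power_mult_distrib S(2) \<kappa>_def[symmetric] using N by simp
      moreover have "real (q m) ^ ?n = exp (real ?n * ln (real (q m)))" using q by (simp only: exp_of_nat_mult exp_ln of_nat_0_less_iff)
      moreover have "real m = exp (ln (real m))" using m by simp
      ultimately show ?thesis unfolding f1_def by (simp only: exp_diff exp_add exp_minus divide_inverse mult.assoc minus_mult_left[symmetric])
    qed
    also have "real (m ^ 4) ^ ?n * (real m * exp (- (\<eta> / 8 * S * cos (2 * pi / real m))\<^sup>2 / (2 * (40 * ?N * real ?n * (2 * pi / real (q m))\<^sup>2)))) = exp (f2 m)"
    proof -
      have "(\<eta> / 8 * S * cos (2 * pi / real m))\<^sup>2 / (2 * (40 * ?N * real ?n * (2 * pi / real (q m))\<^sup>2))
        = C * (\<kappa> m)\<^sup>2 * xlnx m * (real (q m))\<^sup>2 / real ?n"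
        unfolding power_mult_distrib power_divide S(2) \<kappa>_def[symmetric] C_def using N q by (simp del: of_nat_Suc add: field_simps)
      moreover have "real (m ^ 4) ^ ?n = exp (real ?n * (4 * ln (real m)))"
      proof -
        have "4 * ln (real m) = ln (real (m ^ 4))" using m by (simp add: ln_realpow)
        then show ?thesis using m by (simp only: exp_of_nat_mult) simp
      qed
      moreover have "real m = exp (ln (real m))" using m by simp
      ultimately show ?thesis unfolding f2_def by (simp only: exp_diff exp_add exp_minus divide_inverse mult.assoc minus_mult_left[symmetric])
    qed
    finally show ?case by (simp only: S_def)
  qed
qed auto

lemma power_sum_in_prob:
  assumes \<eta>: "0 < \<eta>"
  shows "(\<lambda>m. measure (gauss (multi_indices m (Suc (k m))))
    {a \<in> space (gauss (multi_indices m (Suc (k m)))).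
      \<eta> * dimension m < \<bar>(\<Sum>\<alpha>\<in>multi_indices m (Suc (k m)). cmod (a \<alpha>) powr (2 * real m / (real m + 1))) - 2 * dimension m\<bar>}) \<longlonglongrightarrow> 0"
proof (rule tendsto_sandwich[where f="\<lambda>_. 0"])
  let ?b = "\<lambda>m. 18 * (2 - 2 * real m / (real m + 1)) / \<eta> + 16 / \<eta>\<^sup>2 * (1 / dimension m)"
  have "?b \<longlonglongrightarrow> 18 * 0 / \<eta> + 16 / \<eta>\<^sup>2 * 0"
  proof (intro tendsto_intros inverse_dimension)
    show "(\<lambda>m. 2 - 2 * real m / (real m + 1)) \<longlonglongrightarrow> 0" by real_asymp
  qed (use \<eta> in auto)
  then show "?b \<longlonglongrightarrow> 0" by simp
  show "\<forall>\<^sub>F m in sequentially. measure (gauss (multi_indices m (Suc (k m))))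
    {a \<in> space (gauss (multi_indices m (Suc (k m)))).
      \<eta> * dimension m < \<bar>(\<Sum>\<alpha>\<in>multi_indices m (Suc (k m)). cmod (a \<alpha>) powr (2 * real m / (real m + 1))) - 2 * dimension m\<bar>} \<le> ?b m"
    using eventually_ge_at_top[of 1]
  proof eventually_elim
    case (elim m)
    have "1 \<le> 2 * real m / (real m + 1)" "2 * real m / (real m + 1) \<le> 2" using elim by (simp_all add: field_simps)
    from prob_power_sum[OF finite_multi_indices multi_indices_nonempty[OF zero_less_Suc] this \<eta>, of m "k m"]
    show ?case by (simp add: mult.commute)
  qed
qed auto

end

text \<open>With about \<open>m powr (1 / 2 - \<epsilon>)\<close> points per coordinate and
  \<open>e\<close> about \<open>\<epsilon> * m\<close>, the ratio \<open>e / q\<^sup>2\<close> is of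
  order \<open>m powr (2 * \<epsilon>)\<close>, so correlations outside bad pairs decay faster than
  any power of \<open>m\<close>. The bad pairs are still so rare that their proportion, divided by
  the tail probability of one value, tends to 0.\<close>

lemma sup_norm_lower_in_prob:
  fixes k :: "nat \<Rightarrow> nat"
  assumes k: "(\<lambda>m. real (k m) / real m) \<longlonglongrightarrow> 1" and \<eta>: "0 < \<eta>" "\<eta> < 1"
  shows "(\<lambda>m. measure (gauss (multi_indices m (Suc (k m))))
    {a \<in> space (gauss (multi_indices m (Suc (k m)))).
      poly_sup_norm m (Suc (k m)) a \<le> (1 - \<eta>) * sqrt (dimension k m * xlnx m)}) \<longlonglongrightarrow> 0"
proof (rule tendsto_sandwich[where f="\<lambda>_. 0"])
  define \<epsilon> where "\<epsilon> = \<eta> / 8"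
  define q where "q m = net_size (1 / 2 - \<epsilon>) m" for m
  define e where "e m = nat \<lceil>\<epsilon> * real m\<rceil>" for m :: nat
  define t where "t m = (1 - \<eta>) * sqrt (xlnx m)" for m
  define p where "p m = real m / real (m + k m)" for m
  define r where "r m = real (Suc (m + k m)) / (1 - p m) * exp (- (p m / (4 * (real (q m))\<^sup>2))) ^ e m" for m
  \<comment> \<open>\<open>exp (f m)\<close>, \<open>g m\<close> and \<open>h m\<close> bound the
    contributions of the bad pairs, of the level lowered by correlation, and of values above twice
    the level.\<close>
  define f where "f m = ln (real (q m)) + real (Suc (k m)) * ln 2 + real (e m) * ln (real (q m))
    - real (Suc (k m)) * ln (real (q m)) + (1 - \<eta>)\<^sup>2 * xlnx m / 2 + ln (27 * (1 + sqrt (xlnx m)))" for m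
  define g where "g m = 108 * (r m * (real m)\<^sup>2) * exp (2 * (r m * (real m)\<^sup>2))" for m
  define h where "h m = 729 * (1 + t m)\<^sup>2 * exp (- (t m)\<^sup>2)" for m
  have \<epsilon>: "0 < \<epsilon>" "\<epsilon> < 1 / 8" using \<eta> by (simp_all add: \<epsilon>_def)
  have lnq: "(\<lambda>m. ln (real (q m)) / ln (real m)) \<longlonglongrightarrow> 1 / 2 - \<epsilon>"
    unfolding q_def using \<epsilon> by (intro ln_net_size) auto
  have eb: "\<epsilon> * real m \<le> real (e m)" "real (e m) \<le> \<epsilon> * real m + 1" for m
    using \<epsilon> by (simp_all add: e_def)
  have e_lim: "(\<lambda>m. real (e m) / real m) \<longlonglongrightarrow> \<epsilon>"
  proof (rule tendsto_sandwich[where f="\<lambda>_. \<epsilon>" and h="\<lambda>m. \<epsilon> + 1 / real m"])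
    have "(\<lambda>m. \<epsilon> + 1 / real m) \<longlonglongrightarrow> \<epsilon> + 0" by (intro tendsto_intros lim_1_over_n)
    then show "(\<lambda>m. \<epsilon> + 1 / real m) \<longlonglongrightarrow> \<epsilon>" by simp
    show "\<forall>\<^sub>F m in sequentially. \<epsilon> \<le> real (e m) / real m"
      using eventually_gt_at_top[of 0] by eventually_elim (use eb in \<open>simp add: field_simps\<close>)
    show "\<forall>\<^sub>F m in sequentially. real (e m) / real m \<le> \<epsilon> + 1 / real m"
      using eventually_gt_at_top[of 0] by eventually_elim (use eb in \<open>simp add: field_simps\<close>)
  qed simp
  have f0: "(\<lambda>m. exp (f m)) \<longlonglongrightarrow> 0"
  proof (rule exp_tendsto_0_ratio[OF _ _ xlnx_at_top])
    let ?c = "0 * (1 / 2 - \<epsilon>) + 1 * 0 + \<epsilon> * (1 / 2 - \<epsilon>) - 1 * (1 / 2 - \<epsilon>) + (1 - \<eta>)\<^sup>2 / 2 + 0"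
    have "(\<lambda>m. ln 2 / ln (real m)) \<longlonglongrightarrow> 0" "(\<lambda>m. ln (27 * (1 + sqrt (xlnx m))) / xlnx m) \<longlonglongrightarrow> 0"
      by real_asymp+
    then have "(\<lambda>m. (1 / real m) * (ln (real (q m)) / ln (real m)) + (real (Suc (k m)) / real m) * (ln 2 / ln (real m))
        + (real (e m) / real m) * (ln (real (q m)) / ln (real m)) - (real (Suc (k m)) / real m) * (ln (real (q m)) / ln (real m))
        + (1 - \<eta>)\<^sup>2 / 2 + ln (27 * (1 + sqrt (xlnx m))) / xlnx m) \<longlonglongrightarrow> ?c"
      by (intro tendsto_add tendsto_diff tendsto_mult Suc_k_ratio[OF k] lnq e_lim lim_1_over_n tendsto_const)
    moreover have "\<forall>\<^sub>F m in sequentially. (1 / real m) * (ln (real (q m)) / ln (real m)) + (real (Suc (k m)) / real m) * (ln 2 / ln (real m))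
        + (real (e m) / real m) * (ln (real (q m)) / ln (real m)) - (real (Suc (k m)) / real m) * (ln (real (q m)) / ln (real m))
        + (1 - \<eta>)\<^sup>2 / 2 + ln (27 * (1 + sqrt (xlnx m))) / xlnx m = f m / xlnx m"
      using eventually_ge_at_top[of 2]
    proof eventually_elim
      case (elim m)
      have "ln (real m) \<noteq> 0" "real m \<noteq> 0" using elim by auto
      then show ?case unfolding f_def add_divide_distrib diff_divide_distrib by simp
    qed
    ultimately show "(\<lambda>m. f m / xlnx m) \<longlonglongrightarrow> ?c" by (rule Lim_transform_eventually)
    \<comment> \<open>With \<open>\<epsilon> = \<eta> / 8\<close> the limit is
      \<open>- 13 * \<eta> / 16 + 31 * \<eta>\<^sup>2 / 64\<close>, negative for \<eta> below
      1.\<close>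
    have "\<eta> * \<eta> < \<eta> * 1" using \<eta> by (intro mult_strict_left_mono) auto
    moreover have c: "?c = - (1 / 2 - 3 * \<eta> / 16 + \<eta> * \<eta> / 64) + (1 - 2 * \<eta> + \<eta> * \<eta>) / 2"
      unfolding \<epsilon>_def by (simp add: power2_eq_square algebra_simps)
    moreover have "0 < \<eta> * \<eta>" using \<eta> by simp
    ultimately have "- (1 / 2 - 3 * \<eta> / 16 + \<eta> * \<eta> / 64) + (1 - 2 * \<eta> + \<eta> * \<eta>) / 2 < 0"
      using \<eta> by (simp add: field_simps)
    then show "?c < 0" by (simp only: c)
  qed
  have pb: "\<forall>\<^sub>F m in sequentially. 1 / 3 < p m \<and> p m < 2 / 3"
  proof -
    have "p \<longlonglongrightarrow> 1 / 2" unfolding p_def by (rule p_limit[OF k])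
    then have "\<forall>\<^sub>F m in sequentially. 1 / 3 < p m" "\<forall>\<^sub>F m in sequentially. p m < 2 / 3"
      by (rule order_tendstoD; simp)+
    then show ?thesis by eventually_elim simp
  qed
  have r_bound: "\<forall>\<^sub>F m in sequentially. 0 \<le> r m \<and> r m * (real m)\<^sup>2 \<le> 12 * real m ^ 3 * exp (- (\<epsilon> / 48 * real m powr (2 * \<epsilon>)))"
    using pb k_bounds[OF k]
  proof eventually_elim
    case (elim m)
    have m: "2 \<le> real m" using elim by simp
    have q: "0 < real (q m)" "real (q m) \<le> 2 * real m powr (1 / 2 - \<epsilon>)"
      unfolding q_def using \<epsilon> elim net_size_bounds[of "1 / 2 - \<epsilon>" m] by auto
    have q2: "(real (q m))\<^sup>2 \<le> 4 * (real m * real m powr (- (2 * \<epsilon>)))"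
    proof -
      have "(real (q m))\<^sup>2 \<le> (2 * real m powr (1 / 2 - \<epsilon>))\<^sup>2" using q by (intro power_mono) auto
      also have "\<dots> = 4 * (real m powr (1 / 2 - \<epsilon>) * real m powr (1 / 2 - \<epsilon>))" by (simp add: power2_eq_square)
      also have "real m powr (1 / 2 - \<epsilon>) * real m powr (1 / 2 - \<epsilon>) = real m powr (1 + - (2 * \<epsilon>))"
        by (simp flip: powr_add)
      also have "\<dots> = real m * real m powr (- (2 * \<epsilon>))" using m by (simp only: powr_add) simp
      finally show ?thesis .
    qed
    \<comment> \<open>The constant 48 is 3 times 16: \<open>p\<close> exceeds 1/3, and
      \<open>4 * q\<^sup>2\<close> is at most 16 times
      \<open>m powr (1 - 2 * \<epsilon>)\<close>.\<close>
    have "\<epsilon> / 48 * real m powr (2 * \<epsilon>) = (\<epsilon> * real m) * (1 / 3) / (4 * (4 * (real m * real m powr (- (2 * \<epsilon>)))))"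
      using m by (simp add: powr_minus field_simps)
    also have "\<dots> \<le> real (e m) * p m / (4 * (real (q m))\<^sup>2)"
      using eb[of m] elim q q2 \<epsilon> m by (intro frac_le mult_mono mult_left_mono) auto
    finally have ex: "exp (- (p m / (4 * (real (q m))\<^sup>2))) ^ e m \<le> exp (- (\<epsilon> / 48 * real m powr (2 * \<epsilon>)))"
      unfolding exp_of_nat_mult[symmetric] by simp
    have "real (Suc (m + k m)) / (1 - p m) \<le> (4 * real m) / (1 / 3)"
      using elim by (intro frac_le) auto
    then have "real (Suc (m + k m)) / (1 - p m) \<le> 12 * real m" by simp
    then have "r m \<le> (12 * real m) * exp (- (\<epsilon> / 48 * real m powr (2 * \<epsilon>)))"
      unfolding r_def using ex elim by (intro mult_mono) auto
    then have "r m * (real m)\<^sup>2 \<le> ((12 * real m) * exp (- (\<epsilon> / 48 * real m powr (2 * \<epsilon>)))) * (real m)\<^sup>2"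
      by (intro mult_right_mono) auto
    moreover have "0 \<le> r m" unfolding r_def using elim by (intro mult_nonneg_nonneg divide_nonneg_nonneg) auto
    ultimately show ?case by (simp add: power2_eq_square power3_eq_cube mult_ac)
  qed
  \<comment> \<open>The square of \<open>m\<close> pays for the level: \<open>r\<close> occurs
    multiplied by \<open>t\<^sup>2\<close> in an exponent and by \<open>(1 + t) * t\<close> in front
    of it, while \<open>t \<le> m\<close>.\<close>
  have r0: "(\<lambda>m. r m * (real m)\<^sup>2) \<longlonglongrightarrow> 0"
  proof (rule tendsto_sandwich[where f="\<lambda>_. 0" and h="\<lambda>m. 12 * real m ^ 3 * exp (- (\<epsilon> / 48 * real m powr (2 * \<epsilon>)))"])
    show "(\<lambda>m. 12 * real m ^ 3 * exp (- (\<epsilon> / 48 * real m powr (2 * \<epsilon>)))) \<longlonglongrightarrow> 0"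
      using \<epsilon>(1) by real_asymp
    show "\<forall>\<^sub>F m in sequentially. 0 \<le> r m * (real m)\<^sup>2" using r_bound by eventually_elim simp
    show "\<forall>\<^sub>F m in sequentially. r m * (real m)\<^sup>2 \<le> 12 * real m ^ 3 * exp (- (\<epsilon> / 48 * real m powr (2 * \<epsilon>)))"
      using r_bound by eventually_elim simp
  qed simp
  have g0: "g \<longlonglongrightarrow> 0"
  proof -
    have "g \<longlonglongrightarrow> 108 * 0 * exp (2 * 0)" unfolding g_def by (intro tendsto_intros r0)
    then show ?thesis by simp
  qed
  have h0: "h \<longlonglongrightarrow> 0"
  proof -
    have s: "filterlim (\<lambda>m. sqrt (xlnx m)) at_top sequentially" by real_asymp
    have "filterlim t at_top sequentially"
      unfolding t_def using \<eta> by (intro filterlim_tendsto_pos_mult_at_top[OF tendsto_const _ s]) simp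
    moreover have "((\<lambda>x::real. 729 * (1 + x)\<^sup>2 * exp (- x\<^sup>2)) \<longlongrightarrow> 0) at_top" by real_asymp
    ultimately show ?thesis unfolding h_def by (rule filterlim_compose[rotated])
  qed
  show "(\<lambda>m. exp (f m) + g m + h m) \<longlonglongrightarrow> 0"
    using tendsto_add[OF tendsto_add[OF f0 g0] h0] by simp
  have "\<forall>\<^sub>F m in sequentially. r m * (real m)\<^sup>2 < 1" using r0 by (rule order_tendstoD) simp
  then show "\<forall>\<^sub>F m in sequentially. measure (gauss (multi_indices m (Suc (k m))))
    {a \<in> space (gauss (multi_indices m (Suc (k m)))).
      poly_sup_norm m (Suc (k m)) a \<le> (1 - \<eta>) * sqrt (dimension k m * xlnx m)} \<le> exp (f m) + g m + h m"
    using k_bounds[OF k] r_bound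
  proof eventually_elim
    case (elim m)
    let ?N = "dimension k m" and ?n = "Suc (k m)" and ?T = "std_tail (t m)"
    have mk: "0 < m" "0 < k m" and m: "2 \<le> real m" using elim by simp_all
    have L: "0 \<le> xlnx m" using m by auto
    have q: "0 < q m" unfolding q_def using \<epsilon> mk by (intro net_size_bounds) auto
    have sL: "sqrt (xlnx m) \<le> real m"
    proof (rule real_le_lsqrt)
      show "xlnx m \<le> (real m)\<^sup>2" using ln_le_minus_one[of "real m"] m by (simp add: power2_eq_square)
    qed simp
    have t: "0 \<le> t m" "t m \<le> sqrt (xlnx m)" "(t m)\<^sup>2 = (1 - \<eta>)\<^sup>2 * xlnx m"
      using \<eta> L by (auto simp: t_def power_mult_distrib intro: mult_left_le_one_le)
    have tm: "t m \<le> real m" using t sL by linarith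
    have r: "0 \<le> r m" "r m \<le> 1 / 2"
    proof -
      show "0 \<le> r m" using elim by simp
      have "r m * 4 \<le> r m * (real m)\<^sup>2"
        using \<open>0 \<le> r m\<close> power_mono[OF m, of 2] by (intro mult_left_mono) auto
      then show "r m \<le> 1 / 2" using elim by linarith
    qed
    \<comment> \<open>\<open>X\<close> bounds the reciprocal of the tail at the level, by
      \<open>std_tail_lower\<close>.\<close>
    define X where "X = 27 * (1 + t m) * exp ((t m)\<^sup>2 / 2)"
    have T: "0 < ?T" using t(1) by (rule std_tail_pos)
    have X: "1 / ?T \<le> X"
    proof -
      have "1 / ?T \<le> 1 / (exp (- (t m)\<^sup>2 / 2) / (27 * (1 + t m)))"
        using t(1) by (intro divide_left_mono std_tail_lower mult_pos_pos T) auto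
      also have "\<dots> = X" by (simp add: X_def exp_minus field_simps)
      finally show ?thesis .
    qed
    have X0: "0 \<le> X" using t by (simp add: X_def)
    have "measure (gauss (multi_indices m ?n)) {a \<in> space (gauss (multi_indices m ?n)). poly_sup_norm m ?n a \<le> sqrt ?N * t m}
      \<le> real (q m * (2 ^ ?n * q m ^ e m)) / (real (q m) ^ ?n * ?T)
      + (?T * std_tail (t m - 2 * r m * t m) + std_tail (2 * t m)) / ?T\<^sup>2 - 1"
      using prob_sup_norm_lower[OF mk q t(1), of "e m"] r(2) unfolding r_def p_def by blast
    also have "sqrt ?N * t m = (1 - \<eta>) * sqrt (?N * xlnx m)" by (simp add: t_def real_sqrt_mult)
    also have "real (q m * (2 ^ ?n * q m ^ e m)) / (real (q m) ^ ?n * ?T) \<le> exp (f m)"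
    proof -
      have pw: "real (q m) ^ j = exp (real j * ln (real (q m)))" for j
        using q by (simp only: exp_of_nat_mult exp_ln of_nat_0_less_iff)
      have pw2: "(2::real) ^ ?n = exp (real ?n * ln 2)" by (simp only: exp_of_nat_mult exp_ln zero_less_numeral)
      have "real (q m * (2 ^ ?n * q m ^ e m)) = real (q m) ^ 1 * 2 ^ ?n * real (q m) ^ e m" by simp
      also have "\<dots> = exp (ln (real (q m)) + real ?n * ln 2 + real (e m) * ln (real (q m)))"
        unfolding pw pw2 exp_add by simp
      finally have num: "real (q m * (2 ^ ?n * q m ^ e m)) = exp (ln (real (q m)) + real ?n * ln 2 + real (e m) * ln (real (q m)))" .
      have "real (q m * (2 ^ ?n * q m ^ e m)) / (real (q m) ^ ?n * ?T)
        = (real (q m * (2 ^ ?n * q m ^ e m)) / real (q m) ^ ?n) * (1 / ?T)" by simp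
      also have "\<dots> \<le> (real (q m * (2 ^ ?n * q m ^ e m)) / real (q m) ^ ?n) * X"
        by (intro mult_left_mono X divide_nonneg_nonneg) auto
      also have "\<dots> = exp (ln (real (q m)) + real ?n * ln 2 + real (e m) * ln (real (q m)) - real ?n * ln (real (q m))) * X"
        unfolding num pw exp_diff ..
      also have "\<dots> \<le> exp (ln (real (q m)) + real ?n * ln 2 + real (e m) * ln (real (q m)) - real ?n * ln (real (q m)))
          * exp ((1 - \<eta>)\<^sup>2 * xlnx m / 2 + ln (27 * (1 + sqrt (xlnx m))))"
      proof (intro mult_left_mono exp_ge_zero)
        show "X \<le> exp ((1 - \<eta>)\<^sup>2 * xlnx m / 2 + ln (27 * (1 + sqrt (xlnx m))))"
        proof -
        have "0 < 27 * (1 + sqrt (xlnx m))" using L by (simp add: add_pos_nonneg)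
        then have "exp ((1 - \<eta>)\<^sup>2 * xlnx m / 2 + ln (27 * (1 + sqrt (xlnx m)))) = exp ((t m)\<^sup>2 / 2) * (27 * (1 + sqrt (xlnx m)))"
          by (simp only: exp_add exp_ln t(3))
        then show ?thesis unfolding X_def using t by (simp add: mult.commute)
        qed
      qed
      also have "\<dots> = exp (f m)" by (simp only: f_def exp_add[symmetric] add.assoc)
      finally show ?thesis .
    qed
    also have "(?T * std_tail (t m - 2 * r m * t m) + std_tail (2 * t m)) / ?T\<^sup>2 \<le> 1 + g m + h m"
    proof -
      \<comment> \<open>After division by the squared tail, the main term is the ratio of the tails
        at \<open>t - H\<close> and \<open>t\<close>, which \<open>std_tail_shift\<close> compares
        with 1.\<close>
      define H where "H = 2 * r m * t m"
      have H: "0 \<le> H" "H \<le> t m" using r t(1) mult_right_mono[of "2 * r m" 1 "t m"] by (simp_all add: H_def)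
      have "std_tail (t m - H) / ?T \<le> (?T + H * (exp (t m * H) * exp (- (t m)\<^sup>2 / 2))) / ?T"
        using T by (intro divide_right_mono std_tail_shift H) auto
      also have "\<dots> = 1 + H * exp (t m * H) * exp (- (t m)\<^sup>2 / 2) * (1 / ?T)"
        using T by (simp add: add_divide_distrib)
      also have "\<dots> \<le> 1 + H * exp (t m * H) * exp (- (t m)\<^sup>2 / 2) * X"
        using H by (intro add_left_mono mult_left_mono X) auto
      also have "\<dots> = 1 + (27 * (1 + t m)) * H * exp (t m * H)" by (simp add: X_def exp_minus)
      also have "\<dots> \<le> 1 + g m"
      proof -
        have tt: "t m * t m \<le> (real m)\<^sup>2" using mult_mono[OF tm tm] t(1) by (simp add: power2_eq_square)
        then have "2 * (r m * (t m * t m)) \<le> 2 * (r m * (real m)\<^sup>2)" using r by (intro mult_left_mono) auto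
        then have "t m * H \<le> 2 * (r m * (real m)\<^sup>2)" by (simp add: H_def mult_ac)
        moreover have "(27 * (1 + t m)) * H \<le> 108 * (r m * (real m)\<^sup>2)"
        proof -
          have "(1 + t m) * t m \<le> (2 * real m) * real m" using tm t m by (intro mult_mono) auto
          then have "54 * r m * ((1 + t m) * t m) \<le> 54 * r m * ((2 * real m) * real m)"
            using r by (intro mult_left_mono) auto
          then show ?thesis by (simp add: H_def power2_eq_square mult_ac)
        qed
        ultimately have "(27 * (1 + t m)) * H * exp (t m * H) \<le> 108 * (r m * (real m)\<^sup>2) * exp (2 * (r m * (real m)\<^sup>2))"
          using r(1) by (intro mult_mono[where c="exp (t m * H)"] exp_ge_zero) (simp_all del: distrib_left_numeral)
        then show ?thesis unfolding g_def by (rule add_left_mono)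
      qed
      finally have 1: "std_tail (t m - H) / ?T \<le> 1 + g m" .
      \<comment> \<open>At the doubled level the tail is at most
        \<open>exp (- 2 * t\<^sup>2)\<close>, whereas the two reciprocals contribute only
        \<open>exp (t\<^sup>2)\<close>; 729 is the square of 27.\<close>
      have "std_tail (2 * t m) * (1 / ?T * (1 / ?T)) \<le> exp (- (2 * t m)\<^sup>2 / 2) * (X * X)"
        using t T X X0 by (intro mult_mono std_tail_upper) auto
      also have "\<dots> = h m"
      proof -
        have "exp (- (2 * t m)\<^sup>2 / 2) * (exp ((t m)\<^sup>2 / 2) * exp ((t m)\<^sup>2 / 2)) = exp (- (t m)\<^sup>2)"
          by (simp flip: exp_add add: power_mult_distrib)
        moreover have "exp (- (2 * t m)\<^sup>2 / 2) * (X * X)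
          = (27 * (1 + t m)) * (27 * (1 + t m)) * (exp (- (2 * t m)\<^sup>2 / 2) * (exp ((t m)\<^sup>2 / 2) * exp ((t m)\<^sup>2 / 2)))"
          unfolding X_def by (simp only: mult_ac)
        ultimately have "exp (- (2 * t m)\<^sup>2 / 2) * (X * X) = (27 * (1 + t m)) * (27 * (1 + t m)) * exp (- (t m)\<^sup>2)"
          by (simp only:)
        moreover have "(27 * x) * (27 * x) * y = 729 * x\<^sup>2 * y" for x y :: real
          by (simp add: power2_eq_square)
        ultimately show ?thesis by (simp only: h_def)
      qed
      finally have 2: "std_tail (2 * t m) / ?T\<^sup>2 \<le> h m" by (simp add: power2_eq_square)
      have "(?T * std_tail (t m - H) + std_tail (2 * t m)) / ?T\<^sup>2 = std_tail (t m - H) / ?T + std_tail (2 * t m) / ?T\<^sup>2"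
        using T by (simp add: add_divide_distrib power2_eq_square)
      then show ?thesis using 1 2 unfolding H_def by linarith
    qed
    finally show ?case by simp
  qed
qed auto

section \<open>The quotient\<close>

lemma lp_norm_scale:
  assumes "p \<noteq> 0" "0 < r"
  shows "lp_norm p I (\<lambda>i\<in>I. complex_of_real r * a i) = r * lp_norm p I a"
proof -
  have "(\<Sum>i\<in>I. cmod ((\<lambda>i\<in>I. complex_of_real r * a i) i) powr p) = r powr p * (\<Sum>i\<in>I. cmod (a i) powr p)"
    using assms by (simp add: norm_mult powr_mult sum_distrib_left)
  then show ?thesis
    using assms by (simp add: lp_norm_def powr_mult sum_nonneg powr_powr)
qed

lemma hom_poly_scale_coeff:
  "hom_poly m n (\<lambda>\<alpha>\<in>multi_indices m n. c * a \<alpha>) z = c * hom_poly m n a z"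
  by (simp add: hom_poly_def sum_distrib_left mult.assoc)

lemma poly_sup_norm_scale:
  assumes r: "0 < r"
  shows "poly_sup_norm m n (\<lambda>\<alpha>\<in>multi_indices m n. complex_of_real r * a \<alpha>) = r * poly_sup_norm m n a"
proof (rule antisym)
  let ?b = "\<lambda>\<alpha>\<in>multi_indices m n. complex_of_real r * a \<alpha>"
  have b: "cmod (hom_poly m n ?b z) = r * cmod (hom_poly m n a z)" for z
    using r by (simp add: hom_poly_scale_coeff norm_mult)
  have up: "cmod (hom_poly m n c z) \<le> poly_sup_norm m n c" if "z \<in> polydisc n" for c z
    unfolding poly_sup_norm_def using that by (intro cSUP_upper bdd_above_hom_poly)
  show "poly_sup_norm m n ?b \<le> r * poly_sup_norm m n a"
    unfolding poly_sup_norm_def[of m n ?b] b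
    using r up by (intro cSUP_least polydisc_nonempty mult_left_mono) auto
  have "poly_sup_norm m n a \<le> poly_sup_norm m n ?b / r"
    unfolding poly_sup_norm_def[of m n a]
  proof (intro cSUP_least polydisc_nonempty)
    fix z assume "z \<in> polydisc n"
    from up[OF this, of ?b] show "cmod (hom_poly m n a z) \<le> poly_sup_norm m n ?b / r"
      unfolding b using r by (simp add: field_simps)
  qed
  then show "r * poly_sup_norm m n a \<le> poly_sup_norm m n ?b" using r by (simp add: field_simps)
qed

lemma R_quot_scale:
  assumes "0 < m" "0 < r"
  shows "R_quot m n (\<lambda>\<alpha>\<in>multi_indices m n. complex_of_real r * a \<alpha>) = R_quot m n a"
proof -
  have "2 * real m / (real m + 1) \<noteq> 0" using assms by simp
  then show ?thesis
    using assms unfolding R_quot_def by (simp add: lp_norm_scale poly_sup_norm_scale)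
qed

lemma measure_mu_eq_gauss:
  assumes m: "0 < m" and n: "0 < n"
  shows "measure (mu m n) {a \<in> space (mu m n). \<epsilon> < \<bar>c * R_quot m n a - d\<bar>}
    = measure (gauss (multi_indices m n)) {a \<in> space (gauss (multi_indices m n)). \<epsilon> < \<bar>c * R_quot m n a - d\<bar>}"
proof -
  let ?I = "multi_indices m n"
  let ?C = "{a \<in> space (coeff_lborel ?I). \<epsilon> < \<bar>c * R_quot m n a - d\<bar>}"
  have "R_quot m n \<in> borel_measurable (coeff_lborel ?I)" unfolding R_quot_def[abs_def] by measurable
  then have "(\<lambda>a. \<bar>c * R_quot m n a - d\<bar>) \<in> borel_measurable (coeff_lborel ?I)" by measurable
  then have "?C \<in> sets (coeff_lborel ?I)" by (rule borel_measurable_less[OF borel_measurable_const])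
  then have "cone ?I ?C"
    using m by (auto simp: cone_def R_quot_scale space_coeff_lborel)
  from normalized_sphere_measure_cone[OF finite_multi_indices multi_indices_nonempty[OF n] this]
  have "measure (mu m n) (?C \<inter> unit_sphere ?I) = measure (gauss ?I) ?C" by (simp only: mu_def)
  moreover have "?C \<inter> unit_sphere ?I = {a \<in> space (mu m n). \<epsilon> < \<bar>c * R_quot m n a - d\<bar>}"
    by (auto simp: space_coeff_lborel unit_sphere_def)
  moreover have "?C = {a \<in> space (gauss ?I). \<epsilon> < \<bar>c * R_quot m n a - d\<bar>}"
    by (simp only: space_gauss space_coeff_lborel)
  ultimately show ?thesis by (simp only:)
qed

text \<open>The exponent \<open>s\<close> of the power sum is the reciprocal of
  \<open>2 * m / (m + 1)\<close>. Its part 1/2 produces \<open>sqrt N\<close>, which cancels against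
  the supremum norm, and its part \<open>1 / (2 * m)\<close> leaves the root of the
  dimension.\<close>

lemma R_quot_bounds:
  assumes m: "2 \<le> m" and N: "0 < N" and \<eta>: "0 < \<eta>" "\<eta> < 1"
    and S: "\<bar>(\<Sum>\<alpha>\<in>multi_indices m n. cmod (a \<alpha>) powr (2 * real m / (real m + 1))) - 2 * N\<bar> \<le> \<eta> * N"
    and sup: "(1 - \<eta>) * sqrt (N * xlnx m) < poly_sup_norm m n a" "poly_sup_norm m n a \<le> (1 + \<eta>) * sqrt (N * xlnx m)"
  shows "N powr (1 / (2 * real m)) * (2 - \<eta>) powr (1 / 2 + 1 / (2 * real m)) / (1 + \<eta>) \<le> sqrt (xlnx m) * R_quot m n a"
    and "sqrt (xlnx m) * R_quot m n a \<le> N powr (1 / (2 * real m)) * (2 + \<eta>) powr (1 / 2 + 1 / (2 * real m)) / (1 - \<eta>)"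
proof -
  define s where "s = 1 / 2 + 1 / (2 * real m)"
  define T where "T = (\<Sum>\<alpha>\<in>multi_indices m n. cmod (a \<alpha>) powr (2 * real m / (real m + 1)))"
  have s: "1 / (2 * real m / (real m + 1)) = s" "0 < s" using m by (simp_all add: s_def field_simps)
  have T: "(2 - \<eta>) * N \<le> T" "T \<le> (2 + \<eta>) * N" using S unfolding T_def abs_le_iff by (simp_all add: algebra_simps)
  have lp: "lp_norm (2 * real m / (real m + 1)) (multi_indices m n) a = T powr s"
    by (simp only: lp_norm_def s T_def)
  have L: "0 < xlnx m" using m by simp
  have NL: "0 < sqrt (N * xlnx m)" using N L by simp
  have sN: "N powr s = sqrt N * N powr (1 / (2 * real m))"
    using N by (simp add: s_def powr_add powr_half_sqrt)
  have R: "sqrt (xlnx m) * R_quot m n a = sqrt (xlnx m) * T powr s / poly_sup_norm m n a"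
    by (simp add: R_quot_def lp)
  have P: "0 < poly_sup_norm m n a"
    using sup(1) NL \<eta> by (intro less_trans[OF _ sup(1)] mult_pos_pos) auto
  have val: "sqrt (xlnx m) * (x * N) powr s / (y * sqrt (N * xlnx m)) = N powr (1 / (2 * real m)) * x powr s / y"
    if "0 < x" for x y
    using that N L m by (simp add: powr_mult sN real_sqrt_mult)
  have "sqrt (xlnx m) * ((2 - \<eta>) * N) powr s / ((1 + \<eta>) * sqrt (N * xlnx m)) \<le> sqrt (xlnx m) * T powr s / poly_sup_norm m n a"
    using T sup P L N \<eta> s by (intro frac_le mult_left_mono powr_mono2) auto
  then show "N powr (1 / (2 * real m)) * (2 - \<eta>) powr (1 / 2 + 1 / (2 * real m)) / (1 + \<eta>) \<le> sqrt (xlnx m) * R_quot m n a"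
    using \<eta> by (simp only: R val s_def) (simp add: val[unfolded s_def])
  have "0 \<le> T" unfolding T_def by (intro sum_nonneg) simp
  then have "sqrt (xlnx m) * T powr s / poly_sup_norm m n a \<le> sqrt (xlnx m) * ((2 + \<eta>) * N) powr s / ((1 - \<eta>) * sqrt (N * xlnx m))"
    using T sup NL L N \<eta> s by (intro frac_le mult_left_mono powr_mono2 mult_pos_pos) auto
  then show "sqrt (xlnx m) * R_quot m n a \<le> N powr (1 / (2 * real m)) * (2 + \<eta>) powr (1 / 2 + 1 / (2 * real m)) / (1 - \<eta>)"
    using \<eta> by (simp only: R val s_def) (simp add: val[unfolded s_def])
qed

theorem theoremE:
  fixes n :: "nat \<Rightarrow> nat"
  assumes "\<And>m. m \<ge> 1 \<Longrightarrow> n m > 0"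
    and "(\<lambda>m. real (n m) / real m) \<longlonglongrightarrow> 1"
  shows "\<forall>\<epsilon>>0. (\<lambda>m. measure (mu m (n m))
           {a \<in> space (mu m (n m)).
              \<bar>sqrt (real m * ln (real m)) * R_quot m (n m) a - 2 * sqrt 2\<bar> > \<epsilon>})
         \<longlonglongrightarrow> 0"
proof (intro allI impI)
  fix \<epsilon> :: real assume \<epsilon>: "0 < \<epsilon>"
  \<comment> \<open>Truncated subtraction is harmless here: \<open>n m\<close> is positive from
    \<open>m = 1\<close> on, so \<open>n m = Suc (k m)\<close> eventually.\<close>
  define k where "k m = n m - 1" for m
  have nk: "n m = Suc (k m)" if "1 \<le> m" for m using assms(1)[OF that] by (simp add: k_def)
  have k: "(\<lambda>m. real (k m) / real m) \<longlonglongrightarrow> 1"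
  proof -
    have "(\<lambda>m. real (n m) / real m - 1 / real m) \<longlonglongrightarrow> 1 - 0"
      by (intro tendsto_diff assms(2) lim_1_over_n)
    moreover have "\<forall>\<^sub>F m in sequentially. real (n m) / real m - 1 / real m = real (k m) / real m"
      using eventually_ge_at_top[of 1] by eventually_elim (simp add: nk add_divide_distrib)
    ultimately show ?thesis by (simp add: Lim_transform_eventually)
  qed
  \<comment> \<open>These are the limits in \<open>m\<close> of the two bounds in
    \<open>R_quot_bounds\<close>. Both tend to \<open>2 * sqrt 2\<close> as \<eta> decreases to 0,
    so \<eta> can be fixed with both within \<epsilon> of it before \<open>m\<close> grows.\<close>
  have "((\<lambda>\<eta>. 2 * sqrt (2 - \<eta>) / (1 + \<eta>)) \<longlongrightarrow> 2 * sqrt 2) (at_right (0::real))"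
    "((\<lambda>\<eta>. 2 * sqrt (2 + \<eta>) / (1 - \<eta>)) \<longlongrightarrow> 2 * sqrt 2) (at_right (0::real))"
    by (auto intro!: tendsto_eq_intros)
  then have "\<forall>\<^sub>F \<eta> in at_right (0::real). 2 * sqrt 2 - \<epsilon> < 2 * sqrt (2 - \<eta>) / (1 + \<eta>)"
    "\<forall>\<^sub>F \<eta> in at_right (0::real). 2 * sqrt (2 + \<eta>) / (1 - \<eta>) < 2 * sqrt 2 + \<epsilon>"
    using \<epsilon> by (auto elim: order_tendstoD)
  moreover have "\<forall>\<^sub>F \<eta> in at_right (0::real). 0 < \<eta> \<and> \<eta> < 1"
    by (simp add: eventually_at_right_field) (use zero_less_one in blast)
  ultimately have "\<forall>\<^sub>F \<eta> in at_right (0::real). 2 * sqrt 2 - \<epsilon> < 2 * sqrt (2 - \<eta>) / (1 + \<eta>) \<and>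
    2 * sqrt (2 + \<eta>) / (1 - \<eta>) < 2 * sqrt 2 + \<epsilon> \<and> 0 < \<eta> \<and> \<eta> < 1"
    by eventually_elim simp
  then obtain \<eta> :: real where \<eta>: "0 < \<eta>" "\<eta> < 1"
    "2 * sqrt 2 - \<epsilon> < 2 * sqrt (2 - \<eta>) / (1 + \<eta>)" "2 * sqrt (2 + \<eta>) / (1 - \<eta>) < 2 * sqrt 2 + \<epsilon>"
    using eventually_happens'[OF trivial_limit_at_right_real] by blast
  let ?I = "\<lambda>m. multi_indices m (Suc (k m))"
  let ?l = "\<lambda>m. dimension k m powr (1 / (2 * real m)) * (2 - \<eta>) powr (1 / 2 + 1 / (2 * real m)) / (1 + \<eta>)"
  let ?u = "\<lambda>m. dimension k m powr (1 / (2 * real m)) * (2 + \<eta>) powr (1 / 2 + 1 / (2 * real m)) / (1 - \<eta>)"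
  have s: "(\<lambda>m. 1 / 2 + 1 / (2 * real m)) \<longlonglongrightarrow> 1 / 2" by real_asymp
  have pw: "(\<lambda>m. x powr (1 / 2 + 1 / (2 * real m))) \<longlonglongrightarrow> sqrt x" if "0 < x" for x
    using tendsto_powr[OF tendsto_const s, of x] that by (simp add: powr_half_sqrt)
  have "?l \<longlonglongrightarrow> 2 * sqrt (2 - \<eta>) / (1 + \<eta>)" "?u \<longlonglongrightarrow> 2 * sqrt (2 + \<eta>) / (1 - \<eta>)"
    using \<eta> by (intro tendsto_divide tendsto_mult dimension_root[OF k] pw tendsto_const; simp)+
  then have l: "\<forall>\<^sub>F m in sequentially. 2 * sqrt 2 - \<epsilon> < ?l m" and u: "\<forall>\<^sub>F m in sequentially. ?u m < 2 * sqrt 2 + \<epsilon>"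
    using \<eta> by (auto elim: order_tendstoD)
  let ?B1 = "\<lambda>m. {a \<in> space (gauss (?I m)). \<eta> * dimension k m <
    \<bar>(\<Sum>\<alpha>\<in>?I m. cmod (a \<alpha>) powr (2 * real m / (real m + 1))) - 2 * dimension k m\<bar>}"
  let ?B2 = "\<lambda>m. {a \<in> space (gauss (?I m)). (1 + \<eta>) * sqrt (dimension k m * xlnx m) < poly_sup_norm m (Suc (k m)) a}"
  let ?B3 = "\<lambda>m. {a \<in> space (gauss (?I m)). poly_sup_norm m (Suc (k m)) a \<le> (1 - \<eta>) * sqrt (dimension k m * xlnx m)}"
  let ?P = "\<lambda>m. measure (gauss (?I m))"
  show "(\<lambda>m. measure (mu m (n m)) {a \<in> space (mu m (n m)).
      \<bar>sqrt (real m * ln (real m)) * R_quot m (n m) a - 2 * sqrt 2\<bar> > \<epsilon>}) \<longlonglongrightarrow> 0"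
  proof (rule tendsto_sandwich[where f="\<lambda>_. 0" and h="\<lambda>m. ?P m (?B1 m) + ?P m (?B2 m) + ?P m (?B3 m)"])
    have "(\<lambda>m. ?P m (?B1 m) + ?P m (?B2 m) + ?P m (?B3 m)) \<longlonglongrightarrow> 0 + 0 + 0"
      using \<eta> by (intro tendsto_add power_sum_in_prob[OF k] sup_norm_upper_in_prob[OF k] sup_norm_lower_in_prob[OF k]) auto
    then show "(\<lambda>m. ?P m (?B1 m) + ?P m (?B2 m) + ?P m (?B3 m)) \<longlonglongrightarrow> 0" by simp
    show "\<forall>\<^sub>F m in sequentially. measure (mu m (n m)) {a \<in> space (mu m (n m)).
      \<bar>sqrt (real m * ln (real m)) * R_quot m (n m) a - 2 * sqrt 2\<bar> > \<epsilon>} \<le> ?P m (?B1 m) + ?P m (?B2 m) + ?P m (?B3 m)"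
      using l u eventually_ge_at_top[of 2]
    proof eventually_elim
      case (elim m)
      interpret prob_space "gauss (?I m)" by (rule prob_space_gauss)
      have N: "0 < dimension k m" by (rule dimension_pos[OF k])
      let ?C = "{a \<in> space (gauss (?I m)). \<epsilon> < \<bar>sqrt (xlnx m) * R_quot m (Suc (k m)) a - 2 * sqrt 2\<bar>}"
      have "(\<lambda>a. cmod (a \<alpha>) powr (2 * real m / (real m + 1))) \<in> borel_measurable (gauss (?I m))" if "\<alpha> \<in> ?I m" for \<alpha>
        using measurable_gauss_coord[OF that] by measurable
      then have "(\<lambda>a. \<bar>(\<Sum>\<alpha>\<in>?I m. cmod (a \<alpha>) powr (2 * real m / (real m + 1))) - 2 * dimension k m\<bar>)
          \<in> borel_measurable (gauss (?I m))"
        by (intro borel_measurable_abs borel_measurable_diff borel_measurable_sum borel_measurable_const)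
      then have B1: "?B1 m \<in> events" by (rule borel_measurable_less[OF borel_measurable_const])
      note B = B1 sets_poly_sup_norm
      \<comment> \<open>Outside the three exceptional events the scaled quotient lies between
        \<open>?l m\<close> and \<open>?u m\<close>, and both are already within \<epsilon> of the
        limit on the relevant side.\<close>
      have "?C \<subseteq> ?B1 m \<union> ?B2 m \<union> ?B3 m"
      proof (rule subsetI, rule ccontr)
        fix a assume a: "a \<in> ?C" "a \<notin> ?B1 m \<union> ?B2 m \<union> ?B3 m"
        then have "?l m \<le> sqrt (xlnx m) * R_quot m (Suc (k m)) a" "sqrt (xlnx m) * R_quot m (Suc (k m)) a \<le> ?u m"
          by (intro R_quot_bounds[OF _ N \<eta>(1,2)] elim; auto simp: not_less)+
        then show False using a(1) elim by (auto simp: abs_if split: if_splits)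
      qed
      then have "prob ?C \<le> prob (?B1 m \<union> ?B2 m \<union> ?B3 m)"
        by (intro finite_measure_mono sets.Un B)
      also have "\<dots> \<le> prob (?B1 m \<union> ?B2 m) + prob (?B3 m)" by (intro measure_Un_le sets.Un B)
      also have "\<dots> \<le> prob (?B1 m) + prob (?B2 m) + prob (?B3 m)"
        by (intro add_right_mono measure_Un_le B)
      finally show ?case
        using measure_mu_eq_gauss[of m "n m" \<epsilon> "sqrt (xlnx m)" "2 * sqrt 2"] nk[of m] elim by simp
    qed
  qed auto
qed

end
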